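(* Let $\sigma$ be a periodic labelling, and $G_\sigma$ the corresponding subgroup of $\mathrm{Homeo}^+(\mathbf{R})$. Then for some positive integer $n$ there exists a short exact sequence of groups $$1\to \mathbf{Z}\to G_\sigma\to T(n)\to 1.$$
   Context: For a positive integer $n$, let $C(n)=[0,n]/\{0,n\}$ be the circle obtained by gluing the endpoints of $[0,n]$. $T(n)$ is the group of (orientation-preserving) piecewise linear homeomorphisms $f:C(n)\to C(n)$ such that: $f$ is differentiable except at finitely many points; wherever $f'(x)$ exists it is an integer power of $2$; wherever $f'$ does not exist at $x$, both $x$ and $f(x)$ are dyadic rationals; and the image of $0$ under $f$ is a dyadic rational. Maps act on the right: $x\cdot f$ is the image of $x$ under $f$, and $fg$ means first $f$, then $g$. $\mathrm{Supp}(f)=\{x : x\cdot f\neq x\}$. Thompson's group $F$ is the group of piecewise linear orientation-preserving homeomorphisms of $[0,1]$ that are differentiable except at finitely many dyadic rationals and whose derivatives, where they exist, are integer powers of $2$; $F'=[F,F]$. For dyadic rationals $0\le r<s\le 1$, $F_{[r,s]}$ is the subgroup of elements of $F$ with support in $[r,s]$. Let $\iota_0$ be the map $t\mapsto 1-t$ of $[0,1]$. Fix $c_0\in F$ with $\mathrm{Supp}(c_0)=(0,\tfrac14)$, $x\cdot c_0>x$ for all $x\in(0,\tfrac14)$, and $t\cdot c_0=2t$ for $t\in(0,\tfrac1{16})$. Put $c_1=\iota_0 c_0\iota_0$ and $\nu_1=c_0c_1$. Fix homeomorphisms $\nu_2,\nu_3$ of $[0,1]$ with supports in $(\tfrac1{16},\tfrac{15}{16})$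 that generate $F_{[1/16,15/16]}$. Let $H=\langle F',\nu_1\rangle=\langle \nu_1,\nu_2,\nu_3\rangle$. A labelling is a map $\sigma:\tfrac12\mathbf{Z}\to\{a,b,a^{-1},b^{-1}\}$ with $\sigma(k)\in\{a,a^{-1}\}$ for $k\in\mathbf{Z}$ and $\sigma(k)\in\{b,b^{-1}\}$ for $k\in\tfrac12\mathbf{Z}\setminus\mathbf{Z}$. It is periodic if there is a positive integer $p$ with $\sigma(j+p)=\sigma(j)$ for all $j\in\tfrac12\mathbf{Z}$. For a labelling $\sigma$ and $i\in\{1,2,3\}$ define homeomorphisms $\zeta_i,\chi_i$ of $\mathbf{R}$ by: for $n\in\mathbf{Z}$, $t\in[0,1]$, $(n+t)\cdot\zeta_i=n+t\cdot\nu_i$ if $\sigma(n+\tfrac12)=b$ and $(n+t)\cdot\zeta_i=n+t\cdot(\iota_0\nu_i\iota_0)$ if $\sigma(n+\tfrac12)=b^{-1}$; $(n-\tfrac12+t)\cdot\chi_i=n-\tfrac12+t\cdot\nu_i$ if $\sigma(n)=a$ and $(n-\tfrac12+t)\cdot\chi_i=n-\tfrac12+t\cdot(\iota_0\nu_i\iota_0)$ if $\sigma(n)=a^{-1}$. Then $G_\sigma=\langle\zeta_1,\zeta_2,\zeta_3,\chi_1,\chi_2,\chi_3\rangle<\mathrm{Homeo}^+(\mathbf{R})$. *)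

theory Defs
  imports "HOL-Analysis.Analysis" "HOL-Algebra.Exact_Sequence"
begin

section \<open>Homeomorphism groups acting on the right\<close>

text \<open>The product \<open>f \<otimes> g\<close> is ``first \<open>f\<close>, then \<open>g\<close>''. As in \<open>BijGroup\<close>, maps are
  extensional, so that equal maps are equal as HOL functions.\<close>

definition homeo_group :: "'a topology \<Rightarrow> ('a \<Rightarrow> 'a) monoid" where
  "homeo_group X =
     \<lparr>carrier = {f \<in> extensional (topspace X). homeomorphic_map X X f},
      monoid.mult = (\<lambda>f g. compose (topspace X) g f),
      one = (\<lambda>x\<in>topspace X. x)\<rparr>"

abbreviation Homeo_I :: "(real \<Rightarrow> real) monoid" where
  "Homeo_I \<equiv> homeo_group (top_of_set {0..1})"

definition Homeo_plus_R :: "(real \<Rightarrow> real) monoid" where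
  "Homeo_plus_R = (homeo_group euclideanreal)
     \<lparr>carrier := {f \<in> carrier (homeo_group euclideanreal). strict_mono f}\<rparr>"

section \<open>Thompson's group \<open>F\<close>\<close>

text \<open>\<open>S\<close> is the set of breakpoints; as the pieces are closed intervals, \<open>f\<close> is continuous.\<close>

definition piecewise_linear :: "real \<Rightarrow> real \<Rightarrow> (real \<Rightarrow> real) \<Rightarrow> bool" where
  "piecewise_linear a b f \<longleftrightarrow>
     (\<exists>S. finite S \<and>
        (\<forall>u v. a \<le> u \<and> u < v \<and> v \<le> b \<and> {u<..<v} \<inter> S = {} \<longrightarrow>
           (\<exists>m c. \<forall>t\<in>{u..v}. f t = m * t + c)))"

text \<open>The library's \<open>dyadics\<close> contains only the nonnegative dyadic rationals; it is
  used here only for points of \<open>[0,1]\<close> and of \<open>[0,n]\<close>. Derivatives at the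
  endpoints of \<open>[0,1]\<close> are one-sided.\<close>

definition thompson_F :: "(real \<Rightarrow> real) set" where
  "thompson_F = {f \<in> carrier Homeo_I.
     strict_mono_on {0..1} f \<and> piecewise_linear 0 1 f \<and>
     (\<exists>S. finite S \<and> S \<subseteq> dyadics \<and>
        (\<forall>x\<in>{0..1} - S. \<exists>d. (f has_real_derivative d) (at x within {0..1}))) \<and>
     (\<forall>x\<in>{0..1}. \<forall>d. (f has_real_derivative d) (at x within {0..1}) \<longrightarrow>
        (\<exists>k::int. d = 2 powi k))}"

definition supp_I :: "(real \<Rightarrow> real) \<Rightarrow> real set" where
  "supp_I f = {x \<in> {0..1}. f x \<noteq> x}"

definition thompson_F_on :: "real \<Rightarrow> real \<Rightarrow> (real \<Rightarrow> real) set" where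
  "thompson_F_on r s = {f \<in> thompson_F. supp_I f \<subseteq> {r..s}}"

section \<open>The circle \<open>C(n)\<close> and the group \<open>T(n)\<close>\<close>

definition quotient_topology :: "'a topology \<Rightarrow> ('a \<Rightarrow> 'b) \<Rightarrow> 'b topology" where
  "quotient_topology X q =
     topology (\<lambda>U. U \<subseteq> q ` topspace X \<and> openin X {x \<in> topspace X. q x \<in> U})"

lemma openin_quotient_topology:
  "openin (quotient_topology X q) U \<longleftrightarrow>
     U \<subseteq> q ` topspace X \<and> openin X {x \<in> topspace X. q x \<in> U}"
proof -
  have "istopology (\<lambda>U. U \<subseteq> q ` topspace X \<and> openin X {x \<in> topspace X. q x \<in> U})"
    unfolding istopology_def
  proof (intro conjI allI impI)
    fix S T
    assume S: "S \<subseteq> q ` topspace X \<and> openin X {x \<in> topspace X. q x \<in> S}"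
      and T: "T \<subseteq> q ` topspace X \<and> openin X {x \<in> topspace X. q x \<in> T}"
    then show "S \<inter> T \<subseteq> q ` topspace X" by blast
    have "{x \<in> topspace X. q x \<in> S \<inter> T} =
        {x \<in> topspace X. q x \<in> S} \<inter> {x \<in> topspace X. q x \<in> T}" by blast
    then show "openin X {x \<in> topspace X. q x \<in> S \<inter> T}"
      using S T by (simp only: openin_Int)
  next
    fix \<K>
    assume K: "\<forall>K\<in>\<K>. K \<subseteq> q ` topspace X \<and> openin X {x \<in> topspace X. q x \<in> K}"
    then show "\<Union>\<K> \<subseteq> q ` topspace X" by blast
    have "{x \<in> topspace X. q x \<in> \<Union>\<K>} = (\<Union>K\<in>\<K>. {x \<in> topspace X. q x \<in> K})" by blast
    moreover have "openin X (\<Union>K\<in>\<K>. {x \<in> topspace X. q x \<in> K})"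
      using K by (intro openin_Union) blast
    ultimately show "openin X {x \<in> topspace X. q x \<in> \<Union>\<K>}" by (simp only:)
  qed
  from topology_inverse'[OF this] show ?thesis
    unfolding quotient_topology_def by (rule fun_cong)
qed

lemma topspace_quotient_topology [simp]:
  "topspace (quotient_topology X q) = q ` topspace X"
proof (rule subset_antisym)
  show "topspace (quotient_topology X q) \<subseteq> q ` topspace X"
    by (rule openin_quotient_topology[THEN iffD1, OF openin_topspace, THEN conjunct1])
  have "{x \<in> topspace X. q x \<in> q ` topspace X} = topspace X" by blast
  then have "openin X {x \<in> topspace X. q x \<in> q ` topspace X}"
    by (simp only: openin_topspace)
  then have "openin (quotient_topology X q) (q ` topspace X)"
    by (intro openin_quotient_topology[THEN iffD2] conjI subset_refl)
  then show "q ` topspace X \<subseteq> topspace (quotient_topology X q)"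
    by (rule openin_subset)
qed

lemma quotient_map_quotient_topology: "quotient_map X (quotient_topology X q) q"
  unfolding quotient_map_def topspace_quotient_topology openin_quotient_topology
  by (intro conjI refl allI impI iffI) (simp_all only: simp_thms)

text \<open>The points of \<open>C(n)\<close> are the equivalence classes \<open>{0,n}\<close> and \<open>{x}\<close> for \<open>0 < x < n\<close>.\<close>

definition glue :: "nat \<Rightarrow> real \<Rightarrow> real set" where
  "glue n x = (if x = 0 \<or> x = real n then {0, real n} else {x})"

definition circle :: "nat \<Rightarrow> real set topology" where
  "circle n = quotient_topology (top_of_set {0..real n}) (glue n)"

text \<open>The \<open>n\<close>-periodic extension of \<open>glue n\<close> to the universal cover of \<open>C(n)\<close>.\<close>

definition cover :: "nat \<Rightarrow> real \<Rightarrow> real set" where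
  "cover n x = glue n (x - real n * of_int \<lfloor>x / real n\<rfloor>)"

definition circle_dyadic :: "real set \<Rightarrow> bool" where
  "circle_dyadic p \<longleftrightarrow> p \<subseteq> dyadics"

text \<open>The circle carries the smooth structure for which \<open>cover n\<close> is a local
  diffeomorphism: the derivative of \<open>f\<close> at \<open>p\<close> is that of any local lift of \<open>f\<close>.\<close>

definition has_circle_derivative ::
  "nat \<Rightarrow> (real set \<Rightarrow> real set) \<Rightarrow> real \<Rightarrow> real set \<Rightarrow> bool" where
  "has_circle_derivative n f d p \<longleftrightarrow>
     (\<exists>x g. cover n x = p \<and>
        (\<forall>\<^sub>F y in nhds x. cover n (g y) = f (cover n y)) \<and>
        (g has_real_derivative d) (at x))"

definition circle_lift :: "nat \<Rightarrow> (real set \<Rightarrow> real set) \<Rightarrow> (real \<Rightarrow> real) \<Rightarrow> bool" where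
  "circle_lift n f g \<longleftrightarrow> continuous_on {0..real n} g \<and>
     (\<forall>x\<in>{0..real n}. cover n (g x) = f (glue n x))"

definition thompson_T :: "nat \<Rightarrow> (real set \<Rightarrow> real set) set" where
  "thompson_T n = {f \<in> carrier (homeo_group (circle n)).
     (\<exists>g. circle_lift n f g \<and> strict_mono_on {0..real n} g \<and> piecewise_linear 0 (real n) g) \<and>
     finite {p \<in> topspace (circle n). \<nexists>d. has_circle_derivative n f d p} \<and>
     (\<forall>p \<in> topspace (circle n). \<forall>d. has_circle_derivative n f d p \<longrightarrow>
        (\<exists>k::int. d = 2 powi k)) \<and>
     (\<forall>p \<in> topspace (circle n). (\<nexists>d. has_circle_derivative n f d p) \<longrightarrow>
        circle_dyadic p \<and> circle_dyadic (f p)) \<and>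
     circle_dyadic (f (glue n 0))}"

definition T_group :: "nat \<Rightarrow> (real set \<Rightarrow> real set) monoid" where
  "T_group n = (homeo_group (circle n))\<lparr>carrier := thompson_T n\<rparr>"

section \<open>Labellings and the groups \<open>G\<^sub>\<sigma>\<close>\<close>

datatype letter = La | Lb | La_inv | Lb_inv

definition half_integers :: "real set" where
  "half_integers = {x. \<exists>k::int. x = of_int k / 2}"

text \<open>Only the values of \<open>\<sigma>\<close> on \<open>half_integers\<close> matter.\<close>

definition labelling :: "(real \<Rightarrow> letter) \<Rightarrow> bool" where
  "labelling \<sigma> \<longleftrightarrow> (\<forall>k\<in>\<int>. \<sigma> k \<in> {La, La_inv}) \<and>
     (\<forall>k\<in>half_integers - \<int>. \<sigma> k \<in> {Lb, Lb_inv})"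

definition periodic_labelling :: "(real \<Rightarrow> letter) \<Rightarrow> bool" where
  "periodic_labelling \<sigma> \<longleftrightarrow> labelling \<sigma> \<and>
     (\<exists>p::nat. p > 0 \<and> (\<forall>j\<in>half_integers. \<sigma> (j + real p) = \<sigma> j))"

definition flip :: "real \<Rightarrow> real" where
  "flip = (\<lambda>t\<in>{0..1}. 1 - t)"

definition flip_conj :: "(real \<Rightarrow> real) \<Rightarrow> real \<Rightarrow> real" where
  "flip_conj f = flip \<otimes>\<^bsub>Homeo_I\<^esub> f \<otimes>\<^bsub>Homeo_I\<^esub> flip"

definition nu1 :: "(real \<Rightarrow> real) \<Rightarrow> real \<Rightarrow> real" where
  "nu1 c0 = c0 \<otimes>\<^bsub>Homeo_I\<^esub> flip_conj c0"

text \<open>Writing a real number as \<open>n + t\<close> with \<open>n = \<lfloor>x\<rfloor>\<close> and \<open>t = frac x\<close> loses nothing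
  against allowing \<open>t = 1\<close>: all the \<open>\<nu>\<close> below fix \<open>0\<close> and \<open>1\<close>.\<close>

definition zeta :: "(real \<Rightarrow> letter) \<Rightarrow> (real \<Rightarrow> real) \<Rightarrow> real \<Rightarrow> real" where
  "zeta \<sigma> \<nu> x = (let n = of_int \<lfloor>x\<rfloor>; t = x - n in
     if \<sigma> (n + 1/2) = Lb then n + \<nu> t else n + flip_conj \<nu> t)"

definition chi :: "(real \<Rightarrow> letter) \<Rightarrow> (real \<Rightarrow> real) \<Rightarrow> real \<Rightarrow> real" where
  "chi \<sigma> \<nu> x = (let n = of_int \<lfloor>x + 1/2\<rfloor>; t = x - (n - 1/2) in
     if \<sigma> n = La then n - 1/2 + \<nu> t else n - 1/2 + flip_conj \<nu> t)"

definition G_group ::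
  "(real \<Rightarrow> real) \<Rightarrow> (real \<Rightarrow> real) \<Rightarrow> (real \<Rightarrow> real) \<Rightarrow> (real \<Rightarrow> letter) \<Rightarrow> (real \<Rightarrow> real) monoid" where
  "G_group \<nu>\<^sub>1 \<nu>\<^sub>2 \<nu>\<^sub>3 \<sigma> = subgroup_generated Homeo_plus_R
     {zeta \<sigma> \<nu>\<^sub>1, zeta \<sigma> \<nu>\<^sub>2, zeta \<sigma> \<nu>\<^sub>3, chi \<sigma> \<nu>\<^sub>1, chi \<sigma> \<nu>\<^sub>2, chi \<sigma> \<nu>\<^sub>3}"

section \<open>Short exact sequences\<close>

text \<open>The library's \<open>short_exact_sequence\<close> requires the three groups to have the same
  element type; this is its characterization \<open>short_exact_sequence_iff\<close> without that
  restriction, with the arrows from left to right.\<close>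

definition short_exact ::
  "('a, 'm) monoid_scheme \<Rightarrow> ('b, 'n) monoid_scheme \<Rightarrow> ('c, 'o) monoid_scheme \<Rightarrow>
   ('a \<Rightarrow> 'b) \<Rightarrow> ('b \<Rightarrow> 'c) \<Rightarrow> bool" where
  "short_exact A B C f g \<longleftrightarrow> Group.group A \<and> Group.group B \<and> Group.group C \<and>
     f \<in> mon A B \<and> g \<in> epi B C \<and> f ` carrier A = kernel B C g"

end

theory Submission
  imports Defs
begin

text \<open>Let \<open>n\<close> be the minimal period of \<open>\<sigma>\<close>. The theorem follows from the identification of \<open>G\<^sub>\<sigma>\<close> with
  the group of all piecewise dyadic affine homeomorphisms of the line that commute with \<open>x \<mapsto> x + n\<close>:
  these are exactly the lifts of the elements of \<open>T(n)\<close>, and the lifts of the identity are the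
  translations by multiples of \<open>n\<close>.

  Every generator clearly is such a homeomorphism. Conversely, an element of \<open>F'\<close> supported in one
  half of the unit interval acts, through \<open>\<zeta>\<close> or \<open>\<chi>\<close>, on half-intervals with a prescribed label at
  one of their ends. Since compactly supported groups are perfect, taking commutators intersects such
  conditions on labels, and conjugating by \<open>\<zeta>\<close> or \<open>\<chi>\<close> transports them to the neighbouring
  half-interval. So \<open>G\<^sub>\<sigma>\<close> contains maps acting on just those half-intervals which see the same labels as a
  given one; by minimality of \<open>n\<close> these are its translates by multiples of \<open>n\<close>. Fragmentation then
  produces all periodic homeomorphisms. Perfectness is a by-product of the two generators of
  \<open>F\<^bsub>[1/16,15/16]\<^esub>\<close>: its abelianization is generated by two elements and maps onto \<open>\<int>\<^sup>2\<close> by the slopes at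
  the end points, hence is \<open>\<int>\<^sup>2\<close>.\<close>

section \<open>Dyadic rationals and affine dyadic maps\<close>

text \<open>A generator moves all unit intervals of its kind at once, and the labels only decide
  between a map and its mirror image. The difficulty is to act on one orbit of half-intervals under
  \<open>x \<mapsto> x + n\<close> and on nothing else. Half-intervals are the natural pieces
  because each is the overlap of a unit interval around an integer and one around a half-odd
  integer, so two labels are visible on it. Commutators compare what is visible, and conjugation
  looks one label further. Two half-intervals resist separation only if the labelling looks the same
  from both for ever. In the same direction this is a translational period; in opposite directions
  it is a reflection, and none exists because the inversion of letters has no fixed point. Supports
  are kept compact inside open intervals, since only then are the slopes at the ends trivial and
  perfectness available. Slopes that are powers of 2 do not alone make a map respect dyadic points;
  one dyadic point with dyadic image does, and for \<open>T(n)\<close> that point is 0.\<close>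

definition dyad :: "real set" where
  "dyad = {x. \<exists>(m::int) (k::nat). x = of_int m / 2 ^ k}"

lemma dyad_of_int [simp]: "of_int m \<in> dyad"
  unfolding dyad_def by (rule CollectI, rule exI[of _ m], rule exI[of _ 0]) simp

lemma dyad_add: assumes "x \<in> dyad" "y \<in> dyad" shows "x + y \<in> dyad"
proof -
  obtain m k n l where "x = of_int m / 2 ^ k" "y = of_int n / 2 ^ l"
    using assms unfolding dyad_def by auto
  then have "x + y = of_int (m * 2 ^ l + n * 2 ^ k) / 2 ^ (k + l)"
    by (simp add: add_frac_eq power_add)
  then show ?thesis unfolding dyad_def by blast
qed

lemma dyad_uminus: assumes "x \<in> dyad" shows "- x \<in> dyad"
proof -
  obtain m k where "x = of_int m / 2 ^ k" using assms unfolding dyad_def by auto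
  then have "- x = of_int (- m) / 2 ^ k" by simp
  then show ?thesis unfolding dyad_def by blast
qed

lemma dyad_diff: "x \<in> dyad \<Longrightarrow> y \<in> dyad \<Longrightarrow> x - y \<in> dyad"
  using dyad_add[of x "- y"] dyad_uminus[of y] by simp

lemma dyad_mult: assumes "x \<in> dyad" "y \<in> dyad" shows "x * y \<in> dyad"
proof -
  obtain m k n l where "x = of_int m / 2 ^ k" "y = of_int n / 2 ^ l"
    using assms unfolding dyad_def by auto
  then have "x * y = of_int (m * n) / 2 ^ (k + l)" by (simp add: power_add)
  then show ?thesis unfolding dyad_def by blast
qed

lemma dyad_powi: "(2::real) powi k \<in> dyad"
proof (cases "k \<ge> 0")
  case True
  then have "(2::real) powi k = of_int (2 ^ nat k) / 2 ^ 0" by (simp add: power_int_def)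
  then show ?thesis unfolding dyad_def by blast
next
  case False
  then have "(2::real) powi k = of_int 1 / 2 ^ nat (- k)"
    by (simp add: power_int_def divide_simps)
  then show ?thesis unfolding dyad_def by blast
qed

lemma dyad_powi_mult_iff [simp]: "2 powi k * x \<in> dyad \<longleftrightarrow> x \<in> dyad"
proof
  assume "2 powi k * x \<in> dyad"
  then have "2 powi (- k) * (2 powi k * x) \<in> dyad" by (rule dyad_mult[OF dyad_powi])
  moreover have "2 powi (- k) * (2 powi k * x) = x" by (simp add: power_int_minus field_simps)
  ultimately show "x \<in> dyad" by metis
next
  assume "x \<in> dyad"
  then show "2 powi k * x \<in> dyad" by (intro dyad_mult dyad_powi)
qed

lemma dyad_add_iff: "y \<in> dyad \<Longrightarrow> x + y \<in> dyad \<longleftrightarrow> x \<in> dyad"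
  using dyad_add[of x y] dyad_diff[of "x + y" y] by auto

lemma dyad_numeral [simp]: "numeral w \<in> dyad" "1 \<in> dyad" "0 \<in> dyad"
  using dyad_of_int[of "numeral w"] dyad_of_int[of 1] dyad_of_int[of 0] by simp_all

lemma dyad_half: "x \<in> dyad \<Longrightarrow> x / 2 \<in> dyad"
  using dyad_powi_mult_iff[of "-1" x] by (simp add: power_int_minus)

lemma dyad_half_int [simp]: "of_int m / 2 \<in> dyad"
  by (intro dyad_half) auto

lemma dyad_fraction [simp]: "1 / 2 \<in> dyad" "1 / 4 \<in> dyad" "1 / 16 \<in> dyad" "15 / 16 \<in> dyad"
proof -
  have "of_int 1 / 2 ^ 1 \<in> dyad" "of_int 1 / 2 ^ 2 \<in> dyad"
    "of_int 1 / 2 ^ 4 \<in> dyad" "of_int 15 / 2 ^ 4 \<in> dyad" unfolding dyad_def by blast+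
  then show "1 / 2 \<in> dyad" "1 / 4 \<in> dyad" "1 / 16 \<in> dyad" "15 / 16 \<in> dyad" by simp_all
qed

lemma dyad_dense: assumes "(x::real) < y" shows "\<exists>z\<in>dyad. x < z \<and> z < y"
proof -
  obtain k where k: "(1/2) ^ k < y - x" using real_arch_pow_inv[of "y - x" "1/2"] assms by auto
  define m where "m = \<lfloor>x * 2 ^ k\<rfloor> + 1"
  have 1: "x * 2 ^ k < of_int m" "of_int m \<le> x * 2 ^ k + 1" unfolding m_def by linarith+
  have "1 < (y - x) * 2 ^ k" using k by (simp add: field_simps power_divide)
  with 1 have "x < of_int m / 2 ^ k" "of_int m / 2 ^ k < y" by (simp_all add: field_simps)
  moreover have "of_int m / 2 ^ k \<in> dyad" unfolding dyad_def by blast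
  ultimately show ?thesis by blast
qed

lemma dyad_nonneg: assumes "x \<in> dyad" "0 \<le> x" shows "x \<in> dyadics"
proof -
  obtain m k where x: "x = of_int m / 2 ^ k" using assms unfolding dyad_def by auto
  have "0 \<le> x * 2 ^ k" using assms by simp
  then have "m \<ge> 0" using x by simp
  then have "x = of_nat (nat m) / 2 ^ k" using x by simp
  then show ?thesis unfolding dyadics_def by blast
qed

lemma dyadics_dyad: "(x::real) \<in> dyadics \<Longrightarrow> x \<in> dyad"
  unfolding dyadics_def dyad_def by (force intro: exI[where x="int _"])

text \<open>The orientation-preserving affine group of the ring of dyadic rationals, whose positive
  units are the powers of 2.\<close>

definition dyad_affine :: "(real \<Rightarrow> real) set" where
  "dyad_affine = {a. \<exists>k c. c \<in> dyad \<and> a = (\<lambda>y. 2 powi k * y + c)}"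

lemma dyad_affineI: "c \<in> dyad \<Longrightarrow> (\<lambda>y. 2 powi k * y + c) \<in> dyad_affine"
  unfolding dyad_affine_def by blast

lemma dyad_affine_id: "(\<lambda>y. y) \<in> dyad_affine"
  using dyad_affineI[of 0 0] by simp

lemma dyad_affine_translation: "c \<in> dyad \<Longrightarrow> (\<lambda>y. y + c) \<in> dyad_affine"
  using dyad_affineI[of c 0] by simp

lemma dyad_affine_comp:
  assumes "a \<in> dyad_affine" "b \<in> dyad_affine" shows "(\<lambda>y. a (b y)) \<in> dyad_affine"
proof -
  obtain k c l d where "c \<in> dyad" "a = (\<lambda>y. 2 powi k * y + c)" "d \<in> dyad" "b = (\<lambda>y. 2 powi l * y + d)"
    using assms unfolding dyad_affine_def by blast
  moreover from this have "(\<lambda>y. a (b y)) = (\<lambda>y. 2 powi (k + l) * y + (2 powi k * d + c))"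
    by (simp add: fun_eq_iff power_int_add algebra_simps)
  ultimately show ?thesis
    using dyad_affineI[of "2 powi k * d + c" "k + l"] dyad_add[of "2 powi k * d" c] by simp
qed

lemma dyad_affine_inverse:
  assumes "a \<in> dyad_affine" obtains b where "b \<in> dyad_affine" "\<And>y. b (a y) = y" "\<And>y. a (b y) = y"
proof -
  obtain k c where a: "c \<in> dyad" "a = (\<lambda>y. 2 powi k * y + c)"
    using assms unfolding dyad_affine_def by blast
  define b where "b = (\<lambda>y. 2 powi (- k) * y + - (2 powi (- k) * c))"
  have "b \<in> dyad_affine" unfolding b_def using a by (intro dyad_affineI dyad_uminus) simp
  moreover have "b (a y) = y" "a (b y) = y" for y
    unfolding a b_def by (simp_all add: power_int_minus algebra_simps)
  ultimately show ?thesis using that by blast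
qed

lemma dyad_affine_dyad: "a \<in> dyad_affine \<Longrightarrow> a x \<in> dyad \<longleftrightarrow> x \<in> dyad"
  unfolding dyad_affine_def by (auto simp: dyad_add_iff)

lemma dyad_affine_strict_mono: "a \<in> dyad_affine \<Longrightarrow> strict_mono a"
  unfolding dyad_affine_def by (auto simp: strict_mono_def)

lemma dyad_affine_surj: "a \<in> dyad_affine \<Longrightarrow> surj a"
  by (metis dyad_affine_inverse surjI)

lemma dyad_affine_tendsto: "a \<in> dyad_affine \<Longrightarrow> filterlim f (nhds x) F \<Longrightarrow> filterlim (\<lambda>y. a (f y)) (nhds (a x)) F"
  unfolding dyad_affine_def by (auto intro!: tendsto_intros)

section \<open>Piecewise dyadic affine homeomorphisms of the line\<close>

lemma strict_mono_surj_continuous: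
  fixes f :: "real \<Rightarrow> real" assumes "strict_mono f" "surj f"
  shows "continuous_on UNIV f"
  using assms by (intro continuous_onI_mono) (auto simp: strict_mono_less_eq)

lemma strict_mono_surj_tendsto:
  fixes f :: "real \<Rightarrow> real" assumes "strict_mono f" "surj f"
  shows "f \<midarrow>x\<rightarrow> f x"
  using strict_mono_surj_continuous[OF assms] by (simp add: continuous_on_def)

lemma strict_mono_surj_at_right:
  fixes f :: "real \<Rightarrow> real" assumes "strict_mono f" "surj f"
  shows "filterlim f (at_right (f x)) (at_right x)"
proof -
  have "filterlim f (nhds (f x)) (at_right x)"
    using strict_mono_surj_tendsto[OF assms] by (rule tendsto_within_subset) auto
  moreover have "\<forall>\<^sub>F y in at_right x. f y > f x"
    using assms by (auto simp: eventually_at_filter strict_mono_less)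
  ultimately show ?thesis by (auto simp: filterlim_at elim: eventually_mono)
qed

lemma strict_mono_surj_at_left:
  fixes f :: "real \<Rightarrow> real" assumes "strict_mono f" "surj f"
  shows "filterlim f (at_left (f x)) (at_left x)"
proof -
  have "filterlim f (nhds (f x)) (at_left x)"
    using strict_mono_surj_tendsto[OF assms] by (rule tendsto_within_subset) auto
  moreover have "\<forall>\<^sub>F y in at_left x. f y < f x"
    using assms by (auto simp: eventually_at_filter strict_mono_less)
  ultimately show ?thesis by (auto simp: filterlim_at elim: eventually_mono)
qed

lemma inv_strict_mono_surj:
  fixes f :: "real \<Rightarrow> real" assumes "strict_mono f" "surj f"
  shows "strict_mono (inv_into UNIV f)" "surj (inv_into UNIV f)" "f (inv_into UNIV f x) = x" "inv_into UNIV f (f x) = x"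
proof -
  have b: "inj f" using assms(1) strict_mono_imp_inj_on by blast
  then show "surj (inv_into UNIV f)" by (simp add: inj_imp_surj_inv)
  have 1: "f (inv_into UNIV f y) = y" for y using assms(2) by (simp add: surj_f_inv_f)
  then show "f (inv_into UNIV f x) = x" .
  show "inv_into UNIV f (f x) = x" using b by simp
  show "strict_mono (inv_into UNIV f)"
  proof (rule strict_monoI)
    fix u v :: real assume "u < v"
    then have "f (inv_into UNIV f u) < f (inv_into UNIV f v)" unfolding 1 .
    then show "inv_into UNIV f u < inv_into UNIV f v" by (simp add: strict_mono_less[OF assms(1)])
  qed
qed

text \<open>One-sided germs at every point are dyadic affine, with a break only at dyadic points; this
  local form of piecewise linearity is stable under composition, inversion and gluing.\<close>

definition dyad_germs :: "(real \<Rightarrow> real) \<Rightarrow> real \<Rightarrow> (real \<Rightarrow> real) \<Rightarrow> (real \<Rightarrow> real) \<Rightarrow> bool" where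
  "dyad_germs f x a b \<longleftrightarrow> a \<in> dyad_affine \<and> b \<in> dyad_affine \<and> (\<forall>\<^sub>F y in at_left x. f y = a y) \<and>
     (\<forall>\<^sub>F y in at_right x. f y = b y) \<and> (x \<in> dyad \<or> a = b)"

text \<open>Finiteness of the set of breakpoints is not demanded: on a compact interval it follows
  from the existence of one-sided germs, and a periodic map of the line may have infinitely many.
  Continuity follows from \<open>strict_mono\<close> and \<open>surj\<close>.\<close>

definition dyad_PL :: "(real \<Rightarrow> real) set" where
  "dyad_PL = {f. strict_mono f \<and> surj f \<and> (\<forall>x. \<exists>a b. dyad_germs f x a b)}"

lemma dyad_PL_strict_mono: "f \<in> dyad_PL \<Longrightarrow> strict_mono f"
  and dyad_PL_surj: "f \<in> dyad_PL \<Longrightarrow> surj f"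
  and dyad_PL_germs: "f \<in> dyad_PL \<Longrightarrow> \<exists>a b. dyad_germs f x a b"
  by (auto simp: dyad_PL_def)

lemma dyad_germs_value:
  assumes "strict_mono f" "surj f" "dyad_germs f x a b" shows "f x = a x" "f x = b x"
proof -
  have 1: "filterlim f (nhds (f x)) (at_left x)" "filterlim f (nhds (f x)) (at_right x)"
    using strict_mono_surj_tendsto[OF assms(1,2), of x] by (simp_all add: filterlim_at_split)
  have ab: "a \<in> dyad_affine" "b \<in> dyad_affine"
    and ev: "\<forall>\<^sub>F y in at_left x. f y = a y" "\<forall>\<^sub>F y in at_right x. f y = b y"
    using assms(3) by (simp_all add: dyad_germs_def)
  have "filterlim f (nhds (a x)) (at_left x)" "filterlim f (nhds (b x)) (at_right x)"
    using tendsto_cong[OF ev(1), THEN iffD2, OF dyad_affine_tendsto[OF ab(1) tendsto_ident_at]]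
      tendsto_cong[OF ev(2), THEN iffD2, OF dyad_affine_tendsto[OF ab(2) tendsto_ident_at]] .
  with 1 show "f x = a x" "f x = b x"
    using tendsto_unique[of "at_left x" f "f x" "a x"] tendsto_unique[of "at_right x" f "f x" "b x"] by simp_all
qed

lemma dyad_PL_dyad: "f \<in> dyad_PL \<Longrightarrow> f x \<in> dyad \<longleftrightarrow> x \<in> dyad"
proof -
  assume f: "f \<in> dyad_PL"
  then obtain a b where ab: "dyad_germs f x a b" using dyad_PL_germs by blast
  then have "f x = a x" using f by (intro dyad_germs_value(1) dyad_PL_strict_mono dyad_PL_surj)
  moreover have "a \<in> dyad_affine" using ab by (simp add: dyad_germs_def)
  ultimately show ?thesis using dyad_affine_dyad[of a x] by simp
qed

lemma eventually_eq_trans: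
  "\<forall>\<^sub>F y in F. f y = g y \<Longrightarrow> \<forall>\<^sub>F y in F. g y = h y \<Longrightarrow> \<forall>\<^sub>F y in F. f y = h y"
  by (simp add: eventually_elim2[of "\<lambda>y. f y = g y" F "\<lambda>y. g y = h y"])

lemma eventually_eq_comp:
  assumes "\<forall>\<^sub>F y in G. f y = c y" "filterlim g G F" "\<forall>\<^sub>F y in F. g y = a y"
  shows "\<forall>\<^sub>F y in F. f (g y) = c (a y)"
proof (rule eventually_elim2)
  show "\<forall>\<^sub>F y in F. f (g y) = c (g y)"
    by (rule eventually_compose_filterlim[OF assms(1,2)])
  show "\<forall>\<^sub>F y in F. g y = a y" by fact
qed simp

text \<open>An increasing homeomorphism carries left neighbourhoods to left neighbourhoods, so germs
  compose side by side. Breaks stay at dyadic points because \<open>g\<close> preserves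
  \<open>dyad\<close> in both directions.\<close>

lemma dyad_germs_comp:
  assumes "g \<in> dyad_PL" "dyad_germs g x a b" "dyad_germs f (g x) c d"
  shows "dyad_germs (\<lambda>y. f (g y)) x (\<lambda>y. c (a y)) (\<lambda>y. d (b y))"
proof -
  note g = dyad_PL_strict_mono[OF assms(1)] dyad_PL_surj[OF assms(1)]
  have "\<forall>\<^sub>F y in at_left x. f (g y) = c (a y)"
    using assms(2,3) unfolding dyad_germs_def
    by (simp add: eventually_eq_comp[of f c "at_left (g x)" g "at_left x" a] strict_mono_surj_at_left[OF g])
  moreover have "\<forall>\<^sub>F y in at_right x. f (g y) = d (b y)"
    using assms(2,3) unfolding dyad_germs_def
    by (simp add: eventually_eq_comp[of f d "at_right (g x)" g "at_right x" b] strict_mono_surj_at_right[OF g])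
  ultimately show ?thesis using assms(2,3) dyad_PL_dyad[OF assms(1), of x]
      dyad_affine_comp[of c a] dyad_affine_comp[of d b] unfolding dyad_germs_def by auto
qed

lemma dyad_PL_comp: assumes "f \<in> dyad_PL" "g \<in> dyad_PL" shows "f \<circ> g \<in> dyad_PL"
proof -
  have "\<exists>a b. dyad_germs (f \<circ> g) x a b" for x
    using dyad_germs_comp[OF assms(2)] dyad_PL_germs[OF assms(1), of "g x"] dyad_PL_germs[OF assms(2), of x]
    unfolding comp_def by blast
  moreover have "strict_mono (f \<circ> g)"
    using assms[THEN dyad_PL_strict_mono] by (simp add: strict_mono_def)
  moreover have "surj (f \<circ> g)" using assms[THEN dyad_PL_surj] by (intro comp_surj)
  ultimately show ?thesis unfolding dyad_PL_def by blast
qed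

lemma dyad_PL_inv: assumes f: "f \<in> dyad_PL" shows "inv_into UNIV f \<in> dyad_PL"
proof -
  note m = dyad_PL_strict_mono[OF f] dyad_PL_surj[OF f]
  note i = inv_strict_mono_surj[OF m]
  have "\<exists>a b. dyad_germs (inv_into UNIV f) y a b" for y
  proof -
    obtain a b where ab: "dyad_germs f (inv_into UNIV f y) a b" using dyad_PL_germs[OF f] by blast
    obtain a' where a': "a' \<in> dyad_affine" "\<And>y. a' (a y) = y" "\<And>y. a (a' y) = y"
      using ab dyad_affine_inverse unfolding dyad_germs_def by metis
    obtain b' where b': "b' \<in> dyad_affine" "\<And>y. b' (b y) = y" "\<And>y. b (b' y) = y"
      using ab dyad_affine_inverse unfolding dyad_germs_def by metis
    have "\<forall>\<^sub>F z in at_left y. inv_into UNIV f z = a' z"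
    proof -
      have "\<forall>\<^sub>F z in at_left (inv_into UNIV f y). f z = a z" using ab by (simp add: dyad_germs_def)
      from eventually_compose_filterlim[OF this strict_mono_surj_at_left[OF i(1,2)]]
      show ?thesis by (rule eventually_mono) (metis a'(2) i(3))
    qed
    moreover have "\<forall>\<^sub>F z in at_right y. inv_into UNIV f z = b' z"
    proof -
      have "\<forall>\<^sub>F z in at_right (inv_into UNIV f y). f z = b z" using ab by (simp add: dyad_germs_def)
      from eventually_compose_filterlim[OF this strict_mono_surj_at_right[OF i(1,2)]]
      show ?thesis by (rule eventually_mono) (metis b'(2) i(3))
    qed
    moreover have "a' = b'" if "a = b" using that a' b' by (metis ext)
    ultimately show ?thesis using a' b' ab dyad_PL_dyad[OF f, of "inv_into UNIV f y"]
      unfolding dyad_germs_def by (auto simp: i)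
  qed
  then show ?thesis unfolding dyad_PL_def using i by blast
qed

lemma dyad_affine_PL: assumes "a \<in> dyad_affine" shows "a \<in> dyad_PL"
proof -
  have "dyad_germs a x a a" for x using assms by (simp add: dyad_germs_def)
  then show ?thesis using dyad_affine_strict_mono[OF assms] dyad_affine_surj[OF assms]
    unfolding dyad_PL_def by blast
qed

lemma dyad_PL_id: "(\<lambda>x. x) \<in> dyad_PL" "id \<in> dyad_PL"
  using dyad_affine_PL[OF dyad_affine_id] by (simp_all add: id_def)

lemma dyad_PL_translation: "c \<in> dyad \<Longrightarrow> (\<lambda>x. x + c) \<in> dyad_PL"
  by (intro dyad_affine_PL dyad_affine_translation)

section \<open>Gluing, reflection and interpolation\<close>

lemma dyad_germs_cong:
  assumes "dyad_germs g x a b" "dyad_germs h x c d"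
    "\<forall>\<^sub>F y in at_left x. f y = g y" "\<forall>\<^sub>F y in at_right x. f y = h y"
    "x \<in> dyad \<or> g = h"
  shows "\<exists>a b. dyad_germs f x a b"
proof -
  have "\<forall>\<^sub>F y in at_left x. f y = a y" "\<forall>\<^sub>F y in at_right x. f y = d y"
    "\<forall>\<^sub>F y in at_right x. g = h \<longrightarrow> f y = b y"
    using eventually_eq_trans[OF assms(3), of a] eventually_eq_trans[OF assms(4), of d]
      eventually_eq_trans[OF assms(4), of b] assms(1,2) unfolding dyad_germs_def by auto
  then show ?thesis using assms(1,2,5) unfolding dyad_germs_def by (cases "x \<in> dyad") auto
qed

text \<open>Membership is tested against two models per point, one on each side, which may differ
  only at a dyadic point. Pasting constructions then only have to name their pieces.\<close>

lemma dyad_PL_local: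
  assumes "strict_mono f" "surj f"
    and "\<And>x. \<exists>g\<in>dyad_PL. \<exists>h\<in>dyad_PL. (\<forall>\<^sub>F y in at_left x. f y = g y) \<and>
      (\<forall>\<^sub>F y in at_right x. f y = h y) \<and> (x \<in> dyad \<or> g = h)"
  shows "f \<in> dyad_PL"
proof -
  have "\<exists>a b. dyad_germs f x a b" for x
  proof -
    obtain g h where gh: "g \<in> dyad_PL" "h \<in> dyad_PL" "\<forall>\<^sub>F y in at_left x. f y = g y"
      "\<forall>\<^sub>F y in at_right x. f y = h y" "x \<in> dyad \<or> g = h" using assms(3)[of x] by blast
    obtain a b c d where "dyad_germs g x a b" "dyad_germs h x c d"
      using gh(1,2)[THEN dyad_PL_germs] by blast
    then show ?thesis using gh(3-5) by (rule dyad_germs_cong)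
  qed
  then show ?thesis using assms unfolding dyad_PL_def by blast
qed

lemma dyad_PL_glue:
  assumes "f \<in> dyad_PL" "g \<in> dyad_PL" "p \<in> dyad" "f p = g p"
  shows "(\<lambda>x. if x \<le> p then f x else g x) \<in> dyad_PL" (is "?h \<in> _")
proof (rule dyad_PL_local)
  note f = dyad_PL_strict_mono[OF assms(1)] dyad_PL_surj[OF assms(1)]
  note g = dyad_PL_strict_mono[OF assms(2)] dyad_PL_surj[OF assms(2)]
  show "strict_mono ?h"
  proof (rule strict_monoI)
    fix x y :: real assume "x < y"
    then have "f x < f y" "g x < g y" using f(1) g(1) by (auto simp: strict_mono_less)
    moreover have "f x \<le> f p" if "x \<le> p" using that f(1) by (auto simp: strict_mono_less_eq)
    moreover have "g p < g y" if "p < y" using that g(1) by (auto simp: strict_mono_less)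
    ultimately show "?h x < ?h y" using assms(4) \<open>x < y\<close> by auto
  qed
  show "surj ?h"
  proof (rule surjI)
    fix y
    have "inv_into UNIV f y \<le> p" if "y \<le> f p"
      using that inv_strict_mono_surj(3)[OF f, of y] strict_mono_less_eq[OF f(1), of "inv_into UNIV f y" p] by simp
    moreover have "\<not> inv_into UNIV g y \<le> p" if "\<not> y \<le> f p"
      using that assms(4) inv_strict_mono_surj(3)[OF g, of y] strict_mono_less_eq[OF g(1), of "inv_into UNIV g y" p] by simp
    ultimately show "?h (if y \<le> f p then inv_into UNIV f y else inv_into UNIV g y) = y"
      using inv_strict_mono_surj(3)[OF f] inv_strict_mono_surj(3)[OF g] by simp
  qed
  fix x
  consider "x < p" | "x = p" | "x > p" by linarith
  then show "\<exists>a\<in>dyad_PL. \<exists>b\<in>dyad_PL. (\<forall>\<^sub>F y in at_left x. ?h y = a y) \<and>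
      (\<forall>\<^sub>F y in at_right x. ?h y = b y) \<and> (x \<in> dyad \<or> a = b)"
  proof cases
    case 1
    then have "\<forall>\<^sub>F y in at x within A. ?h y = f y" for A
      using order_tendstoD(2)[OF tendsto_ident_at, of x p A] by (auto elim: eventually_mono)
    then show ?thesis using assms(1) by blast
  next
    case 2
    then show ?thesis using assms
      by (intro bexI[of _ f] bexI[of _ g]) (auto simp: eventually_at_filter)
  next
    case 3
    then have "\<forall>\<^sub>F y in at x within A. ?h y = g y" for A
      using order_tendstoD(1)[OF tendsto_ident_at, of p x A] by (auto elim: eventually_mono)
    then show ?thesis using assms(2) by blast
  qed
qed

lemma dyad_affine_reflect: "a \<in> dyad_affine \<Longrightarrow> (\<lambda>y. - a (- y)) \<in> dyad_affine"
  unfolding dyad_affine_def using dyad_uminus by fastforce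

text \<open>Reflection exchanges the two sides of a point and hence the two germs. Inverse letters
  act through this conjugation.\<close>

lemma dyad_PL_reflect: assumes "f \<in> dyad_PL" shows "(\<lambda>x. - f (- x)) \<in> dyad_PL"
proof -
  note f = dyad_PL_strict_mono[OF assms] dyad_PL_surj[OF assms]
  have "strict_mono (\<lambda>x. - f (- x))" using f(1) by (simp add: strict_mono_def)
  moreover have "surj (\<lambda>x. - f (- x))"
  proof (rule surjI)
    fix y show "- f (- (- inv_into UNIV f (- y))) = y"
      using inv_strict_mono_surj(3)[OF f, of "- y"] by simp
  qed
  moreover have "\<exists>a b. dyad_germs (\<lambda>x. - f (- x)) x a b" for x
  proof -
    obtain a b where ab: "dyad_germs f (- x) a b" using dyad_PL_germs[OF assms] by blast
    have "at_left x = filtermap uminus (at_right (- x))" "at_right x = filtermap uminus (at_left (- x))"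
      using at_left_minus[of x] at_right_minus[of x] by simp_all
    then have "\<forall>\<^sub>F y in at_left x. - f (- y) = - b (- y)" "\<forall>\<^sub>F y in at_right x. - f (- y) = - a (- y)"
      using ab by (auto simp: eventually_filtermap dyad_germs_def)
    moreover have "x \<in> dyad \<longleftrightarrow> - x \<in> dyad" using dyad_uminus[of x] dyad_uminus[of "- x"] by auto
    ultimately have "dyad_germs (\<lambda>x. - f (- x)) x (\<lambda>y. - b (- y)) (\<lambda>y. - a (- y))"
      using ab dyad_affine_reflect unfolding dyad_germs_def by auto
    then show ?thesis by blast
  qed
  ultimately show ?thesis unfolding dyad_PL_def by blast
qed

text \<open>After scaling by a power of 2, the target length \<open>q\<close> satisfies
  \<open>p \<le> q < 2 * p\<close> for the source length \<open>p\<close>, and one break suffices: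
  slope 1 up to \<open>e\<close>, slope 2 from \<open>e\<close> to \<open>p\<close>.\<close>

lemma dyad_PL_interpolate:
  assumes "a \<in> dyad" "b \<in> dyad" "a' \<in> dyad" "b' \<in> dyad" "a < b" "a' < b'"
  shows "\<exists>f\<in>dyad_PL. f a = a' \<and> f b = b'"
proof -
  define k where "k = \<lfloor>log 2 ((b' - a') / (b - a))\<rfloor>"
  define p where "p = 2 powi k * (b - a)"
  define q where "q = b' - a'"
  have pq: "p \<le> q" "q < 2 * p" "0 < p"
  proof -
    let ?r = "(b' - a') / (b - a)"
    have r: "?r > 0" using assms by simp
    have "2 powr of_int k \<le> ?r" "?r < 2 powr (of_int k + 1)"
      using r unfolding k_def by (simp_all add: powr_le_iff powr_less_iff less_powr_iff le_powr_iff)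
    then have "2 powi k \<le> ?r" "?r < 2 * 2 powi k"
      by (simp_all add: powr_real_of_int' powr_add)
    then show "p \<le> q" "q < 2 * p" "0 < p" using assms unfolding p_def q_def by (simp_all add: field_simps)
  qed
  \<comment> \<open>The solution of \<open>e + 2 * (p - e) = q\<close>.\<close>
  define e where "e = 2 * p - q"
  have e: "e \<in> dyad" unfolding e_def p_def q_def using assms by (intro dyad_diff dyad_mult[of 2]) (auto intro: dyad_diff)
  define h where "h = (\<lambda>x. if x \<le> e then x else 2 * x - e)"
  have "(\<lambda>x. 2 powi 1 * x + - e) \<in> dyad_affine" using e by (intro dyad_affineI dyad_uminus)
  then have "h \<in> dyad_PL" unfolding h_def
    using dyad_PL_glue[OF dyad_PL_id(1), of "\<lambda>x. 2 * x - e" e] e by (simp add: dyad_affine_PL)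
  moreover have "(\<lambda>x. 2 powi k * x + - (2 powi k * a)) \<in> dyad_PL"
    using assms by (intro dyad_affine_PL dyad_affineI dyad_uminus) simp
  ultimately have "(\<lambda>x. x + a') \<circ> (h \<circ> (\<lambda>x. 2 powi k * x + - (2 powi k * a))) \<in> dyad_PL"
    using assms by (intro dyad_PL_comp dyad_PL_translation)
  moreover have "h 0 = 0" "h p = q" unfolding h_def e_def using pq by auto
  ultimately show ?thesis
    by (intro bexI[of _ "(\<lambda>x. x + a') \<circ> (h \<circ> (\<lambda>x. 2 powi k * x + - (2 powi k * a)))"])
      (simp_all add: p_def q_def algebra_simps)
qed

definition dyad_PL_on :: "real \<Rightarrow> real \<Rightarrow> (real \<Rightarrow> real) set" where
  "dyad_PL_on a b = {f \<in> dyad_PL. \<forall>x. x \<notin> {a..b} \<longrightarrow> f x = x}"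

text \<open>Support in a compact part of the open interval, so that the slopes at both ends are
  trivial. This is what places a map in the commutator subgroup; elements of
  \<open>dyad_PL_on\<close> may have other slopes there.\<close>

definition dyad_PL_c :: "real \<Rightarrow> real \<Rightarrow> (real \<Rightarrow> real) set" where
  "dyad_PL_c a b = {f \<in> dyad_PL. \<exists>r s. a < r \<and> r \<le> s \<and> s < b \<and> (\<forall>x. x \<notin> {r..s} \<longrightarrow> f x = x)}"

lemma dyad_PL_cI:
  "f \<in> dyad_PL \<Longrightarrow> a < r \<Longrightarrow> r \<le> s \<Longrightarrow> s < b \<Longrightarrow> (\<And>x. x < r \<or> s < x \<Longrightarrow> f x = x) \<Longrightarrow> f \<in> dyad_PL_c a b"
  unfolding dyad_PL_c_def by (auto simp: not_le)

text \<open>The bounds are enlarged to dyadic ones, which can serve as gluing points. As the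
  enlargement is strict, the new bounds are fixed themselves.\<close>

lemma dyad_PL_cE:
  assumes "f \<in> dyad_PL_c a b"
  obtains r s where "f \<in> dyad_PL" "r \<in> dyad" "s \<in> dyad" "a < r" "r < s" "s < b" "\<And>x. x \<le> r \<or> s \<le> x \<Longrightarrow> f x = x"
proof -
  obtain r s where f: "f \<in> dyad_PL" and rs: "a < r" "r \<le> s" "s < b" "\<And>x. x \<notin> {r..s} \<Longrightarrow> f x = x"
    using assms unfolding dyad_PL_c_def by blast
  obtain r' s' where "r' \<in> dyad" "s' \<in> dyad" "a < r'" "r' < r" "s < s'" "s' < b"
    using dyad_dense[of a r] dyad_dense[of s b] rs by blast
  moreover from this have "f x = x" if "x \<le> r' \<or> s' \<le> x" for x using that by (intro rs(4)) auto
  ultimately show ?thesis using f rs(2) by (intro that[of r' s']) auto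
qed

lemma dyad_PL_on_extend:
  assumes g: "g \<in> dyad_PL" and d: "a \<in> dyad" "r \<in> dyad" "s \<in> dyad" "b \<in> dyad"
    and "a < r" "r \<le> s" "s < b" "a < g r" "g s < b"
  shows "\<exists>f\<in>dyad_PL_on a b. \<forall>x\<in>{r..s}. f x = g x"
proof -
  have gd: "g r \<in> dyad" "g s \<in> dyad" using g d by (simp_all add: dyad_PL_dyad)
  obtain f1 where f1: "f1 \<in> dyad_PL" "f1 a = a" "f1 r = g r"
    using dyad_PL_interpolate[of a r a "g r"] assms gd by auto
  obtain f2 where f2: "f2 \<in> dyad_PL" "f2 s = g s" "f2 b = b"
    using dyad_PL_interpolate[of s b "g s" b] assms gd by auto
  define h4 where "h4 = (\<lambda>x. if x \<le> b then f2 x else x)"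
  define h3 where "h3 = (\<lambda>x. if x \<le> s then g x else h4 x)"
  define h2 where "h2 = (\<lambda>x. if x \<le> r then f1 x else h3 x)"
  define h1 where "h1 = (\<lambda>x. if x \<le> a then x else h2 x)"
  have "h4 \<in> dyad_PL" unfolding h4_def using f2 d by (intro dyad_PL_glue dyad_PL_id) auto
  then have "h3 \<in> dyad_PL" unfolding h3_def using f2 d g assms
    by (intro dyad_PL_glue) (auto simp: h4_def)
  then have "h2 \<in> dyad_PL" unfolding h2_def using f1 d g assms
    by (intro dyad_PL_glue) (auto simp: h3_def)
  then have "h1 \<in> dyad_PL" unfolding h1_def using f1 d g assms
    by (intro dyad_PL_glue dyad_PL_id) (auto simp: h2_def)
  moreover have "h1 x = x" if "x \<notin> {a..b}" for x
    using that assms unfolding h1_def h2_def h3_def h4_def by auto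
  moreover have "h1 x = g x" if "x \<in> {r..s}" for x
    using that assms f1 unfolding h1_def h2_def h3_def h4_def by auto
  ultimately show ?thesis unfolding dyad_PL_on_def by blast
qed

text \<open>Dyadic points just outside \<open>[r, s]\<close> still have their images in
  \<open>(a, b)\<close>, and dyadic \<open>a'\<close>, \<open>b'\<close> fit beyond both; the gaps
  are filled by interpolation. This is the supply of auxiliary conjugators: the behaviour of any
  \<open>g\<close> on \<open>[r, s]\<close> is realized with compact support.\<close>

lemma dyad_PL_c_extend:
  assumes g: "g \<in> dyad_PL" and "a < r" "r \<le> s" "s < b" "a < g r" "g s < b"
  shows "\<exists>f\<in>dyad_PL_c a b. \<forall>x\<in>{r..s}. f x = g x"
proof -
  note m = dyad_PL_strict_mono[OF g] dyad_PL_surj[OF g]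
  note i = inv_strict_mono_surj[OF m]
  have "inv_into UNIV g a < r" using i(1) i(4)[of r] assms by (metis strict_mono_less)
  then obtain r' where r': "r' \<in> dyad" "a < r'" "inv_into UNIV g a < r'" "r' < r"
    using dyad_dense[of "max a (inv_into UNIV g a)" r] assms by auto
  have "s < inv_into UNIV g b" using i(1) i(4)[of s] assms by (metis strict_mono_less)
  then obtain s' where s': "s' \<in> dyad" "s' < b" "s' < inv_into UNIV g b" "s < s'"
    using dyad_dense[of s "min b (inv_into UNIV g b)"] assms by auto
  have gr: "a < g r'" using r'(3) m(1) i(3)[of a] by (metis strict_mono_less)
  have gs: "g s' < b" using s'(3) m(1) i(3)[of b] by (metis strict_mono_less)
  obtain a' where a': "a' \<in> dyad" "a < a'" "a' < r'" "a' < g r'"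
    using dyad_dense[of a "min r' (g r')"] r' gr by auto
  obtain b' where b': "b' \<in> dyad" "b' < b" "s' < b'" "g s' < b'"
    using dyad_dense[of "max s' (g s')" b] s' gs by auto
  obtain f where f: "f \<in> dyad_PL_on a' b'" "\<forall>x\<in>{r'..s'}. f x = g x"
    using dyad_PL_on_extend[OF g a'(1) r'(1) s'(1) b'(1)] a' b' r' s' assms by auto
  then have "f \<in> dyad_PL_c a b"
    unfolding dyad_PL_on_def using a' b' r' s' assms by (intro dyad_PL_cI[of f a a' b' b]) auto
  then show ?thesis using f(2) r' s' by (intro bexI[of _ f]) auto
qed

section \<open>The group of homeomorphisms of the line\<close>

lemma carrier_Homeo_plus_R: "f \<in> carrier Homeo_plus_R \<longleftrightarrow> strict_mono f \<and> surj f"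
proof
  assume "f \<in> carrier Homeo_plus_R"
  then show "strict_mono f \<and> surj f"
    using homeomorphic_imp_surjective_map[of euclideanreal euclideanreal f]
    by (auto simp: Homeo_plus_R_def homeo_group_def)
next
  assume f: "strict_mono f \<and> surj f"
  note i = inv_strict_mono_surj[OF conjunct1[OF f] conjunct2[OF f]]
  have "homeomorphic_maps euclideanreal euclideanreal f (inv_into UNIV f)"
    using f i strict_mono_surj_continuous[of f] strict_mono_surj_continuous[OF i(1,2)]
    by (simp add: homeomorphic_maps_def)
  then show "f \<in> carrier Homeo_plus_R"
    using f by (auto simp: Homeo_plus_R_def homeo_group_def homeomorphic_map_maps)
qed

lemma mult_Homeo_plus_R [simp]: "f \<otimes>\<^bsub>Homeo_plus_R\<^esub> g = g \<circ> f"
  by (simp add: Homeo_plus_R_def homeo_group_def compose_def fun_eq_iff)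

lemma one_Homeo_plus_R [simp]: "\<one>\<^bsub>Homeo_plus_R\<^esub> = id"
  by (auto simp: Homeo_plus_R_def homeo_group_def)

lemma group_Homeo_plus_R: "group Homeo_plus_R"
proof (rule groupI)
  fix f g assume "f \<in> carrier Homeo_plus_R" "g \<in> carrier Homeo_plus_R"
  then show "f \<otimes>\<^bsub>Homeo_plus_R\<^esub> g \<in> carrier Homeo_plus_R"
    by (simp add: carrier_Homeo_plus_R strict_mono_def comp_surj del: comp_apply) (simp add: strict_mono_def)
next
  fix f assume "f \<in> carrier Homeo_plus_R"
  then show "\<exists>g\<in>carrier Homeo_plus_R. g \<otimes>\<^bsub>Homeo_plus_R\<^esub> f = \<one>\<^bsub>Homeo_plus_R\<^esub>"
    by (intro bexI[of _ "inv_into UNIV f"])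
      (auto simp: carrier_Homeo_plus_R inv_strict_mono_surj fun_eq_iff)
qed (auto simp: carrier_Homeo_plus_R strict_mono_def comp_assoc)

interpretation Homeo: group Homeo_plus_R by (rule group_Homeo_plus_R)

lemma inv_Homeo_plus_R:
  "f \<in> carrier Homeo_plus_R \<Longrightarrow> inv\<^bsub>Homeo_plus_R\<^esub> f = inv_into UNIV f"
  by (intro Homeo.inv_equality) (auto simp: carrier_Homeo_plus_R inv_strict_mono_surj fun_eq_iff)

lemma subgroup_HomeoI:
  assumes "id \<in> K" "\<And>f. f \<in> K \<Longrightarrow> strict_mono f \<and> surj f" "\<And>f g. f \<in> K \<Longrightarrow> g \<in> K \<Longrightarrow> f \<circ> g \<in> K"
    "\<And>f. f \<in> K \<Longrightarrow> inv_into UNIV f \<in> K"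
  shows "subgroup K Homeo_plus_R"
  using assms by (intro Homeo.subgroupI) (auto simp: carrier_Homeo_plus_R inv_Homeo_plus_R)

lemma
  assumes "subgroup K Homeo_plus_R"
  shows subgroup_Homeo_id: "id \<in> K"
    and subgroup_Homeo_comp: "f \<in> K \<Longrightarrow> g \<in> K \<Longrightarrow> f \<circ> g \<in> K"
    and subgroup_Homeo_inv: "f \<in> K \<Longrightarrow> inv_into UNIV f \<in> K"
    and subgroup_Homeo_carrier: "f \<in> K \<Longrightarrow> strict_mono f" "f \<in> K \<Longrightarrow> surj f"
  using subgroup.one_closed[OF assms] subgroup.m_closed[OF assms, of g f] subgroup.m_inv_closed[OF assms, of f]
    subgroup.mem_carrier[OF assms, of f] by (auto simp: inv_Homeo_plus_R carrier_Homeo_plus_R)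

lemma subgroup_dyad_PL_on: "subgroup (dyad_PL_on a b) Homeo_plus_R"
proof (rule subgroup_HomeoI)
  fix f assume "f \<in> dyad_PL_on a b"
  then have f: "f \<in> dyad_PL" "\<And>x. x \<notin> {a..b} \<Longrightarrow> f x = x" by (auto simp: dyad_PL_on_def)
  then show "strict_mono f \<and> surj f" by (simp add: dyad_PL_strict_mono dyad_PL_surj)
  then have "inv_into UNIV f x = x" if "x \<notin> {a..b}" for x
    using f(2)[OF that] inv_strict_mono_surj(4) by metis
  then show "inv_into UNIV f \<in> dyad_PL_on a b" using f(1) by (auto simp: dyad_PL_on_def dyad_PL_inv)
qed (auto simp: dyad_PL_on_def dyad_PL_id dyad_PL_comp)

lemma subgroup_dyad_PL_c: assumes "a < b" shows "subgroup (dyad_PL_c a b) Homeo_plus_R"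
proof (rule subgroup_HomeoI)
  show "id \<in> dyad_PL_c a b"
    using assms by (intro dyad_PL_cI[of _ a "(a + b) / 2" "(a + b) / 2"]) (auto intro: dyad_PL_id)
  fix f assume f: "f \<in> dyad_PL_c a b"
  then obtain r s where rs: "f \<in> dyad_PL" "r \<in> dyad" "s \<in> dyad" "a < r" "r < s" "s < b" "\<And>x. x \<le> r \<or> s \<le> x \<Longrightarrow> f x = x"
    by (rule dyad_PL_cE) blast
  then show sm: "strict_mono f \<and> surj f" by (simp add: dyad_PL_strict_mono dyad_PL_surj)
  then have "inv_into UNIV f x = x" if "x < r \<or> s < x" for x
    using rs(7)[of x] that inv_strict_mono_surj(4) by (metis less_imp_le)
  then show "inv_into UNIV f \<in> dyad_PL_c a b" using rs by (intro dyad_PL_cI[of _ a r s b] dyad_PL_inv) auto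
  fix g assume g: "g \<in> dyad_PL_c a b"
  then obtain r' s' where rs': "g \<in> dyad_PL" "r' \<in> dyad" "s' \<in> dyad" "a < r'" "r' < s'" "s' < b" "\<And>x. x \<le> r' \<or> s' \<le> x \<Longrightarrow> g x = x"
    by (rule dyad_PL_cE) blast
  have "(f \<circ> g) x = x" if "x < min r r' \<or> max s s' < x" for x
    using rs(7)[of x] rs'(7)[of x] that by auto
  then show "f \<circ> g \<in> dyad_PL_c a b"
    using rs rs' by (intro dyad_PL_cI[of _ a "min r r'" "max s s'" b] dyad_PL_comp) auto
qed

section \<open>Germs, slopes and breakpoints\<close>

lemma affine_eqI:
  fixes m c m' c' :: real
  assumes "m * u + c = m' * u + c'" "m * v + c = m' * v + c'" "u \<noteq> v"
  shows "m = m' \<and> c = c'"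
proof -
  have "(m - m') * (u - v) = 0" using assms by (simp add: algebra_simps)
  then show ?thesis using assms by auto
qed

lemma affine_eq_at_right:
  fixes m c m' c' :: real
  assumes "\<forall>\<^sub>F y in at_right x. m * y + c = m' * y + c'" shows "m = m' \<and> c = c'"
proof -
  obtain b where b: "b > x" "\<And>y. x < y \<Longrightarrow> y < b \<Longrightarrow> m * y + c = m' * y + c'"
    using assms unfolding eventually_at_right_field by blast
  obtain u where u: "x < u" "u < b" using dense[OF b(1)] by auto
  obtain v where v: "x < v" "v < u" using dense[OF u(1)] by auto
  show ?thesis using affine_eqI[OF b(2)[of u] b(2)[of v]] u v by auto
qed

lemma affine_eq_at_left:
  fixes m c m' c' :: real
  assumes "\<forall>\<^sub>F y in at_left x. m * y + c = m' * y + c'" shows "m = m' \<and> c = c'"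
proof -
  obtain b where b: "b < x" "\<And>y. b < y \<Longrightarrow> y < x \<Longrightarrow> m * y + c = m' * y + c'"
    using assms unfolding eventually_at_left_field by blast
  obtain u where u: "b < u" "u < x" using dense[OF b(1)] by auto
  obtain v where v: "b < v" "v < u" using dense[OF u(1)] by auto
  show ?thesis using affine_eqI[OF b(2)[of u] b(2)[of v]] u v by auto
qed

lemma dyad_germs_unique:
  assumes "dyad_germs f x a b" "dyad_germs f x a' b'" shows "a = a' \<and> b = b'"
proof -
  obtain k c k' c' l d l' d' where *: "a = (\<lambda>y. 2 powi k * y + c)" "a' = (\<lambda>y. 2 powi k' * y + c')"
    "b = (\<lambda>y. 2 powi l * y + d)" "b' = (\<lambda>y. 2 powi l' * y + d')"
    using assms unfolding dyad_germs_def dyad_affine_def by blast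
  have "\<forall>\<^sub>F y in at_left x. f y = a y" "\<forall>\<^sub>F y in at_left x. f y = a' y"
    using assms by (simp_all add: dyad_germs_def)
  then have l: "\<forall>\<^sub>F y in at_left x. a y = a' y" by eventually_elim simp
  have "\<forall>\<^sub>F y in at_right x. f y = b y" "\<forall>\<^sub>F y in at_right x. f y = b' y"
    using assms by (simp_all add: dyad_germs_def)
  then have r: "\<forall>\<^sub>F y in at_right x. b y = b' y" by eventually_elim simp
  show ?thesis using affine_eq_at_left[OF l[unfolded *]] affine_eq_at_right[OF r[unfolded *]] * by simp
qed

text \<open>\<open>a 1 - a 0\<close> is the slope. The floor only turns its logarithm, an integer on
  \<open>dyad_affine\<close>, into an \<open>int\<close>.\<close>

definition affine_exp :: "(real \<Rightarrow> real) \<Rightarrow> int" where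
  "affine_exp a = \<lfloor>log 2 (a 1 - a 0)\<rfloor>"

lemma affine_exp [simp]: "affine_exp (\<lambda>y. 2 powi k * y + c) = k"
proof -
  have "log 2 (2 powi k) = of_int k" by (simp add: powr_real_of_int'[symmetric])
  then show ?thesis by (simp add: affine_exp_def)
qed

lemma affine_exp_comp:
  assumes "a \<in> dyad_affine" "b \<in> dyad_affine"
  shows "affine_exp (\<lambda>y. a (b y)) = affine_exp a + affine_exp b"
proof -
  obtain k c l d where *: "a = (\<lambda>y. 2 powi k * y + c)" "b = (\<lambda>y. 2 powi l * y + d)"
    using assms unfolding dyad_affine_def by blast
  have "(\<lambda>y. a (b y)) = (\<lambda>y. 2 powi (k + l) * y + (2 powi k * d + c))"
    unfolding * by (simp add: fun_eq_iff power_int_add algebra_simps)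
  then show ?thesis using * by simp
qed

definition left_exp :: "(real \<Rightarrow> real) \<Rightarrow> real \<Rightarrow> int" where
  "left_exp f x = affine_exp (SOME a. \<exists>b. dyad_germs f x a b)"

definition right_exp :: "(real \<Rightarrow> real) \<Rightarrow> real \<Rightarrow> int" where
  "right_exp f x = affine_exp (SOME b. \<exists>a. dyad_germs f x a b)"

lemma left_right_exp:
  assumes "dyad_germs f x a b" shows "left_exp f x = affine_exp a" "right_exp f x = affine_exp b"
proof -
  have "(SOME a. \<exists>b. dyad_germs f x a b) = a"
    by (rule some_equality) (use assms dyad_germs_unique[OF assms] in blast)+
  moreover have "(SOME b. \<exists>a. dyad_germs f x a b) = b"
    by (rule some_equality) (use assms dyad_germs_unique[OF assms] in blast)+
  ultimately show "left_exp f x = affine_exp a" "right_exp f x = affine_exp b"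
    by (simp_all add: left_exp_def right_exp_def)
qed

text \<open>Chain rule for one-sided slopes. At a common fixed point the exponents add, so they
  become homomorphisms to \<int>.\<close>

lemma exp_comp:
  assumes "f \<in> dyad_PL" "g \<in> dyad_PL"
  shows "left_exp (f \<circ> g) x = left_exp f (g x) + left_exp g x"
    "right_exp (f \<circ> g) x = right_exp f (g x) + right_exp g x"
proof -
  obtain a b where ab: "dyad_germs g x a b" using dyad_PL_germs[OF assms(2)] by blast
  obtain c d where cd: "dyad_germs f (g x) c d" using dyad_PL_germs[OF assms(1)] by blast
  have in_aff: "a \<in> dyad_affine" "b \<in> dyad_affine" "c \<in> dyad_affine" "d \<in> dyad_affine"
    using ab cd by (auto simp: dyad_germs_def)
  have "f \<circ> g = (\<lambda>y. f (g y))" by (simp add: fun_eq_iff)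
  then show "left_exp (f \<circ> g) x = left_exp f (g x) + left_exp g x"
    "right_exp (f \<circ> g) x = right_exp f (g x) + right_exp g x"
    using left_right_exp[OF dyad_germs_comp[OF assms(2) ab cd]] left_right_exp[OF ab] left_right_exp[OF cd]
      affine_exp_comp[of c a] affine_exp_comp[of d b] in_aff by simp_all
qed

lemma eventually_nested_at_right:
  assumes "\<forall>\<^sub>F y in at_right (x::real). P y"
  shows "\<forall>\<^sub>F y in at_right x. (\<forall>\<^sub>F z in at_right y. P z) \<and> (\<forall>\<^sub>F z in at_left y. P z)"
proof -
  obtain b where b: "b > x" "\<And>y. x < y \<Longrightarrow> y < b \<Longrightarrow> P y"
    using assms unfolding eventually_at_right_field by blast
  show ?thesis unfolding eventually_at_right_field eventually_at_left_field
    using b by (intro exI[of _ b]) (meson less_trans)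
qed

lemma eventually_nested_at_left:
  assumes "\<forall>\<^sub>F y in at_left (x::real). P y"
  shows "\<forall>\<^sub>F y in at_left x. (\<forall>\<^sub>F z in at_right y. P z) \<and> (\<forall>\<^sub>F z in at_left y. P z)"
proof -
  obtain b where b: "b < x" "\<And>y. b < y \<Longrightarrow> y < x \<Longrightarrow> P y"
    using assms unfolding eventually_at_left_field by blast
  show ?thesis unfolding eventually_at_right_field eventually_at_left_field
    using b by (intro exI[of _ b]) (meson less_trans)
qed

definition breaks :: "(real \<Rightarrow> real) \<Rightarrow> real set" where
  "breaks f = {x. \<nexists>a. dyad_germs f x a a}"

lemma breaks_subset_dyad: "f \<in> dyad_PL \<Longrightarrow> breaks f \<subseteq> dyad"
  using dyad_PL_germs unfolding breaks_def dyad_germs_def by fast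

text \<open>On either side of \<open>x\<close> and close to it, the one-sided germ at
  \<open>x\<close> is a two-sided germ at every point. So breaks are isolated.\<close>

lemma eventually_not_break:
  assumes "f \<in> dyad_PL" shows "\<forall>\<^sub>F y in at x. y \<notin> breaks f"
proof -
  obtain a b where ab: "dyad_germs f x a b" using dyad_PL_germs[OF assms] by blast
  have "\<forall>\<^sub>F y in at_left x. y \<notin> breaks f"
  proof -
    have "\<forall>\<^sub>F y in at_left x. f y = a y" using ab by (simp add: dyad_germs_def)
    from eventually_nested_at_left[OF this] show ?thesis
      by eventually_elim (use ab in \<open>auto simp: breaks_def dyad_germs_def\<close>)
  qed
  moreover have "\<forall>\<^sub>F y in at_right x. y \<notin> breaks f"
  proof -
    have "\<forall>\<^sub>F y in at_right x. f y = b y" using ab by (simp add: dyad_germs_def)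
    from eventually_nested_at_right[OF this] show ?thesis
      by eventually_elim (use ab in \<open>auto simp: breaks_def dyad_germs_def\<close>)
  qed
  ultimately show ?thesis by (simp add: eventually_at_split)
qed

lemma finite_breaks: assumes "f \<in> dyad_PL" shows "finite ({u..v} \<inter> breaks f)"
proof (rule finite_not_islimpt_in_compact)
  fix z show "\<not> z islimpt breaks f"
    using eventually_not_break[OF assms, of z] unfolding islimpt_conv_frequently_at frequently_def by simp
qed simp

text \<open>Off the breaks the germ is locally constant as a function of the point, hence constant
  on the connected open interval. Continuity settles the two end points.\<close>

lemma affine_off_breaks:
  assumes f: "f \<in> dyad_PL" and uv: "u < v" "{u<..<v} \<inter> breaks f = {}"
  shows "\<exists>k c. \<forall>t\<in>{u..v}. f t = 2 powi k * t + c"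
proof -
  note m = dyad_PL_strict_mono[OF f] dyad_PL_surj[OF f]
  define A where "A x = (SOME a. dyad_germs f x a a)" for x
  have A: "dyad_germs f x (A x) (A x)" if "x \<in> {u<..<v}" for x
    using that uv(2) unfolding A_def breaks_def by (auto intro!: someI_ex[of "\<lambda>a. dyad_germs f x a a"])
  have "A x = A y" if "x \<in> {u<..<v}" "y \<in> {u<..<v}" for x y
  proof (rule connected_local_const[OF _ that])
    show "\<forall>a\<in>{u<..<v}. \<forall>\<^sub>F b in at a within {u<..<v}. A a = A b"
    proof
      fix z assume z: "z \<in> {u<..<v}"
      have "\<forall>\<^sub>F w in at z. w \<in> {u<..<v} \<longrightarrow> A z = A w"
      proof -
        have l: "\<forall>\<^sub>F y in at_left z. f y = A z y" and r: "\<forall>\<^sub>F y in at_right z. f y = A z y"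
          using A[OF z] by (simp_all add: dyad_germs_def)
        have "A z = A w" if w: "w \<in> {u<..<v}"
          and e: "(\<forall>\<^sub>F y in at_right w. f y = A z y) \<and> (\<forall>\<^sub>F y in at_left w. f y = A z y)" for w
        proof -
          have "dyad_germs f w (A z) (A z)" using e A[OF z] by (simp add: dyad_germs_def)
          then show ?thesis using dyad_germs_unique A[OF w] by blast
        qed
        then show ?thesis unfolding eventually_at_split
          using eventually_nested_at_left[OF l] eventually_nested_at_right[OF r] by (auto elim!: eventually_mono)
      qed
      then show "\<forall>\<^sub>F b in at z within {u<..<v}. A z = A b"
        unfolding eventually_at_topological by blast
    qed
  qed simp
  moreover obtain w where w: "w \<in> {u<..<v}" using dense[OF uv(1)] by auto
  ultimately have Aw: "A x = A w" if "x \<in> {u<..<v}" for x using that by blast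
  have eq: "f x = A w x" if "x \<in> {u<..<v}" for x
    using dyad_germs_value(1)[OF m A[OF that]] Aw[OF that] by simp
  obtain k c where kc: "A w = (\<lambda>y. 2 powi k * y + c)"
    using A[OF w] unfolding dyad_germs_def dyad_affine_def by blast
  obtain a b where ab: "dyad_germs f u a b" using dyad_PL_germs[OF f] by blast
  have fu: "f u = 2 powi k * u + c"
  proof (rule tendsto_unique)
    show "filterlim f (nhds (f u)) (at_right u)"
      using strict_mono_surj_tendsto[OF m, of u] by (simp add: filterlim_at_split)
    have "\<forall>\<^sub>F y in at_right u. 2 powi k * y + c = f y"
      unfolding eventually_at_right_field using eq kc uv(1) by (intro exI[of _ v]) auto
    then show "filterlim f (nhds (2 powi k * u + c)) (at_right u)"
      by (rule Lim_transform_eventually[rotated]) (intro tendsto_intros)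
  qed simp
  have fv: "f v = 2 powi k * v + c"
  proof (rule tendsto_unique)
    show "filterlim f (nhds (f v)) (at_left v)"
      using strict_mono_surj_tendsto[OF m, of v] by (simp add: filterlim_at_split)
    have "\<forall>\<^sub>F y in at_left v. 2 powi k * y + c = f y"
      unfolding eventually_at_left_field using eq kc uv(1) by (intro exI[of _ u]) auto
    then show "filterlim f (nhds (2 powi k * v + c)) (at_left v)"
      by (rule Lim_transform_eventually[rotated]) (intro tendsto_intros)
  qed simp
  show ?thesis
  proof (intro exI ballI)
    fix t assume "t \<in> {u..v}"
    then consider "t = u" | "t = v" | "t \<in> {u<..<v}" by force
    then show "f t = 2 powi k * t + c" using fu fv eq kc by cases auto
  qed
qed

lemma piecewise_linear_dyad_PL:
  assumes "f \<in> dyad_PL" "\<And>x. x \<in> {a..b} \<Longrightarrow> g x = f x" shows "piecewise_linear a b g"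
  unfolding piecewise_linear_def
proof (rule exI[of _ "{a..b} \<inter> breaks f"], intro conjI allI impI)
  show "finite ({a..b} \<inter> breaks f)" by (rule finite_breaks[OF assms(1)])
  fix u v assume uv: "a \<le> u \<and> u < v \<and> v \<le> b \<and> {u<..<v} \<inter> ({a..b} \<inter> breaks f) = {}"
  then have "{u<..<v} \<inter> breaks f = {}" by fastforce
  then obtain k c where "\<forall>t\<in>{u..v}. f t = 2 powi k * t + c"
    using affine_off_breaks[OF assms(1)] uv by blast
  then show "\<exists>m c. \<forall>t\<in>{u..v}. g t = m * t + c" using assms(2) uv by (intro exI[of _ "2 powi k"] exI[of _ c]) auto
qed

section \<open>One-sided derivatives and recognition of dyadic germs\<close>

lemma DERIV_at_right_unique:
  assumes "(f has_real_derivative d) (at_right x)" "\<forall>\<^sub>F y in at_right x. f y = m * y + c" "f x = m * x + c"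
  shows "d = m"
proof (rule tendsto_unique)
  show "((\<lambda>y. (f y - f x) / (y - x)) \<longlongrightarrow> d) (at_right x)"
    using assms(1) by (simp add: has_field_derivative_iff)
  have "\<forall>\<^sub>F y in at_right x. y > x" by (simp add: eventually_at_filter)
  with assms(2) have "\<forall>\<^sub>F y in at_right x. m = (f y - f x) / (y - x)"
    by eventually_elim (simp add: assms(3) field_simps)
  then show "((\<lambda>y. (f y - f x) / (y - x)) \<longlongrightarrow> m) (at_right x)"
    by (rule Lim_transform_eventually[rotated]) simp
qed simp

lemma DERIV_at_left_unique:
  assumes "(f has_real_derivative d) (at_left x)" "\<forall>\<^sub>F y in at_left x. f y = m * y + c" "f x = m * x + c"
  shows "d = m"
proof (rule tendsto_unique)
  show "((\<lambda>y. (f y - f x) / (y - x)) \<longlongrightarrow> d) (at_left x)"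
    using assms(1) by (simp add: has_field_derivative_iff)
  have "\<forall>\<^sub>F y in at_left x. y < x" by (simp add: eventually_at_filter)
  with assms(2) have "\<forall>\<^sub>F y in at_left x. m = (f y - f x) / (y - x)"
    by eventually_elim (simp add: assms(3) field_simps)
  then show "((\<lambda>y. (f y - f x) / (y - x)) \<longlongrightarrow> m) (at_left x)"
    by (rule Lim_transform_eventually[rotated]) simp
qed simp

lemma dyad_PL_DERIV_right:
  assumes "f \<in> dyad_PL" "(f has_real_derivative d) (at_right x)" shows "\<exists>k::int. d = 2 powi k"
proof -
  obtain a b where ab: "dyad_germs f x a b" using dyad_PL_germs[OF assms(1)] by blast
  then obtain k c where kc: "b = (\<lambda>y. 2 powi k * y + c)" unfolding dyad_germs_def dyad_affine_def by blast
  then show ?thesis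
    using DERIV_at_right_unique[OF assms(2), of "2 powi k" c] ab
      dyad_germs_value(2)[OF dyad_PL_strict_mono[OF assms(1)] dyad_PL_surj[OF assms(1)] ab]
    by (auto simp: dyad_germs_def)
qed

lemma dyad_PL_DERIV_left:
  assumes "f \<in> dyad_PL" "(f has_real_derivative d) (at_left x)" shows "\<exists>k::int. d = 2 powi k"
proof -
  obtain a b where ab: "dyad_germs f x a b" using dyad_PL_germs[OF assms(1)] by blast
  then obtain k c where kc: "a = (\<lambda>y. 2 powi k * y + c)" unfolding dyad_germs_def dyad_affine_def by blast
  then show ?thesis
    using DERIV_at_left_unique[OF assms(2), of "2 powi k" c] ab
      dyad_germs_value(1)[OF dyad_PL_strict_mono[OF assms(1)] dyad_PL_surj[OF assms(1)] ab]
    by (auto simp: dyad_germs_def)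
qed

lemma dyad_PL_differentiable:
  assumes f: "f \<in> dyad_PL" and x: "x \<notin> breaks f" shows "\<exists>d. (f has_real_derivative d) (at x)"
proof -
  obtain a where a: "dyad_germs f x a a" using x by (auto simp: breaks_def)
  then obtain k c where kc: "a = (\<lambda>y. 2 powi k * y + c)" unfolding dyad_germs_def dyad_affine_def by blast
  have "\<forall>\<^sub>F y in at x. f y = 2 powi k * y + c" using a kc by (simp add: dyad_germs_def eventually_at_split)
  moreover have "f x = 2 powi k * x + c"
    using dyad_germs_value(1)[OF dyad_PL_strict_mono[OF f] dyad_PL_surj[OF f] a] kc by simp
  ultimately have "\<forall>\<^sub>F y in nhds x. f y = 2 powi k * y + c" by (simp add: eventually_nhds_conv_at)
  moreover have "((\<lambda>y. 2 powi k * y + c) has_real_derivative 2 powi k) (at x)"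
    by (auto intro!: derivative_eq_intros)
  ultimately show ?thesis using DERIV_cong_ev[of x x f "\<lambda>y. 2 powi k * y + c" "2 powi k" "2 powi k"] by blast
qed

text \<open>The assumptions on slopes and differentiability leave the constant terms of the germs
  open. Whether the constant term is dyadic is a locally constant property of the point, so one
  dyadic point \<open>p\<close> with dyadic image decides it on the whole line.\<close>

lemma dyad_PL_of_slopes:
  assumes f: "strict_mono f" "surj f"
    and right: "\<And>x. \<exists>k c. \<forall>\<^sub>F y in at_right x. f y = 2 powi k * y + c"
    and left: "\<And>x. \<exists>k c. \<forall>\<^sub>F y in at_left x. f y = 2 powi k * y + c"
    and smooth: "\<And>x. x \<notin> dyad \<Longrightarrow> \<exists>d. (f has_real_derivative d) (at x)"
    and p: "p \<in> dyad" "f p \<in> dyad"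
  shows "f \<in> dyad_PL"
proof -
  obtain k c where r: "\<And>x. \<forall>\<^sub>F y in at_right x. f y = 2 powi k x * y + c x" using right by metis
  obtain l d where l: "\<And>x. \<forall>\<^sub>F y in at_left x. f y = 2 powi l x * y + d x" using left by metis
  have fr: "f x = 2 powi k x * x + c x" for x
  proof (rule tendsto_unique)
    show "filterlim f (nhds (f x)) (at_right x)"
      using strict_mono_surj_tendsto[OF f, of x] by (simp add: filterlim_at_split)
    have "\<forall>\<^sub>F y in at_right x. 2 powi k x * y + c x = f y" using r[of x] by eventually_elim simp
    then show "filterlim f (nhds (2 powi k x * x + c x)) (at_right x)"
      by (rule Lim_transform_eventually[rotated]) (intro tendsto_intros)
  qed simp
  have fl: "f x = 2 powi l x * x + d x" for x
  proof (rule tendsto_unique)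
    show "filterlim f (nhds (f x)) (at_left x)"
      using strict_mono_surj_tendsto[OF f, of x] by (simp add: filterlim_at_split)
    have "\<forall>\<^sub>F y in at_left x. 2 powi l x * y + d x = f y" using l[of x] by eventually_elim simp
    then show "filterlim f (nhds (2 powi l x * x + d x)) (at_left x)"
      by (rule Lim_transform_eventually[rotated]) (intro tendsto_intros)
  qed simp
  \<comment> \<open>Differentiability forces equal slopes, and then equal constants since both germs
    have the value \<open>f x\<close>.\<close>
  have kl: "k x = l x \<and> c x = d x" if x: "x \<notin> dyad" for x
  proof -
    obtain e where e: "(f has_real_derivative e) (at x)" using smooth[OF x] by blast
    have "e = 2 powi k x" using e r fr
      by (intro DERIV_at_right_unique[of f e x]) (auto intro: has_field_derivative_at_within)
    moreover have "e = 2 powi l x" using e l fl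
      by (intro DERIV_at_left_unique[of f e x]) (auto intro: has_field_derivative_at_within)
    ultimately have kl: "(2::real) powi k x = 2 powi l x" by simp
    then have "c x = d x" using fr[of x] fl[of x] by simp
    moreover have "k x = l x" using affine_exp[of "k x" 0] affine_exp[of "l x" 0] kl by simp
    ultimately show ?thesis by simp
  qed
  \<comment> \<open>At a dyadic point both constants are \<open>f x\<close> minus a dyadic
    number.\<close>
  have cd: "c x \<in> dyad \<longleftrightarrow> d x \<in> dyad" for x
  proof (cases "x \<in> dyad")
    case True
    have "2 powi k x * x \<in> dyad" "2 powi l x * x \<in> dyad" using True by simp_all
    then show ?thesis using fr[of x] fl[of x] dyad_add_iff by (metis add.commute)
  qed (use kl in auto)
  \<comment> \<open>Just to the right of \<open>x\<close> the constant is \<open>c x\<close>, just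
    to the left it is \<open>d x\<close>; \<open>cd\<close> bridges the two.\<close>
  have ev: "\<forall>\<^sub>F y in at x. (c x \<in> dyad) = (c y \<in> dyad)" for x
  proof -
    have *: "k y = k' \<and> c y = c'" if "\<forall>\<^sub>F z in at_right y. f z = 2 powi k' * z + c'" for y k' c'
    proof -
      have "\<forall>\<^sub>F z in at_right y. 2 powi k y * z + c y = 2 powi k' * z + c'"
        using r[of y] that by eventually_elim simp
      from affine_eq_at_right[OF this] show ?thesis
        using affine_exp[of "k y" 0] affine_exp[of k' 0] by simp
    qed
    have "\<forall>\<^sub>F y in at_left x. c y = d x"
      using eventually_nested_at_left[OF l[of x]] by (auto elim!: eventually_mono dest: *)
    moreover have "\<forall>\<^sub>F y in at_right x. c y = c x"
      using eventually_nested_at_right[OF r[of x]] by (auto elim!: eventually_mono dest: *)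
    ultimately show ?thesis unfolding eventually_at_split by (auto elim!: eventually_mono simp: cd[of x])
  qed
  have "(c x \<in> dyad) = (c p \<in> dyad)" for x
    using connected_local_const[of UNIV x p "\<lambda>x. c x \<in> dyad"] ev by simp
  moreover have "c p \<in> dyad"
    using fr[of p] p dyad_diff[of "f p" "2 powi k p * p"] by simp
  ultimately have c: "c x \<in> dyad" for x by blast
  have "dyad_germs f x (\<lambda>y. 2 powi l x * y + d x) (\<lambda>y. 2 powi k x * y + c x)" for x
    unfolding dyad_germs_def using c cd[of x] l[of x] r[of x] kl[of x] by (auto intro!: dyad_affineI)
  then show ?thesis unfolding dyad_PL_def using f by blast
qed

lemma piecewise_linear_right:
  assumes "piecewise_linear a b f" "a \<le> x" "x < b"
  shows "\<exists>m c v. x < v \<and> v \<le> b \<and> (\<forall>t\<in>{x..v}. f t = m * t + c)"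
proof -
  obtain S where S: "finite S" "\<And>u v. a \<le> u \<and> u < v \<and> v \<le> b \<and> {u<..<v} \<inter> S = {} \<Longrightarrow>
           (\<exists>m c. \<forall>t\<in>{u..v}. f t = m * t + c)" using assms(1) unfolding piecewise_linear_def by blast
  define T where "T = insert b {t \<in> S. x < t}"
  have T: "finite T" "T \<noteq> {}" using S by (auto simp: T_def)
  have "{x<..<Min T} \<inter> S = {}"
  proof -
    have "Min T \<le> t" if "t \<in> S" "x < t" for t using that T(1) by (intro Min_le) (auto simp: T_def)
    then show ?thesis by fastforce
  qed
  moreover have "Min T \<le> b" using T by (intro Min_le) (auto simp: T_def)
  moreover have "x < Min T" using T assms(3) by (subst Min_gr_iff) (auto simp: T_def)
  ultimately show ?thesis using S(2)[of x "Min T"] assms(2) by blast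
qed

lemma piecewise_linear_left:
  assumes "piecewise_linear a b f" "a < x" "x \<le> b"
  shows "\<exists>m c v. v < x \<and> a \<le> v \<and> (\<forall>t\<in>{v..x}. f t = m * t + c)"
proof -
  obtain S where S: "finite S" "\<And>u v. a \<le> u \<and> u < v \<and> v \<le> b \<and> {u<..<v} \<inter> S = {} \<Longrightarrow>
           (\<exists>m c. \<forall>t\<in>{u..v}. f t = m * t + c)" using assms(1) unfolding piecewise_linear_def by blast
  define T where "T = insert a {t \<in> S. t < x}"
  have T: "finite T" "T \<noteq> {}" using S by (auto simp: T_def)
  have "{Max T<..<x} \<inter> S = {}"
  proof -
    have "t \<le> Max T" if "t \<in> S" "t < x" for t using that T(1) by (intro Max_ge) (auto simp: T_def)
    then show ?thesis by fastforce
  qed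
  moreover have "a \<le> Max T" using T by (intro Max_ge) (auto simp: T_def)
  moreover have "Max T < x" using T assms(2) by (subst Max_less_iff) (auto simp: T_def)
  ultimately show ?thesis using S(2)[of "Max T" x] assms(3) by blast
qed

section \<open>Perfectness of the compactly supported subgroups\<close>

text \<open>The hypothesis says that \<open>(s, t)\<close> maps the two-generated abelianization of \<open>G\<close> onto
  \<open>\<int>\<^sup>2\<close>; such a map is injective.\<close>

lemma (in group) hom_trivial_of_two_generators:
  assumes "comm_group Q" and q: "q \<in> hom G Q"
    and uv: "u \<in> carrier G" "v \<in> carrier G" and gen: "carrier G = generate G {u, v}"
    and s: "s \<in> hom G integer_group" and t: "t \<in> hom G integer_group"
    and x: "x \<in> carrier G" "s x = 1" "t x = 0" and y: "y \<in> carrier G" "s y = 0" "t y = 1"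
    and f: "f \<in> carrier G" "s f = 0" "t f = 0"
  shows "q f = \<one>\<^bsub>Q\<^esub>"
proof -
  interpret Q: comm_group Q by fact
  interpret q: group_hom G Q q using q by unfold_locales
  interpret s: group_hom G integer_group s using s by (intro group_hom.intro group_hom_axioms.intro group_integer_group group_axioms)
  interpret t: group_hom G integer_group t using t by (intro group_hom.intro group_hom_axioms.intro group_integer_group group_axioms)
  have qc: "q u \<in> carrier Q" "q v \<in> carrier Q" using uv by simp_all
  \<comment> \<open>One pair of exponents computes \<open>q\<close>, \<open>s\<close> and
    \<open>t\<close> simultaneously, which is possible because the three targets are
    abelian.\<close>
  have claim: "\<exists>i j::int. q g = q u [^]\<^bsub>Q\<^esub> i \<otimes>\<^bsub>Q\<^esub> q v [^]\<^bsub>Q\<^esub> j \<and>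
      s g = i * s u + j * s v \<and> t g = i * t u + j * t v" if "g \<in> generate G {u, v}" for g
    using that
  proof (induction rule: generate.induct)
    case one
    show ?case by (rule exI[of _ 0], rule exI[of _ 0]) simp
  next
    case (incl h)
    then consider "h = u" | "h = v" by blast
    then show ?case
    proof cases
      case 1 then show ?thesis using qc by (intro exI[of _ 1] exI[of _ 0]) simp
    next
      case 2 then show ?thesis using qc by (intro exI[of _ 0] exI[of _ 1]) simp
    qed
  next
    case (inv h)
    then consider "h = u" | "h = v" by blast
    then show ?case
    proof cases
      case 1 then show ?thesis using qc uv by (intro exI[of _ "-1"] exI[of _ 0]) (simp add: Q.int_pow_neg)
    next
      case 2 then show ?thesis using qc uv by (intro exI[of _ 0] exI[of _ "-1"]) (simp add: Q.int_pow_neg)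
    qed
  next
    case (eng h1 h2)
    have h: "h1 \<in> carrier G" "h2 \<in> carrier G" using eng gen by simp_all
    obtain i j where 1: "q h1 = q u [^]\<^bsub>Q\<^esub> i \<otimes>\<^bsub>Q\<^esub> q v [^]\<^bsub>Q\<^esub> j"
      "s h1 = i * s u + j * s v" "t h1 = i * t u + j * t v" using eng by blast
    obtain i' j' where 2: "q h2 = q u [^]\<^bsub>Q\<^esub> i' \<otimes>\<^bsub>Q\<^esub> q v [^]\<^bsub>Q\<^esub> j'"
      "s h2 = i' * s u + j' * s v" "t h2 = i' * t u + j' * t v" using eng by blast
    have "q (h1 \<otimes> h2) = q u [^]\<^bsub>Q\<^esub> (i + i') \<otimes>\<^bsub>Q\<^esub> q v [^]\<^bsub>Q\<^esub> (j + j')"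
      using h qc 1 2 by (simp add: Q.int_pow_mult Q.m_ac)
    moreover have "s (h1 \<otimes> h2) = (i + i') * s u + (j + j') * s v" "t (h1 \<otimes> h2) = (i + i') * t u + (j + j') * t v"
      using h 1 2 by (simp_all add: algebra_simps)
    ultimately show ?case by blast
  qed
  have cl: "x \<in> generate G {u, v}" "y \<in> generate G {u, v}" "f \<in> generate G {u, v}" using x y f gen by simp_all
  obtain i1 j1 where 1: "i1 * s u + j1 * s v = 1" "i1 * t u + j1 * t v = 0"
    using claim[OF cl(1)] unfolding x by metis
  obtain i2 j2 where 2: "i2 * s u + j2 * s v = 0" "i2 * t u + j2 * t v = 1"
    using claim[OF cl(2)] unfolding y by metis
  obtain i j where 3: "q f = q u [^]\<^bsub>Q\<^esub> i \<otimes>\<^bsub>Q\<^esub> q v [^]\<^bsub>Q\<^esub> j"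
    "i * s u + j * s v = 0" "i * t u + j * t v = 0" using claim[OF cl(3)] unfolding f by metis
  \<comment> \<open>The determinant of \<open>(s, t)\<close> on the generators. It is nonzero
    because it divides the determinant 1 of \<open>(s, t)\<close> on \<open>x\<close>,
    \<open>y\<close>; Cramer's rule then makes the exponents of \<open>f\<close> vanish.\<close>
  define d where "d = s u * t v - s v * t u"
  have "(i1 * j2 - j1 * i2) * d = (i1 * s u + j1 * s v) * (i2 * t u + j2 * t v) -
      (i1 * t u + j1 * t v) * (i2 * s u + j2 * s v)" by (simp add: d_def algebra_simps)
  then have d: "d \<noteq> 0" unfolding 1 2 by auto
  have "i * d = t v * (i * s u + j * s v) - s v * (i * t u + j * t v)"
    "j * d = s u * (i * t u + j * t v) - t u * (i * s u + j * s v)" by (simp_all add: d_def algebra_simps)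
  then have "i = 0" "j = 0" unfolding 3(2,3) using d by simp_all
  then show ?thesis using 3(1) qc by simp
qed

text \<open>The preceding lemma for the projection to the abelianization, whose kernel is the
  derived subgroup.\<close>

lemma (in group) derived_of_two_generators:
  assumes "u \<in> carrier G" "v \<in> carrier G" "carrier G = generate G {u, v}"
    "s \<in> hom G integer_group" "t \<in> hom G integer_group"
    "x \<in> carrier G" "s x = 1" "t x = 0" "y \<in> carrier G" "s y = 0" "t y = 1"
    "f \<in> carrier G" "s f = 0" "t f = 0"
  shows "f \<in> derived G (carrier G)"
proof -
  interpret D: normal "derived G (carrier G)" G by (rule derived_self_is_normal)
  have "derived G (carrier G) #> f = \<one>\<^bsub>G Mod derived G (carrier G)\<^esub>"
    by (rule hom_trivial_of_two_generators[OF derived_quot_is_comm_group D.r_coset_hom_Mod assms])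
  then show ?thesis using rcos_self[OF assms(12) D.subgroup_axioms] by (simp add: FactGroup_def)
qed

text \<open>Points just outside the interval are fixed, so monotonicity gives
  \<open>a \<le> f a\<close> and \<open>f b \<le> b\<close>; the inverse gives the opposite
  inequalities.\<close>

lemma dyad_PL_on_endpoints:
  assumes f: "f \<in> dyad_PL_on a b" shows "f a = a" "f b = b"
proof -
  have ge: "a \<le> h a" "h b \<le> b" if "h \<in> dyad_PL_on a b" for h
  proof -
    have h: "strict_mono h" "\<And>x. x \<notin> {a..b} \<Longrightarrow> h x = x" using that by (auto simp: dyad_PL_on_def dyad_PL_strict_mono)
    have "x \<le> h a" if "x < a" for x
      using h(2)[of x] strict_mono_less[OF h(1), of x a] that by simp
    then show "a \<le> h a" by (rule dense_le)
    have "h b \<le> x" if "b < x" for x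
      using h(2)[of x] strict_mono_less[OF h(1), of b x] that by simp
    then show "h b \<le> b" by (rule dense_ge)
  qed
  have m: "strict_mono f" "surj f" using f by (auto simp: dyad_PL_on_def dyad_PL_strict_mono dyad_PL_surj)
  have "inv_into UNIV f \<in> dyad_PL_on a b" by (rule subgroup_Homeo_inv[OF subgroup_dyad_PL_on f])
  from ge[OF this] have "f a \<le> f (inv_into UNIV f a)" "f (inv_into UNIV f b) \<le> f b"
    by (simp_all add: strict_mono_less_eq[OF m(1)])
  then show "f a = a" "f b = b" using ge[OF f] by (simp_all add: inv_strict_mono_surj[OF m])
qed

lemma dyad_PL_c_on: "f \<in> dyad_PL_c a b \<Longrightarrow> f \<in> dyad_PL_on a b"
  unfolding dyad_PL_c_def dyad_PL_on_def by auto

lemma exp_trivial: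
  "\<forall>\<^sub>F y in at_right x. f y = y \<Longrightarrow> f \<in> dyad_PL \<Longrightarrow> right_exp f x = 0"
  "\<forall>\<^sub>F y in at_left x. f y = y \<Longrightarrow> f \<in> dyad_PL \<Longrightarrow> left_exp f x = 0"
proof -
  have e: "affine_exp (\<lambda>y. y) = 0" using affine_exp[of 0 0] by simp
  show "right_exp f x = 0" if r: "\<forall>\<^sub>F y in at_right x. f y = y" and f: "f \<in> dyad_PL"
  proof -
    obtain a b where ab: "dyad_germs f x a b" using dyad_PL_germs[OF f] by blast
    then obtain k c where kc: "b = (\<lambda>y. 2 powi k * y + c)" unfolding dyad_germs_def dyad_affine_def by blast
    have "\<forall>\<^sub>F y in at_right x. f y = b y" using ab by (simp add: dyad_germs_def)
    with r have "\<forall>\<^sub>F y in at_right x. 2 powi k * y + c = 1 * y + 0" by eventually_elim (simp add: kc)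
    from affine_eq_at_right[OF this] have "b = (\<lambda>y. y)" by (simp add: kc)
    then show ?thesis using left_right_exp(2)[OF ab] e by simp
  qed
  show "left_exp f x = 0" if r: "\<forall>\<^sub>F y in at_left x. f y = y" and f: "f \<in> dyad_PL"
  proof -
    obtain a b where ab: "dyad_germs f x a b" using dyad_PL_germs[OF f] by blast
    then obtain k c where kc: "a = (\<lambda>y. 2 powi k * y + c)" unfolding dyad_germs_def dyad_affine_def by blast
    have "\<forall>\<^sub>F y in at_left x. f y = a y" using ab by (simp add: dyad_germs_def)
    with r have "\<forall>\<^sub>F y in at_left x. 2 powi k * y + c = 1 * y + 0" by eventually_elim (simp add: kc)
    from affine_eq_at_left[OF this] have "a = (\<lambda>y. y)" by (simp add: kc)
    then show ?thesis using left_right_exp(1)[OF ab] e by simp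
  qed
qed

text \<open>Realizes the exponents (1, 0) and (0, 1), so the end slopes map onto
  \<int>\<times>\<int>. The maps \<open>2 * x - 1/16\<close> and \<open>2 * x - 15/16\<close> double
  the distance to their fixed points \<open>1/16\<close> and \<open>15/16\<close>. They are made
  trivial on the far side of the middle, and replaced by the identity beyond the fixed
  point.\<close>

lemma dyad_PL_on_exps:
  shows "\<exists>f\<in>dyad_PL_on (1/16) (15/16). right_exp f (1/16) = 1 \<and> left_exp f (15/16) = 0"
    and "\<exists>f\<in>dyad_PL_on (1/16) (15/16). right_exp f (1/16) = 0 \<and> left_exp f (15/16) = 1"
proof -
  have two: "(\<lambda>y. 2 * y - p) \<in> dyad_affine" if "p \<in> dyad" for p
    using dyad_affineI[of "- p" 1] that by (simp add: dyad_uminus)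
  have exp2: "affine_exp (\<lambda>y. 2 * y - p) = 1" for p using affine_exp[of 1 "- p"] by simp
  show "\<exists>f\<in>dyad_PL_on (1/16) (15/16). right_exp f (1/16) = 1 \<and> left_exp f (15/16) = 0"
  proof -
    obtain h where h: "h \<in> dyad_PL_c 0 (1/2)" "\<forall>x\<in>{1/16..1/8}. h x = 2 * x - 1/16"
      using dyad_PL_c_extend[of "\<lambda>x. 2 * x - 1/16" 0 "1/16" "1/8" "1/2"] dyad_affine_PL[OF two[of "1/16"]] by auto
    then have h': "h \<in> dyad_PL" "\<And>x. x \<ge> 1/2 \<Longrightarrow> h x = x"
      by (auto simp: dyad_PL_c_def)
    let ?f = "\<lambda>x. if x \<le> 1/16 then x else h x"
    have f: "?f \<in> dyad_PL" using h h' by (intro dyad_PL_glue dyad_PL_id) auto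
    then have "?f \<in> dyad_PL_on (1/16) (15/16)" using h' by (auto simp: dyad_PL_on_def)
    moreover have "left_exp ?f (15/16) = 0"
      by (rule exp_trivial(2)[OF _ f]) (auto simp: eventually_at_left_field h' intro!: exI[of _ "1/2"])
    moreover have "dyad_germs ?f (1/16) (\<lambda>y. y) (\<lambda>y. 2 * y - 1/16)"
    proof -
      have "\<forall>\<^sub>F y in at_right (1/16). ?f y = 2 * y - 1/16"
        unfolding eventually_at_right_field using h(2) by (intro exI[of _ "1/8"]) auto
      moreover have "\<forall>\<^sub>F y in at_left (1/16). ?f y = y"
        unfolding eventually_at_left_field by (intro exI[of _ 0]) auto
      ultimately show ?thesis using two[of "1/16"] by (simp add: dyad_germs_def dyad_affine_id)
    qed
    then have "right_exp ?f (1/16) = 1" using left_right_exp(2) exp2[of "1/16"] by simp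
    ultimately show ?thesis by blast
  qed
  show "\<exists>f\<in>dyad_PL_on (1/16) (15/16). right_exp f (1/16) = 0 \<and> left_exp f (15/16) = 1"
  proof -
    obtain h where h: "h \<in> dyad_PL_c (1/2) 1" "\<forall>x\<in>{7/8..15/16}. h x = 2 * x - 15/16"
      using dyad_PL_c_extend[of "\<lambda>x. 2 * x - 15/16" "1/2" "7/8" "15/16" 1] dyad_affine_PL[OF two[of "15/16"]] by auto
    then have h': "h \<in> dyad_PL" "\<And>x. x \<le> 1/2 \<Longrightarrow> h x = x"
      by (auto simp: dyad_PL_c_def)
    let ?f = "\<lambda>x. if x \<le> 15/16 then h x else x"
    have f: "?f \<in> dyad_PL" using h h' by (intro dyad_PL_glue dyad_PL_id) auto
    then have "?f \<in> dyad_PL_on (1/16) (15/16)" using h' by (auto simp: dyad_PL_on_def)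
    moreover have "right_exp ?f (1/16) = 0"
      by (rule exp_trivial(1)[OF _ f]) (auto simp: eventually_at_right_field h' intro!: exI[of _ "1/2"])
    moreover have "dyad_germs ?f (15/16) (\<lambda>y. 2 * y - 15/16) (\<lambda>y. y)"
    proof -
      have "\<forall>\<^sub>F y in at_left (15/16). ?f y = 2 * y - 15/16"
        unfolding eventually_at_left_field using h(2) by (intro exI[of _ "7/8"]) auto
      moreover have "\<forall>\<^sub>F y in at_right (15/16). ?f y = y"
        unfolding eventually_at_right_field by (intro exI[of _ 1]) auto
      ultimately show ?thesis using two[of "15/16"] by (simp add: dyad_germs_def dyad_affine_id)
    qed
    then have "left_exp ?f (15/16) = 1" using left_right_exp(1) exp2[of "15/16"] by simp
    ultimately show ?thesis by blast
  qed
qed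

text \<open>A map that is the identity near both ends has end exponents (0, 0), and the
  two-generator criterion applies. The exponents are homomorphisms because the ends are
  fixed.\<close>

lemma dyad_PL_c_derived:
  assumes gen: "generate Homeo_plus_R {u, v} = dyad_PL_on (1/16) (15/16)" (is "_ = ?A")
  shows "dyad_PL_c (1/16) (15/16) \<subseteq> derived Homeo_plus_R ?A"
proof
  fix f assume f: "f \<in> dyad_PL_c (1/16) (15/16)"
  let ?G = "Homeo_plus_R\<lparr>carrier := ?A\<rparr>"
  note sub = subgroup_dyad_PL_on[of "1/16" "15/16"]
  interpret A: group ?G by (rule Homeo.subgroup_imp_group[OF sub])
  have uv: "u \<in> ?A" "v \<in> ?A" unfolding gen[symmetric] by (auto intro: generate.incl)
  have PL: "h \<in> dyad_PL" if "h \<in> ?A" for h using that by (simp add: dyad_PL_on_def)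
  have s: "(\<lambda>f. right_exp f (1/16)) \<in> hom ?G integer_group"
    by (auto simp: hom_def exp_comp PL dyad_PL_on_endpoints)
  have t: "(\<lambda>f. left_exp f (15/16)) \<in> hom ?G integer_group"
    by (auto simp: hom_def exp_comp PL dyad_PL_on_endpoints)
  have fA: "f \<in> ?A" using f by (rule dyad_PL_c_on)
  obtain x where x: "x \<in> ?A" "right_exp x (1/16) = 1" "left_exp x (15/16) = 0" using dyad_PL_on_exps by blast
  obtain y where y: "y \<in> ?A" "right_exp y (1/16) = 0" "left_exp y (15/16) = 1" using dyad_PL_on_exps by blast
  obtain r s where "f \<in> dyad_PL" "r \<in> dyad" "s \<in> dyad" "1/16 < r" "r < s" "s < 15/16"
    and fx: "\<And>x. x \<le> r \<or> s \<le> x \<Longrightarrow> f x = x" using f by (rule dyad_PL_cE) blast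
  then have "\<forall>\<^sub>F y in at_right (1/16). f y = y"
    unfolding eventually_at_right_field by (intro exI[of _ r]) (simp add: fx)
  moreover have "\<forall>\<^sub>F y in at_left (15/16). f y = y"
    unfolding eventually_at_left_field using \<open>s < 15/16\<close> by (intro exI[of _ s]) (simp add: fx)
  ultimately have "right_exp f (1/16) = 0" "left_exp f (15/16) = 0" using exp_trivial PL[OF fA] by blast+
  moreover have "generate ?G {u, v} = ?A"
    using Homeo.generate_consistent[OF _ sub, of "{u, v}"] uv gen by simp
  ultimately have "f \<in> derived ?G (carrier ?G)"
    using uv fA x y s t by (intro A.derived_of_two_generators[of u v "\<lambda>f. right_exp f (1/16)" "\<lambda>f. left_exp f (15/16)" x y f]) simp_all
  also have "\<dots> = derived Homeo_plus_R ?A"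
    using Homeo.derived_consistent[OF subset_refl sub] by simp
  finally show "f \<in> derived Homeo_plus_R ?A" .
qed

text \<open>The commutator statement is known on \<open>[1/16, 15/16]\<close>. A dyadic map
  \<open>q\<close> transports it to an interval \<open>[a', b']\<close> that contains the support of
  \<open>f\<close> and lies inside \<open>(a, b)\<close>. All of
  \<open>dyad_PL_on (1/16) (15/16)\<close>, whatever its end slopes, then lands in
  \<open>dyad_PL_c a b\<close>, so the commutators that produce \<open>f\<close> lie in
  \<open>K\<close>.\<close>

lemma dyad_PL_c_perfect:
  assumes gen: "generate Homeo_plus_R {u, v} = dyad_PL_on (1/16) (15/16)"
    and K: "subgroup K Homeo_plus_R"
    and comm: "\<And>g h. g \<in> dyad_PL_c a b \<Longrightarrow> h \<in> dyad_PL_c a b \<Longrightarrow>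
      g \<circ> h \<circ> inv_into UNIV g \<circ> inv_into UNIV h \<in> K"
  shows "dyad_PL_c a b \<subseteq> K"
proof
  fix f assume "f \<in> dyad_PL_c a b"
  then obtain r s where f: "f \<in> dyad_PL" and rs: "a < r" "r < s" "s < b" "\<And>x. x \<le> r \<or> s \<le> x \<Longrightarrow> f x = x"
    by (rule dyad_PL_cE) blast
  obtain a' b' where a'b': "a' \<in> dyad" "b' \<in> dyad" "a < a'" "a' < r" "s < b'" "b' < b"
    using dyad_dense[of a r] dyad_dense[of s b] rs by blast
  obtain q where q: "q \<in> dyad_PL" "q a' = 1/16" "q b' = 15/16"
    using dyad_PL_interpolate[of a' b' "1/16" "15/16"] a'b' rs by auto
  note m = dyad_PL_strict_mono[OF q(1)] dyad_PL_surj[OF q(1)]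
  note i = inv_strict_mono_surj[OF m]
  let ?q = "inv_into UNIV q"
  define c where "c h = ?q \<circ> h \<circ> q" for h
  have qC: "q \<in> carrier Homeo_plus_R" "?q \<in> carrier Homeo_plus_R" using m i by (simp_all add: carrier_Homeo_plus_R)
  have C_comp: "g \<circ> h \<in> carrier Homeo_plus_R" if "g \<in> carrier Homeo_plus_R" "h \<in> carrier Homeo_plus_R" for g h
    using Homeo.m_closed[OF that(2,1)] by simp
  have c_comp: "c (g \<circ> h) = c g \<circ> c h" for g h by (simp add: c_def fun_eq_iff i)
  have c_inv: "c (inv_into UNIV h) = inv_into UNIV (c h)" if "h \<in> carrier Homeo_plus_R" for h
  proof -
    have h: "strict_mono h" "surj h" using that by (simp_all add: carrier_Homeo_plus_R)
    have "c h \<in> carrier Homeo_plus_R" unfolding c_def using that qC by (intro C_comp)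
    then have ch: "strict_mono (c h)" "surj (c h)" by (simp_all add: carrier_Homeo_plus_R)
    have "c h (c (inv_into UNIV h) x) = x" for x by (simp add: c_def i inv_strict_mono_surj[OF h])
    then show ?thesis using inv_strict_mono_surj(4)[OF ch] by (metis ext)
  qed
  \<comment> \<open>With \<open>K\<close> pulled back along the conjugation, only the commutators
    generating \<open>derived\<close> have to be tested.\<close>
  define K' where "K' = {h \<in> carrier Homeo_plus_R. c h \<in> K}"
  have K': "subgroup K' Homeo_plus_R"
  proof (rule subgroup_HomeoI)
    show "id \<in> K'" using subgroup_Homeo_id[OF K] i by (auto simp: K'_def c_def carrier_Homeo_plus_R strict_mono_def comp_def id_def)
    fix g assume g: "g \<in> K'"
    then show "strict_mono g \<and> surj g" by (simp add: K'_def carrier_Homeo_plus_R)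
    then show "inv_into UNIV g \<in> K'"
      using g subgroup_Homeo_inv[OF K, of "c g"] by (simp add: K'_def c_inv carrier_Homeo_plus_R inv_strict_mono_surj)
    fix h assume h: "h \<in> K'"
    have "g \<circ> h \<in> carrier Homeo_plus_R" using g h by (intro C_comp) (simp_all add: K'_def)
    then show "g \<circ> h \<in> K'" using g h subgroup_Homeo_comp[OF K, of "c g" "c h"] by (simp add: K'_def c_comp)
  qed
  have cPL: "c h \<in> dyad_PL_c a b" if h: "h \<in> dyad_PL_on (1/16) (15/16)" for h
  proof (rule dyad_PL_cI[of _ a a' b' b])
    show "c h \<in> dyad_PL" unfolding c_def using h q by (intro dyad_PL_comp dyad_PL_inv) (auto simp: dyad_PL_on_def)
    fix x assume x: "x < a' \<or> b' < x"
    then have "q x < q a' \<or> q b' < q x" using strict_mono_less[OF m(1)] by blast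
    then have "q x \<notin> {1/16..15/16}" unfolding q(2,3) by auto
    then have "h (q x) = q x" using h by (simp add: dyad_PL_on_def)
    then show "c h x = x" by (simp add: c_def i)
  qed (use a'b' rs in auto)
  have "derived Homeo_plus_R (dyad_PL_on (1/16) (15/16)) \<subseteq> K'"
    unfolding derived_def
  proof (rule Homeo.generate_subgroup_incl[OF _ K'], safe)
    fix g h assume g: "g \<in> dyad_PL_on (1/16) (15/16)" and h: "h \<in> dyad_PL_on (1/16) (15/16)"
    note sub = subgroup_dyad_PL_on[of "1/16" "15/16"]
    have gh: "inv_into UNIV g \<in> dyad_PL_on (1/16) (15/16)" "inv_into UNIV h \<in> dyad_PL_on (1/16) (15/16)"
      using g h subgroup_Homeo_inv[OF sub] by blast+
    have C: "g \<in> carrier Homeo_plus_R" "h \<in> carrier Homeo_plus_R" using g h subgroup.mem_carrier[OF sub] by auto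
    have ii: "inv_into UNIV (inv_into UNIV g) = g" "inv_into UNIV (inv_into UNIV h) = h"
      using C by (auto simp: carrier_Homeo_plus_R bij_def strict_mono_imp_inj_on inv_inv_eq)
    have C': "inv_into UNIV g \<in> carrier Homeo_plus_R" "inv_into UNIV h \<in> carrier Homeo_plus_R"
      using gh subgroup.mem_carrier[OF sub] by auto
    \<comment> \<open>The group product runs against \<open>\<circ>\<close>: the group commutator of
      \<open>g\<close> and \<open>h\<close> is the functional commutator of the inverses of
      \<open>h\<close> and \<open>g\<close>.\<close>
    have "c (inv_into UNIV h \<circ> inv_into UNIV g \<circ> h \<circ> g) =
        c (inv_into UNIV h) \<circ> c (inv_into UNIV g) \<circ> inv_into UNIV (c (inv_into UNIV h)) \<circ> inv_into UNIV (c (inv_into UNIV g))"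
      using c_inv[OF C'(1)] c_inv[OF C'(2)] by (simp add: c_comp ii)
    also have "\<dots> \<in> K" by (intro comm cPL gh)
    finally have "c (g \<otimes>\<^bsub>Homeo_plus_R\<^esub> h \<otimes>\<^bsub>Homeo_plus_R\<^esub> inv\<^bsub>Homeo_plus_R\<^esub> g \<otimes>\<^bsub>Homeo_plus_R\<^esub> inv\<^bsub>Homeo_plus_R\<^esub> h) \<in> K"
      using C by (simp add: inv_Homeo_plus_R comp_assoc)
    moreover have "g \<otimes>\<^bsub>Homeo_plus_R\<^esub> h \<otimes>\<^bsub>Homeo_plus_R\<^esub> inv\<^bsub>Homeo_plus_R\<^esub> g \<otimes>\<^bsub>Homeo_plus_R\<^esub> inv\<^bsub>Homeo_plus_R\<^esub> h \<in> carrier Homeo_plus_R"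
      using C by (intro Homeo.m_closed Homeo.inv_closed)
    ultimately show "g \<otimes>\<^bsub>Homeo_plus_R\<^esub> h \<otimes>\<^bsub>Homeo_plus_R\<^esub> inv\<^bsub>Homeo_plus_R\<^esub> g \<otimes>\<^bsub>Homeo_plus_R\<^esub> inv\<^bsub>Homeo_plus_R\<^esub> h \<in> K'"
      unfolding K'_def by blast
  qed
  moreover have "q \<circ> f \<circ> ?q \<in> dyad_PL_c (1/16) (15/16)"
  proof (rule dyad_PL_cI[of _ _ "q r" "q s"])
    show "q \<circ> f \<circ> ?q \<in> dyad_PL" using f q by (intro dyad_PL_comp dyad_PL_inv)
    show "1/16 < q r" "q s < 15/16" "q r \<le> q s"
      using a'b' rs strict_mono_less[OF m(1)] by (auto simp: q(2,3)[symmetric] strict_mono_less_eq[OF m(1)])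
    fix x assume "x < q r \<or> q s < x"
    then have "?q x < r \<or> s < ?q x" using strict_mono_less[OF i(1), of x "q r"] strict_mono_less[OF i(1), of "q s" x] i(4) by auto
    then show "(q \<circ> f \<circ> ?q) x = x" using rs(4)[of "?q x"] i(3) by auto
  qed
  ultimately have "c (q \<circ> f \<circ> ?q) \<in> K" using dyad_PL_c_derived[OF gen] by (auto simp: K'_def)
  moreover have "c (q \<circ> f \<circ> ?q) = f" by (simp add: c_def fun_eq_iff i)
  ultimately show "f \<in> K" by simp
qed

section \<open>Thompson's group as a group of homeomorphisms of the line\<close>

lemma homeo_group_mult: "f \<otimes>\<^bsub>homeo_group X\<^esub> g = compose (topspace X) g f"
  and homeo_group_one: "\<one>\<^bsub>homeo_group X\<^esub> = (\<lambda>x\<in>topspace X. x)"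
  and homeo_group_carrier: "f \<in> carrier (homeo_group X) \<longleftrightarrow> f \<in> extensional (topspace X) \<and> homeomorphic_map X X f"
  by (simp_all add: homeo_group_def)

lemma homeo_group_restrict:
  assumes "homeomorphic_map X X f" shows "restrict f (topspace X) \<in> carrier (homeo_group X)"
  using homeomorphic_map_eq[OF assms, of "restrict f (topspace X)"] by (simp add: homeo_group_carrier)

lemma group_homeo_group: "group (homeo_group X)"
proof (rule groupI)
  fix f g assume fg: "f \<in> carrier (homeo_group X)" "g \<in> carrier (homeo_group X)"
  then have "homeomorphic_map X X (g \<circ> f)"
    by (intro homeomorphic_map_compose[where Y = X]) (simp_all add: homeo_group_carrier)
  from homeo_group_restrict[OF this] show "f \<otimes>\<^bsub>homeo_group X\<^esub> g \<in> carrier (homeo_group X)"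
    by (simp add: homeo_group_mult compose_def comp_def)
next
  show "\<one>\<^bsub>homeo_group X\<^esub> \<in> carrier (homeo_group X)"
    using homeo_group_restrict[of X "\<lambda>x. x"] homeomorphic_map_id[of X X] by (simp add: homeo_group_one id_def)
next
  fix f g h assume "f \<in> carrier (homeo_group X)" "g \<in> carrier (homeo_group X)" "h \<in> carrier (homeo_group X)"
  moreover have "f ` topspace X = topspace X" if "f \<in> carrier (homeo_group X)" for f
    using that homeomorphic_imp_surjective_map[of X X f] by (simp add: homeo_group_carrier)
  ultimately show "f \<otimes>\<^bsub>homeo_group X\<^esub> g \<otimes>\<^bsub>homeo_group X\<^esub> h = f \<otimes>\<^bsub>homeo_group X\<^esub> (g \<otimes>\<^bsub>homeo_group X\<^esub> h)"
    by (auto simp: homeo_group_mult compose_def fun_eq_iff restrict_def)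
next
  fix f assume "f \<in> carrier (homeo_group X)"
  then show "\<one>\<^bsub>homeo_group X\<^esub> \<otimes>\<^bsub>homeo_group X\<^esub> f = f"
    by (auto simp: homeo_group_mult homeo_group_one homeo_group_carrier compose_def fun_eq_iff extensional_def)
next
  fix f assume f: "f \<in> carrier (homeo_group X)"
  then obtain g where g: "homeomorphic_maps X X f g" by (auto simp: homeo_group_carrier homeomorphic_map_maps)
  then have hg: "homeomorphic_map X X g" by (simp add: homeomorphic_maps_map)
  let ?g = "restrict g (topspace X)"
  have "?g \<in> carrier (homeo_group X)" by (rule homeo_group_restrict[OF hg])
  moreover have "?g \<otimes>\<^bsub>homeo_group X\<^esub> f = \<one>\<^bsub>homeo_group X\<^esub>"
    using g by (auto simp: homeo_group_mult homeo_group_one compose_def homeomorphic_maps_def fun_eq_iff)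
  ultimately show "\<exists>g\<in>carrier (homeo_group X). g \<otimes>\<^bsub>homeo_group X\<^esub> f = \<one>\<^bsub>homeo_group X\<^esub>" by blast
qed

interpretation HI: group Homeo_I by (rule group_homeo_group)

definition extend_I :: "(real \<Rightarrow> real) \<Rightarrow> real \<Rightarrow> real" where
  "extend_I f x = (if x \<in> {0..1} then f x else x)"

lemma Homeo_I_image: "f \<in> carrier Homeo_I \<Longrightarrow> f ` {0..1} = {0..1}"
  using homeomorphic_imp_surjective_map[of "top_of_set {0..1}" "top_of_set {0..1}" f] by (simp add: homeo_group_carrier)

lemma extend_I_mult:
  assumes "f \<in> carrier Homeo_I" shows "extend_I (f \<otimes>\<^bsub>Homeo_I\<^esub> g) = extend_I g \<circ> extend_I f"
  using Homeo_I_image[OF assms] by (auto simp: extend_I_def homeo_group_mult compose_def fun_eq_iff)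

lemma extend_I_one: "extend_I \<one>\<^bsub>Homeo_I\<^esub> = id"
  by (auto simp: extend_I_def homeo_group_one)

lemma thompson_F_endpoints:
  assumes "f \<in> thompson_F" shows "f 0 = 0" "f 1 = 1"
proof -
  have f: "f ` {0..1} = {0..1}" "strict_mono_on {0..1} f" using assms Homeo_I_image by (auto simp: thompson_F_def)
  have "0 \<in> f ` {0..1}" "1 \<in> f ` {0..1}" unfolding f(1) by simp_all
  then obtain u v where uv: "u \<in> {0..1}" "f u = 0" "v \<in> {0..1}" "f v = 1" by (metis imageE)
  have r: "f x \<in> {0..1}" if "x \<in> {0..1}" for x using f(1) that by blast
  have "f 0 \<le> f u" "f v \<le> f 1" 
    using strict_mono_on_leD[OF f(2), of 0 u] strict_mono_on_leD[OF f(2), of v 1] uv(1,3) by simp_all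
  then show "f 0 = 0" "f 1 = 1" using uv r[of 0] r[of 1] by auto
qed

lemma extend_I_strict_mono_surj:
  assumes "f \<in> thompson_F" shows "strict_mono (extend_I f)" "surj (extend_I f)"
proof -
  have f: "f ` {0..1} = {0..1}" "strict_mono_on {0..1} f" using assms Homeo_I_image by (auto simp: thompson_F_def)
  have r: "0 \<le> f x" "f x \<le> 1" if "0 \<le> x" "x \<le> 1" for x
    using imageI[of x "{0..1}" f] that unfolding f(1) by simp_all
  show "strict_mono (extend_I f)"
  proof (rule strict_monoI)
    fix x y :: real assume xy: "x < y"
    have "f x < f y" if "0 \<le> x" "y \<le> 1" using that xy f(2) by (auto simp: strict_mono_on_def)
    then show "extend_I f x < extend_I f y"
      using xy r[of x] r[of y] by (auto simp: extend_I_def)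
  qed
  show "surj (extend_I f)"
    unfolding surj_def
  proof
    fix y show "\<exists>x. y = extend_I f x"
    proof (cases "y \<in> {0..1}")
      case True
      then obtain x where "x \<in> {0..1}" "y = f x" using f(1) by blast
      then show ?thesis by (intro exI[of _ x]) (simp add: extend_I_def)
    qed (auto simp: extend_I_def intro: exI[of _ y])
  qed
qed

text \<open>The definition of F constrains the affine pieces only through slopes and
  differentiability. Dyadic constant terms come from \<open>dyad_PL_of_slopes\<close>, started at
  the fixed point 0; outside \<open>[0,1]\<close> the exponent is 0.\<close>

lemma extend_I_dyad_PL: assumes f: "f \<in> thompson_F" shows "extend_I f \<in> dyad_PL"
proof (rule dyad_PL_of_slopes)
  let ?F = "extend_I f"
  show "strict_mono ?F" "surj ?F" by (rule extend_I_strict_mono_surj[OF f])+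
  have pl: "piecewise_linear 0 1 f" using f by (simp add: thompson_F_def)
  have pow: "\<And>x d. x \<in> {0..1} \<Longrightarrow> (f has_real_derivative d) (at x within {0..1}) \<Longrightarrow> \<exists>k::int. d = 2 powi k"
    using f by (simp add: thompson_F_def)
  \<comment> \<open>The slope of a linear piece is the derivative at any inner point of it.\<close>
  have slope: "\<exists>k::int. m = 2 powi k" if uv: "0 \<le> u" "u < v" "v \<le> 1" "\<forall>t\<in>{u..v}. f t = m * t + c" for u v m c
  proof -
    obtain y where y: "u < y" "y < v" using dense[OF uv(2)] by blast
    have "((\<lambda>t. m * t + c) has_real_derivative m) (at y)" by (auto intro!: derivative_eq_intros)
    then have "(f has_real_derivative m) (at y)"
      by (rule has_field_derivative_transform_within_open[of _ _ _ "{u<..<v}"])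
        (use y uv in auto)
    then have "(f has_real_derivative m) (at y within {0..1})" by (rule has_field_derivative_at_within)
    then show ?thesis using pow[of y m] y uv by auto
  qed
  fix x
  show "\<exists>k c. \<forall>\<^sub>F y in at_right x. ?F y = 2 powi k * y + c"
  proof (cases "0 \<le> x \<and> x < 1")
    case True
    then obtain m c v where v: "x < v" "v \<le> 1" "\<forall>t\<in>{x..v}. f t = m * t + c" using piecewise_linear_right[OF pl] by blast
    then obtain k where "m = 2 powi k" using slope[of x v m c] True by blast
    then show ?thesis unfolding eventually_at_right_field using v True
      by (intro exI[of _ k] exI[of _ c] exI[of _ v]) (auto simp: extend_I_def)
  next
    case False
    then have "\<forall>\<^sub>F y in at_right x. ?F y = 2 powi 0 * y + 0"
      unfolding eventually_at_right_field
      by (intro exI[of _ "if x < 0 then 0 else x + 1"]) (auto simp: extend_I_def)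
    then show ?thesis by blast
  qed
  show "\<exists>k c. \<forall>\<^sub>F y in at_left x. ?F y = 2 powi k * y + c"
  proof (cases "0 < x \<and> x \<le> 1")
    case True
    then obtain m c v where v: "v < x" "0 \<le> v" "\<forall>t\<in>{v..x}. f t = m * t + c" using piecewise_linear_left[OF pl, of x] by blast
    then obtain k where "m = 2 powi k" using slope[of v x m c] True by blast
    then show ?thesis unfolding eventually_at_left_field using v True
      by (intro exI[of _ k] exI[of _ c] exI[of _ v]) (auto simp: extend_I_def)
  next
    case False
    then have "\<forall>\<^sub>F y in at_left x. ?F y = 2 powi 0 * y + 0"
      unfolding eventually_at_left_field
      by (intro exI[of _ "if x \<le> 0 then x - 1 else 1"]) (auto simp: extend_I_def)
    then show ?thesis by blast
  qed
  show "\<exists>d. (?F has_real_derivative d) (at x)" if x: "x \<notin> dyad"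
  proof (cases "x \<in> {0..1}")
    case True
    moreover have "x \<noteq> 0" "x \<noteq> 1" using x by auto
    ultimately have x01: "0 < x" "x < 1" by auto
    obtain S where "S \<subseteq> dyadics" "\<forall>x\<in>{0..1} - S. \<exists>d. (f has_real_derivative d) (at x within {0..1})"
      using f unfolding thompson_F_def by blast
    then obtain d where "(f has_real_derivative d) (at x within {0..1})"
      using x True dyadics_dyad by blast
    then have "(f has_real_derivative d) (at x)" using x01 by (simp add: at_within_Icc_at)
    then have "(?F has_real_derivative d) (at x)"
      by (rule has_field_derivative_transform_within_open[of _ _ _ "{0<..<1}"])
        (use x01 in \<open>auto simp: extend_I_def\<close>)
    then show ?thesis by blast
  next
    case False
    have "((\<lambda>y. y) has_real_derivative 1) (at x)" by (auto intro!: derivative_eq_intros)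
    then have "(?F has_real_derivative 1) (at x)"
      by (rule has_field_derivative_transform_within_open[of _ _ _ "- {0..1}"])
        (use False in \<open>auto simp: extend_I_def\<close>)
    then show ?thesis by blast
  qed
  show "0 \<in> dyad" "?F 0 \<in> dyad" using thompson_F_endpoints[OF f] by (simp_all add: extend_I_def)
qed

lemma extend_I_PL_on:
  assumes "f \<in> thompson_F_on r s" "{r..s} \<subseteq> {0..1}" shows "extend_I f \<in> dyad_PL_on r s"
  using assms extend_I_dyad_PL[of f] by (auto simp: thompson_F_on_def dyad_PL_on_def supp_I_def extend_I_def)

lemma restrict_thompson_F:
  assumes f: "f \<in> dyad_PL_on 0 1" shows "restrict f {0..1} \<in> thompson_F"
proof -
  have PL: "f \<in> dyad_PL" using f by (simp add: dyad_PL_on_def)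
  note m = dyad_PL_strict_mono[OF PL] dyad_PL_surj[OF PL]
  note i = inv_strict_mono_surj[OF m]
  \<comment> \<open>A point leaving \<open>[0,1]\<close> would land on a fixed point, against
    injectivity.\<close>
  have pres: "h x \<in> {0..1}" if h: "h \<in> dyad_PL_on 0 1" and x: "x \<in> {0..1}" for h x
  proof (rule ccontr)
    assume n: "h x \<notin> {0..1}"
    then have "h (h x) = h x" using h by (simp add: dyad_PL_on_def)
    moreover have "inj h" using h by (auto simp: dyad_PL_on_def dyad_PL_strict_mono strict_mono_imp_inj_on)
    ultimately have "h x = x" by (meson injD)
    then show False using n x by simp
  qed
  have "inv_into UNIV f \<in> dyad_PL_on 0 1" by (rule subgroup_Homeo_inv[OF subgroup_dyad_PL_on f])
  note p = pres[OF f] pres[OF this]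
  let ?f = "restrict f {0..1}"
  have "homeomorphic_maps (top_of_set {0..1}) (top_of_set {0..1}) f (inv_into UNIV f)"
    using p i strict_mono_surj_continuous[OF m] strict_mono_surj_continuous[OF i(1,2)]
    by (auto simp: homeomorphic_maps_def intro: continuous_on_subset)
  then have "homeomorphic_map (top_of_set {0..1}) (top_of_set {0..1}) f" by (auto simp: homeomorphic_map_maps)
  from homeo_group_restrict[OF this] have "?f \<in> carrier Homeo_I" by simp
  moreover have "strict_mono_on {0..1} ?f" using m(1) by (auto simp: strict_mono_on_def strict_mono_def)
  moreover have "piecewise_linear 0 1 ?f" by (rule piecewise_linear_dyad_PL[OF PL]) simp
  moreover have "\<exists>S. finite S \<and> S \<subseteq> dyadics \<and>
        (\<forall>x\<in>{0..1} - S. \<exists>d. (?f has_real_derivative d) (at x within {0..1}))"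
  proof (intro exI[of _ "{0..1} \<inter> breaks f"] conjI ballI)
    show "finite ({0..1} \<inter> breaks f)" by (rule finite_breaks[OF PL])
    show "{0..1} \<inter> breaks f \<subseteq> dyadics" using breaks_subset_dyad[OF PL] dyad_nonneg by auto
    fix x assume x: "x \<in> {0..1} - {0..1} \<inter> breaks f"
    then obtain d where "(f has_real_derivative d) (at x)" using dyad_PL_differentiable[OF PL] by blast
    then have "(f has_real_derivative d) (at x within {0..1})" by (rule has_field_derivative_at_within)
    then have "(?f has_real_derivative d) (at x within {0..1})"
      by (rule has_field_derivative_transform_within[of _ _ _ _ 1]) (use x in auto)
    then show "\<exists>d. (?f has_real_derivative d) (at x within {0..1})" by blast
  qed
  moreover have "\<exists>k::int. d = 2 powi k"
    if x: "x \<in> {0..1}" and d': "(?f has_real_derivative d) (at x within {0..1})" for x d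
  proof -
    have d: "(f has_real_derivative d) (at x within {0..1})"
      by (rule has_field_derivative_transform_within[OF d', of 1]) (use x in auto)
    show ?thesis
    \<comment> \<open>The derivative within \<open>[0,1]\<close> restricts to a right derivative at
      points below 1, and to a left derivative at 1.\<close>
    proof (cases "x < 1")
      case True
      have "(f has_real_derivative d) (at x within {x..1})" using d x by (auto intro: has_field_derivative_subset)
      then have "(f has_real_derivative d) (at_right x)" using True by (simp add: at_within_Icc_at_right)
      then show ?thesis by (rule dyad_PL_DERIV_right[OF PL])
    next
      case False
      then have "x = 1" using x by simp
      then have "(f has_real_derivative d) (at_left x)" using d by (simp add: at_within_Icc_at_left)
      then show ?thesis by (rule dyad_PL_DERIV_left[OF PL])
    qed
  qed
  ultimately show ?thesis unfolding thompson_F_def by blast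
qed

text \<open>On maps supported in \<open>[r, s]\<close>, \<open>extend_I\<close> is a group
  isomorphism whose inverse is restriction to \<open>[0,1]\<close>, so generators remain generators
  on the line.\<close>

lemma generate_extend_I:
  assumes gen: "generate Homeo_I {u, v} = thompson_F_on r s" and rs: "{r..s} \<subseteq> {0..1}"
  shows "generate Homeo_plus_R {extend_I u, extend_I v} = dyad_PL_on r s"
proof
  have uv: "u \<in> thompson_F_on r s" "v \<in> thompson_F_on r s" unfolding gen[symmetric] by (auto intro: generate.incl)
  then have e: "extend_I u \<in> dyad_PL_on r s" "extend_I v \<in> dyad_PL_on r s" using extend_I_PL_on rs by blast+
  show "generate Homeo_plus_R {extend_I u, extend_I v} \<subseteq> dyad_PL_on r s"
    by (rule Homeo.generate_subgroup_incl[OF _ subgroup_dyad_PL_on]) (use e in auto)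
  have uvC: "u \<in> carrier Homeo_I" "v \<in> carrier Homeo_I" using uv by (auto simp: thompson_F_on_def thompson_F_def)
  let ?E = "generate Homeo_plus_R {extend_I u, extend_I v}"
  have claim: "extend_I g \<in> ?E \<and> g \<in> carrier Homeo_I" if "g \<in> generate Homeo_I {u, v}" for g
    using that
  proof (induction rule: generate.induct)
    case one
    show ?case using generate.one[of Homeo_plus_R "{extend_I u, extend_I v}"] HI.one_closed
      unfolding one_Homeo_plus_R extend_I_one by blast
  next
    case (incl h)
    then show ?case using uvC by (auto intro: generate.incl)
  next
    case (inv h)
    then have h: "h \<in> carrier Homeo_I" "extend_I h \<in> {extend_I u, extend_I v}" using uvC by auto
    then have eC: "extend_I h \<in> carrier Homeo_plus_R"
      using e subgroup.mem_carrier[OF subgroup_dyad_PL_on[of r s], of "extend_I h"] by auto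
    have "extend_I (inv\<^bsub>Homeo_I\<^esub> h) \<circ> extend_I h = id"
      unfolding extend_I_mult[OF h(1), symmetric] HI.r_inv[OF h(1)] by (rule extend_I_one)
    then have "extend_I (inv\<^bsub>Homeo_I\<^esub> h) y = inv_into UNIV (extend_I h) y" for y
      using eC inv_strict_mono_surj(3)[of "extend_I h" y] unfolding carrier_Homeo_plus_R
      unfolding fun_eq_iff comp_apply id_apply by metis
    then have "extend_I (inv\<^bsub>Homeo_I\<^esub> h) = inv\<^bsub>Homeo_plus_R\<^esub> (extend_I h)"
      using eC by (auto simp: inv_Homeo_plus_R)
    then show ?case using h(1) generate.inv[OF h(2), of Homeo_plus_R] by simp
  next
    case (eng g h)
    then have C: "g \<in> carrier Homeo_I" "h \<in> carrier Homeo_I" and "extend_I g \<in> ?E" "extend_I h \<in> ?E" by blast+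
    then have "extend_I h \<circ> extend_I g \<in> ?E" using generate.eng[of "extend_I g" Homeo_plus_R _ "extend_I h"] by simp
    then show ?case unfolding extend_I_mult[OF C(1)] using C HI.m_closed by blast
  qed
  show "dyad_PL_on r s \<subseteq> ?E"
  proof
    fix f assume f: "f \<in> dyad_PL_on r s"
    then have "f \<in> dyad_PL_on 0 1" using rs by (auto simp: dyad_PL_on_def)
    then have "restrict f {0..1} \<in> thompson_F_on r s"
      using restrict_thompson_F f by (auto simp: thompson_F_on_def supp_I_def dyad_PL_on_def)
    then have "extend_I (restrict f {0..1}) \<in> ?E" using claim gen by blast
    moreover have "extend_I (restrict f {0..1}) = f"
      using f rs by (force simp: extend_I_def dyad_PL_on_def fun_eq_iff)
    ultimately show "f \<in> ?E" by simp
  qed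
qed

section \<open>Homeomorphisms preserving a decomposition into blocks\<close>

text \<open>On the block with index \<open>i\<close>, in a coordinate centred at its midpoint, \<open>blocks w p V f\<close> acts as
  \<open>f\<close>, as the conjugate of \<open>f\<close> by \<open>t \<mapsto> - t\<close>, or trivially, according to \<open>V i\<close>.\<close>

definition twist :: "int \<Rightarrow> (real \<Rightarrow> real) \<Rightarrow> real \<Rightarrow> real" where
  "twist e f t = (if e = 1 then f t else if e = - 1 then - f (- t) else t)"

text \<open>\<open>w\<close> is the half-width: block \<open>i\<close> runs from
  \<open>p + 2 * i * w\<close> to \<open>p + 2 * (i + 1) * w\<close>.\<close>

definition center :: "real \<Rightarrow> real \<Rightarrow> int \<Rightarrow> real" where
  "center w p i = p + (2 * of_int i + 1) * w"

definition blocks :: "real \<Rightarrow> real \<Rightarrow> (int \<Rightarrow> int) \<Rightarrow> (real \<Rightarrow> real) \<Rightarrow> real \<Rightarrow> real" where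
  "blocks w p V f x = (let i = \<lfloor>(x - p) / (2 * w)\<rfloor> in
     center w p i + twist (V i) f (x - center w p i))"

lemma dyad_PL_on_range:
  assumes "f \<in> dyad_PL_on a b" "a \<le> t" "t \<le> b" shows "a \<le> f t" "f t \<le> b"
proof -
  have m: "strict_mono f" using assms by (auto simp: dyad_PL_on_def dyad_PL_strict_mono)
  have "f a \<le> f t" "f t \<le> f b" using assms by (simp_all add: strict_mono_less_eq[OF m])
  then show "a \<le> f t" "f t \<le> b" using dyad_PL_on_endpoints[OF assms(1)] by simp_all
qed

lemma twist_PL_on:
  assumes "f \<in> dyad_PL_on (- w) w" shows "twist e f \<in> dyad_PL_on (- w) w"
proof -
  have f: "f \<in> dyad_PL" "\<And>x. x \<notin> {- w..w} \<Longrightarrow> f x = x" using assms by (auto simp: dyad_PL_on_def)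
  consider "e = 1" | "e = - 1" | "e \<noteq> 1" "e \<noteq> - 1" by blast
  then show ?thesis
  proof cases
    case 1
    then have "twist e f = f" by (simp add: twist_def fun_eq_iff)
    then show ?thesis using assms by simp
  next
    case 2
    then have e: "twist e f = (\<lambda>t. - f (- t))" by (simp add: twist_def fun_eq_iff)
    have "- f (- x) = x" if "x \<notin> {- w..w}" for x using f(2)[of "- x"] that by auto
    then show ?thesis using dyad_PL_reflect[OF f(1)] unfolding e dyad_PL_on_def by blast
  next
    case 3
    then have "twist e f = (\<lambda>t. t)" by (simp add: twist_def fun_eq_iff)
    then show ?thesis using dyad_PL_id by (simp add: dyad_PL_on_def)
  qed
qed

lemma twist_range:
  assumes "f \<in> dyad_PL_on (- w) w" "- w \<le> t" "t \<le> w" shows "- w \<le> twist e f t" "twist e f t \<le> w"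
  using dyad_PL_on_range[OF twist_PL_on[OF assms(1)] assms(2,3)] by auto

lemma twist_comp: "twist e (f \<circ> g) t = twist e f (twist e g t)"
  by (simp add: twist_def)

lemma twist_id: "twist e id t = t"
  by (simp add: twist_def)

lemma twist_minus: "twist (- e) f t = twist e (twist (- 1) f) t"
  by (auto simp: twist_def)

lemma floor_block:
  assumes "0 < w" "- w \<le> t" "t < w" shows "\<lfloor>(center w p i + t - p) / (2 * w)\<rfloor> = i"
proof -
  have e: "(center w p i + t - p) / (2 * w) = of_int i + (w + t) / (2 * w)"
    using assms by (simp add: center_def field_simps)
  have "0 \<le> (w + t) / (2 * w)" "(w + t) / (2 * w) < 1" using assms by (simp_all add: field_simps)
  then show ?thesis unfolding e by (simp add: floor_eq_iff)
qed

lemma block_cases: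
  assumes "0 < w" obtains i t where "x = center w p i + t" "- w \<le> t" "t < w"
proof -
  let ?i = "\<lfloor>(x - p) / (2 * w)\<rfloor>"
  have "of_int ?i \<le> (x - p) / (2 * w)" "(x - p) / (2 * w) < of_int ?i + 1" by linarith+
  then have "of_int ?i * (2 * w) \<le> x - p" "x - p < (of_int ?i + 1) * (2 * w)"
    using assms by (simp_all only: pos_le_divide_eq pos_divide_less_eq mult_pos_pos zero_less_numeral)
  then have "- w \<le> x - center w p ?i" "x - center w p ?i < w"
    by (simp_all add: center_def algebra_simps)
  then show ?thesis using that[of ?i "x - center w p ?i"] by simp
qed

lemma center_Suc: "center w p (i + 1) - w = center w p i + w"
  by (simp add: center_def algebra_simps)

text \<open>The floor in \<open>blocks\<close> assigns the right end of a block to the next block.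
  The formula still holds for \<open>t = w\<close> because all twists fix \<open>- w\<close> and
  \<open>w\<close>.\<close>

lemma blocks_eq:
  assumes "0 < w" "f \<in> dyad_PL_on (- w) w" "- w \<le> t" "t \<le> w"
  shows "blocks w p V f (center w p i + t) = center w p i + twist (V i) f t"
proof (cases "t = w")
  case False
  then show ?thesis using floor_block[of w t p i] assms by (simp add: blocks_def Let_def)
next
  case True
  note ends = dyad_PL_on_endpoints[OF twist_PL_on[OF assms(2)]]
  have "blocks w p V f (center w p (i + 1) + - w) = center w p (i + 1) + twist (V (i + 1)) f (- w)"
    using floor_block[of w "- w" p "i + 1"] assms by (simp add: blocks_def Let_def)
  then show ?thesis using True ends center_Suc[of w p i] by simp
qed

lemma blocks_comp:
  assumes "0 < w" "f \<in> dyad_PL_on (- w) w" "g \<in> dyad_PL_on (- w) w"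
  shows "blocks w p V (f \<circ> g) = blocks w p V f \<circ> blocks w p V g"
proof
  fix x
  obtain i t where x: "x = center w p i + t" "- w \<le> t" "t < w" by (rule block_cases[OF assms(1)])
  have "f \<circ> g \<in> dyad_PL_on (- w) w" using assms by (intro subgroup_Homeo_comp[OF subgroup_dyad_PL_on])
  then show "blocks w p V (f \<circ> g) x = (blocks w p V f \<circ> blocks w p V g) x"
    using assms x twist_range[OF assms(3), of t "V i"] by (simp add: blocks_eq twist_comp)
qed

lemma blocks_id: "0 < w \<Longrightarrow> blocks w p V id = id"
  by (rule ext) (simp add: blocks_def Let_def twist_id)

lemma blocks_strict_mono_surj:
  assumes w: "0 < w" and f: "f \<in> dyad_PL_on (- w) w"
  shows "strict_mono (blocks w p V f)" "surj (blocks w p V f)"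
proof -
  have m: "strict_mono (twist e f)" for e using twist_PL_on[OF f] by (simp add: dyad_PL_on_def dyad_PL_strict_mono)
  show "strict_mono (blocks w p V f)"
  proof (rule strict_monoI)
    fix x y :: real assume xy: "x < y"
    obtain i t where x: "x = center w p i + t" "- w \<le> t" "t < w" by (rule block_cases[OF w])
    obtain j u where y: "y = center w p j + u" "- w \<le> u" "u < w" by (rule block_cases[OF w])
    have fx: "blocks w p V f x = center w p i + twist (V i) f t" using w f x by (simp add: blocks_eq)
    have fy: "blocks w p V f y = center w p j + twist (V j) f u" using w f y by (simp add: blocks_eq)
    show "blocks w p V f x < blocks w p V f y"
    proof (cases "i = j")
      case True
      then show ?thesis using fx fy xy x y m[of "V i"] by (simp add: strict_mono_less)
    next
      case False
      have "i < j"
      proof (rule ccontr)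
        assume "\<not> i < j"
        then have "(2 * of_int j + 2) * w \<le> (2 * of_int i) * w" using False w by (intro mult_right_mono) linarith+
        then show False using xy x y by (simp add: center_def algebra_simps)
      qed
      then have "(2 * of_int i + 2) * w \<le> (2 * of_int j) * w" using w by (intro mult_right_mono) linarith+
      then have "center w p i + w \<le> center w p j - w" by (simp add: center_def algebra_simps)
      moreover have "twist (V i) f t < w"
        using strict_monoD[OF m x(3), of "V i"] dyad_PL_on_endpoints(2)[OF twist_PL_on[OF f, of "V i"]] by simp
      moreover have "- w \<le> twist (V j) f u" using twist_range[OF f, of u "V j"] y by simp
      ultimately show ?thesis using fx fy by simp
    qed
  qed
  have i: "inv_into UNIV f \<in> dyad_PL_on (- w) w" by (rule subgroup_Homeo_inv[OF subgroup_dyad_PL_on f])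
  have "strict_mono f" "surj f" using f by (auto simp: dyad_PL_on_def dyad_PL_strict_mono dyad_PL_surj)
  then have "f \<circ> inv_into UNIV f = id" by (simp add: fun_eq_iff inv_strict_mono_surj)
  then have "blocks w p V f \<circ> blocks w p V (inv_into UNIV f) = id"
    using blocks_comp[OF w f i] blocks_id[OF w] by metis
  then show "surj (blocks w p V f)" by (metis surj_iff comp_surj surj_id surjI comp_apply id_apply)
qed

lemma blocks_inv:
  assumes w: "0 < w" and f: "f \<in> dyad_PL_on (- w) w"
  shows "inv_into UNIV (blocks w p V f) = blocks w p V (inv_into UNIV f)"
proof
  fix x
  have i: "inv_into UNIV f \<in> dyad_PL_on (- w) w" by (rule subgroup_Homeo_inv[OF subgroup_dyad_PL_on f])
  have "strict_mono f" "surj f" using f by (auto simp: dyad_PL_on_def dyad_PL_strict_mono dyad_PL_surj)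
  then have "f \<circ> inv_into UNIV f = id" by (simp add: fun_eq_iff inv_strict_mono_surj)
  then have "blocks w p V f \<circ> blocks w p V (inv_into UNIV f) = id"
    using blocks_comp[OF w f i] blocks_id[OF w] by metis
  then have "blocks w p V f (blocks w p V (inv_into UNIV f) x) = x" by (simp add: fun_eq_iff)
  then show "inv_into UNIV (blocks w p V f) x = blocks w p V (inv_into UNIV f) x"
    using inv_strict_mono_surj(4)[OF blocks_strict_mono_surj[OF w f]] by metis
qed

text \<open>Inside a block the model is a translate of a twist of \<open>f\<close>. At the boundary
  of two blocks there are two models, which is allowed because boundaries are dyadic.\<close>

lemma blocks_dyad_PL:
  assumes w: "0 < w" "w \<in> dyad" "p \<in> dyad" and f: "f \<in> dyad_PL_on (- w) w"
  shows "blocks w p V f \<in> dyad_PL"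
proof (rule dyad_PL_local)
  show "strict_mono (blocks w p V f)" "surj (blocks w p V f)" by (rule blocks_strict_mono_surj[OF w(1) f])+
  fix x
  define g where "g i = (\<lambda>x. x + center w p i) \<circ> (twist (V i) f \<circ> (\<lambda>x. x + - center w p i))" for i
  have c: "center w p i \<in> dyad" for i
    unfolding center_def using w by (intro dyad_add dyad_mult) auto
  have g: "g i \<in> dyad_PL" for i
    unfolding g_def using twist_PL_on[OF f] c
    by (intro dyad_PL_comp dyad_PL_translation dyad_uminus) (auto simp: dyad_PL_on_def)
  have eq: "blocks w p V f y = g i y" if "center w p i - w \<le> y" "y \<le> center w p i + w" for y i
    using blocks_eq[OF w(1) f, of "y - center w p i" p V i] that by (simp add: g_def)
  obtain i t where x: "x = center w p i + t" "- w \<le> t" "t < w" by (rule block_cases[OF w(1)])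
  have r: "\<forall>\<^sub>F y in at_right x. blocks w p V f y = g i y"
    unfolding eventually_at_right_field using x eq[of i] by (intro exI[of _ "center w p i + w"]) auto
  show "\<exists>g\<in>dyad_PL. \<exists>h\<in>dyad_PL. (\<forall>\<^sub>F y in at_left x. blocks w p V f y = g y) \<and>
      (\<forall>\<^sub>F y in at_right x. blocks w p V f y = h y) \<and> (x \<in> dyad \<or> g = h)"
  proof (cases "t = - w")
    case True
    have e: "center w p (i - 1) + w = x" using x True center_Suc[of w p "i - 1"] by simp
    have "\<forall>\<^sub>F y in at_left x. blocks w p V f y = g (i - 1) y"
      unfolding eventually_at_left_field using e eq[of "i - 1"] w(1)
      by (intro exI[of _ "center w p (i - 1) - w"]) auto
    moreover have "x \<in> dyad" unfolding x True using w c by (intro dyad_add dyad_uminus)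
    ultimately show ?thesis using g r by blast
  next
    case False
    have "\<forall>\<^sub>F y in at_left x. blocks w p V f y = g i y"
      unfolding eventually_at_left_field using x False eq[of i] by (intro exI[of _ "center w p i - w"]) auto
    then show ?thesis using g r by blast
  qed
qed

lemma blocks_periodic:
  assumes w: "0 < w" and f: "f \<in> dyad_PL_on (- w) w" and V: "\<And>i. V (i + k) = V i"
  shows "blocks w p V f (x + 2 * w * of_int k) = blocks w p V f x + 2 * w * of_int k"
proof -
  obtain i t where x: "x = center w p i + t" "- w \<le> t" "t < w" by (rule block_cases[OF w])
  have e: "x + 2 * w * of_int k = center w p (i + k) + t" unfolding x center_def by (simp add: algebra_simps)
  have "center w p (i + k) = center w p i + 2 * w * of_int k" unfolding center_def by (simp add: algebra_simps)
  moreover have "blocks w p V f (center w p (i + k) + t) = center w p (i + k) + twist (V (i + k)) f t"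
    "blocks w p V f x = center w p i + twist (V i) f t"
    unfolding x(1) using x w f by (intro blocks_eq; simp)+
  ultimately show ?thesis unfolding e by (simp add: V)
qed

lemma twist_PL_c: assumes "f \<in> dyad_PL_c (- w) w" "e \<in> {1, - 1}" shows "twist e f \<in> dyad_PL_c (- w) w"
proof (cases "e = 1")
  case True
  then have "twist e f = f" by (simp add: twist_def fun_eq_iff)
  then show ?thesis using assms by simp
next
  case False
  then have e: "twist e f = (\<lambda>t. - f (- t))" using assms by (auto simp: twist_def fun_eq_iff)
  obtain r s where f: "f \<in> dyad_PL" and rs: "r \<in> dyad" "s \<in> dyad" "- w < r" "r < s" "s < w" "\<And>x. x \<le> r \<or> s \<le> x \<Longrightarrow> f x = x"
    using assms(1) by (rule dyad_PL_cE) blast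
  have "- f (- x) = x" if "x < - s \<or> - r < x" for x using rs(6)[of "- x"] that by auto
  then show ?thesis unfolding e using rs dyad_PL_reflect[OF f]
    by (intro dyad_PL_cI[of _ "- w" "- s" "- r" w]) auto
qed

section \<open>Isolating a single block modulo the period\<close>

definition periodic_PL :: "nat \<Rightarrow> (real \<Rightarrow> real) set" where
  "periodic_PL n = {g \<in> dyad_PL. \<forall>x. g (x + real n) = g x + real n}"

lemma periodic_PL_dyad_PL: "g \<in> periodic_PL n \<Longrightarrow> g \<in> dyad_PL"
  by (simp add: periodic_PL_def)

lemma periodic_PL_shift:
  assumes "g \<in> periodic_PL n" shows "g (x + real n * of_int k) = g x + real n * of_int k"
proof (induction k rule: int_induct[where k = 0])
  case base
  then show ?case by simp
next
  case (step1 i)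
  have "g (x + real n * of_int i + real n) = g (x + real n * of_int i) + real n"
    using assms by (simp add: periodic_PL_def)
  then show ?case using step1 by (simp add: algebra_simps)
next
  case (step2 i)
  have "g (x + real n * of_int (i - 1) + real n) = g (x + real n * of_int (i - 1)) + real n"
    using assms by (simp add: periodic_PL_def)
  then show ?case using step2 by (simp add: algebra_simps)
qed

lemma subgroup_periodic_PL: "subgroup (periodic_PL n) Homeo_plus_R"
proof (rule subgroup_HomeoI)
  fix f assume f: "f \<in> periodic_PL n"
  then have m: "strict_mono f" "surj f" by (simp_all add: periodic_PL_def dyad_PL_strict_mono dyad_PL_surj)
  then show "strict_mono f \<and> surj f" by simp
  have "inv_into UNIV f (x + real n) = inv_into UNIV f x + real n" for x
  proof -
    have "f (inv_into UNIV f x + real n) = x + real n" using f m by (simp add: periodic_PL_def inv_strict_mono_surj)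
    then show ?thesis using inv_strict_mono_surj(4)[OF m] by metis
  qed
  then show "inv_into UNIV f \<in> periodic_PL n" using f by (simp add: periodic_PL_def dyad_PL_inv)
qed (auto simp: periodic_PL_def dyad_PL_id dyad_PL_comp)

text \<open>Labels are read off at \<open>m / 2\<close> for integers \<open>m\<close>; the unit interval centred at \<open>m / 2\<close>
  carries the label \<open>s m\<close>.\<close>

definition unit_map :: "int \<Rightarrow> (int \<Rightarrow> int) \<Rightarrow> (real \<Rightarrow> real) \<Rightarrow> real \<Rightarrow> real" where
  "unit_map c V = blocks (1/2) ((of_int c - 1) / 2) (\<lambda>i. V (2 * i + c))"

text \<open>The blocks are \<open>[i/2, (i+1)/2]\<close>, the overlaps of the unit intervals centred
  at \<open>i / 2\<close> and \<open>(i + 1) / 2\<close>.\<close>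

definition half_map :: "(int \<Rightarrow> int) \<Rightarrow> (real \<Rightarrow> real) \<Rightarrow> real \<Rightarrow> real" where
  "half_map = blocks (1/4) 0"

lemma int_periodic:
  fixes f :: "int \<Rightarrow> 'a" assumes "\<And>i. f (i + p) = f i" shows "f (i + p * k) = f i"
proof (induction k rule: int_induct[where k = 0])
  case (step1 k) then show ?case using assms[of "i + p * k"] by (simp add: algebra_simps)
next
  case (step2 k) then show ?case using assms[of "i + p * (k - 1)"] by (simp add: algebra_simps)
qed simp

lemma dyad_PL_c_mono:
  assumes "a' \<le> a" "b \<le> b'" shows "dyad_PL_c a b \<subseteq> dyad_PL_c a' b'"
proof
  fix f assume "f \<in> dyad_PL_c a b"
  then obtain r s where "f \<in> dyad_PL" "a < r" "r \<le> s" "s < b" "\<And>x. x \<notin> {r..s} \<Longrightarrow> f x = x"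
    unfolding dyad_PL_c_def by blast
  then show "f \<in> dyad_PL_c a' b'" using assms by (intro dyad_PL_cI[of f a' r s b']) auto
qed

lemma unit_map_eq:
  assumes "h \<in> dyad_PL_on (- (1/2)) (1/2)" "- (1/2) \<le> t" "t \<le> 1/2" "even (m - c)"
  shows "unit_map c V h (of_int m / 2 + t) = of_int m / 2 + twist (V m) h t"
proof -
  define i where "i = (m - c) div 2"
  have m: "m = 2 * i + c" using assms(4) by (simp add: i_def)
  have "center (1/2) ((of_int c - 1) / 2) i = of_int m / 2" unfolding center_def m by (simp add: field_simps)
  then show ?thesis unfolding unit_map_def
    using blocks_eq[of "1/2" h t "(of_int c - 1) / 2" "\<lambda>i. V (2 * i + c)" i] assms(1-3)
    by (simp only: flip: m)
qed

text \<open>What the generators contribute. Positions are doubled, so a translation by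
  \<open>q\<close> is a shift of labels by \<open>2 * q\<close>, and only even shifts respect the
  two kinds of letters. \<open>unit_map_K\<close> covers both families of generators, according to
  the parity of \<open>c\<close>. \<open>perfect\<close> is perfectness in the form in which it is
  used: a subgroup containing all commutators contains everything.\<close>

locale labelled_line =
  fixes n :: nat and s :: "int \<Rightarrow> int" and K :: "(real \<Rightarrow> real) set"
  assumes n_pos: "n > 0"
    and s_sign: "s i \<in> {1, - 1}"
    and s_period: "s (i + 2 * int n) = s i"
    and s_minimal: "(\<And>i. s (i + 2 * q) = s i) \<Longrightarrow> int n dvd q"
    and K_subgroup: "subgroup K Homeo_plus_R"
    and K_periodic: "K \<subseteq> periodic_PL n"
    and unit_map_K: "h \<in> dyad_PL_c (- (1/2)) (1/2) \<Longrightarrow> unit_map c s h \<in> K"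
    and perfect: "subgroup L Homeo_plus_R \<Longrightarrow>
      (\<And>g h. g \<in> dyad_PL_c a b \<Longrightarrow> h \<in> dyad_PL_c a b \<Longrightarrow>
        g \<circ> h \<circ> inv_into UNIV g \<circ> inv_into UNIV h \<in> L) \<Longrightarrow> dyad_PL_c a b \<subseteq> L"
begin

section \<open>Patterns of half-intervals realized in \<open>K\<close>\<close>

lemma s_period': "s (i + 2 * int n * k) = s i"
  by (rule int_periodic) (rule s_period)

lemma half_map_eq:
  assumes "h \<in> dyad_PL_on (- (1/4)) (1/4)" "- (1/4) \<le> t" "t \<le> 1/4"
  shows "half_map S h ((2 * of_int i + 1) / 4 + t) = (2 * of_int i + 1) / 4 + twist (S i) h t"
  using blocks_eq[of "1/4" h t 0 S i] assms by (simp add: half_map_def center_def)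

lemma half_cases: obtains i t where "x = (2 * of_int i + 1) / 4 + t" "- (1/4) \<le> t" "t \<le> 1/(4::real)"
  using block_cases[of "1/4" x 0] by (metis center_def add_0 less_imp_le mult.commute times_divide_eq_right mult_1 zero_less_divide_1_iff zero_less_numeral)

definition pattern :: "(int \<Rightarrow> int) \<Rightarrow> bool" where
  "pattern S \<longleftrightarrow> (\<forall>i. S i \<in> {- 1, 0, 1} \<and> S (i + 2 * int n) = S i)"

text \<open>A pattern prescribes on each half-interval a map, its mirror image or nothing; it is
  available if \<open>K\<close> realizes it for every compactly supported \<open>f\<close>. The aim
  is the pattern supported on a single class modulo \<open>2 * n\<close>.\<close>

definition available :: "(int \<Rightarrow> int) set" where
  "available = {S. pattern S \<and> (\<forall>f\<in>dyad_PL_c (- (1/4)) (1/4). half_map S f \<in> K)}"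

lemma availableD:
  assumes "S \<in> available"
  shows "S i \<in> {- 1, 0, 1}" "S (i + 2 * int n) = S i" "f \<in> dyad_PL_c (- (1/4)) (1/4) \<Longrightarrow> half_map S f \<in> K"
  using assms by (auto simp: available_def pattern_def)

text \<open>Reflecting \<open>f\<close> beforehand exchanges a map and its mirror image on all
  half-intervals at once.\<close>

lemma uminus_available: assumes "S \<in> available" shows "(\<lambda>i. - S i) \<in> available"
proof -
  have "half_map (\<lambda>i. - S i) f = half_map S (twist (- 1) f)" for f
    by (rule ext) (simp add: half_map_def blocks_def Let_def twist_minus[of "S _" f])
  then have "half_map (\<lambda>i. - S i) f \<in> K" if "f \<in> dyad_PL_c (- (1/4)) (1/4)" for f
    using availableD(3)[OF assms twist_PL_c[OF that, of "- 1"]] by simp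
  moreover have "pattern (\<lambda>i. - S i)" using availableD(1,2)[OF assms] by (force simp: pattern_def)
  ultimately show ?thesis by (simp add: available_def)
qed

lemma sign_available: "S \<in> available \<Longrightarrow> e \<in> {1, - 1} \<Longrightarrow> (\<lambda>i. e * S i) \<in> available"
  using uminus_available[of S] by auto

definition meet :: "(int \<Rightarrow> int) \<Rightarrow> (int \<Rightarrow> int) \<Rightarrow> int \<Rightarrow> int" where
  "meet S T i = (if S i = T i then S i else 0)"

text \<open>\<open>u\<close> and \<open>v\<close> live on positive coordinates. For different signs
  their twists have disjoint supports, or at least one of them is trivial, so they commute.\<close>

lemma disjoint_commutator:
  assumes u: "u \<in> dyad_PL_c 0 (1/4)" and v: "v \<in> dyad_PL_c 0 (1/4)" and de: "d \<noteq> e"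
  shows "twist d u (twist e v (twist d (inv_into UNIV u) (twist e (inv_into UNIV v) t))) = t"
proof -
  have fx: "g x = x" if "g \<in> dyad_PL_c 0 (1/4)" "x \<le> 0" for g x using that by (auto simp: dyad_PL_c_def)
  have mono: "strict_mono g" "surj g" if "g \<in> dyad_PL_c 0 (1/4)" for g
    using that by (auto simp: dyad_PL_c_def dyad_PL_strict_mono dyad_PL_surj)
  have pos: "g x > 0" if "g \<in> dyad_PL_c 0 (1/4)" "x > 0" for g x
    using fx[OF that(1), of 0] strict_mono_less[OF mono(1)[OF that(1)], of 0 x] that(2) by simp
  have inv: "inv_into UNIV g \<in> dyad_PL_c 0 (1/4)" if "g \<in> dyad_PL_c 0 (1/4)" for g
    using subgroup_Homeo_inv[OF subgroup_dyad_PL_c that] by simp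
  note ii = inv_strict_mono_surj(3)[OF mono[OF u]] inv_strict_mono_surj(3)[OF mono[OF v]]
  note P = pos[OF u] pos[OF v] pos[OF inv[OF u]] pos[OF inv[OF v]]
  note F = fx[OF u] fx[OF v] fx[OF inv[OF u]] fx[OF inv[OF v]]
  show ?thesis
  proof (cases "t > 0")
    case True
    then show ?thesis using de P[of t] F[of "- t"] ii
      by (simp add: twist_def F less_imp_le P)
  next
    case False
    then have "t = 0 \<or> - t > 0" by auto
    then show ?thesis using de P[of "- t"] F[of t] ii
      by (elim disjE) (simp_all add: twist_def F less_imp_le P)
  qed
qed

text \<open>The commutator of an action with pattern \<open>S\<close> and one with pattern
  \<open>T\<close> is trivial where the patterns differ, and a twisted ordinary commutator where
  they agree. Perfectness extends this to all maps supported on positive coordinates; conjugation by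
  an \<open>S\<close>-action removes that restriction.\<close>

lemma meet_available: assumes S: "S \<in> available" and T: "T \<in> available" shows "meet S T \<in> available"
proof -
  let ?I = "dyad_PL_c (- (1/4)) (1/4)"
  have subI: "subgroup ?I Homeo_plus_R" by (rule subgroup_dyad_PL_c) simp
  have on: "f \<in> dyad_PL_on (- (1/4)) (1/4)" if "f \<in> ?I" for f using that by (rule dyad_PL_c_on)
  have hcomp: "half_map R (f \<circ> g) = half_map R f \<circ> half_map R g" if "f \<in> ?I" "g \<in> ?I" for R f g
    unfolding half_map_def using on[OF that(1)] on[OF that(2)] by (intro blocks_comp) auto
  have hinv: "half_map R (inv_into UNIV f) = inv_into UNIV (half_map R f)" if "f \<in> ?I" for R f
    unfolding half_map_def using on[OF that] by (intro blocks_inv[symmetric]) auto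
  define L where "L = {e \<in> ?I. half_map (meet S T) e \<in> K}"
  have L: "subgroup L Homeo_plus_R"
  proof (rule subgroup_HomeoI)
    show "id \<in> L" using subgroup_Homeo_id[OF subI] subgroup_Homeo_id[OF K_subgroup]
      by (simp add: L_def half_map_def blocks_id)
    fix f assume f: "f \<in> L"
    then show "strict_mono f \<and> surj f" using subgroup_Homeo_carrier[OF subI] by (simp add: L_def)
    show "inv_into UNIV f \<in> L"
      using f subgroup_Homeo_inv[OF subI] subgroup_Homeo_inv[OF K_subgroup] by (simp add: L_def hinv)
    fix g assume "g \<in> L"
    then show "f \<circ> g \<in> L"
      using f subgroup_Homeo_comp[OF subI] subgroup_Homeo_comp[OF K_subgroup] by (simp add: L_def hcomp)
  qed
  have small: "f \<in> ?I" if "f \<in> dyad_PL_c 0 (1/4)" for f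
    using dyad_PL_c_mono[of "- (1/4)" 0 "1/4" "1/4"] that by auto
  have "dyad_PL_c 0 (1/4) \<subseteq> L"
  proof (rule perfect[OF L])
    fix u v assume u: "u \<in> dyad_PL_c 0 (1/4)" and v: "v \<in> dyad_PL_c 0 (1/4)"
    note uv = small[OF u] small[OF v]
    note uvi = subgroup_Homeo_inv[OF subI uv(1)] subgroup_Homeo_inv[OF subI uv(2)]
    let ?c = "u \<circ> v \<circ> inv_into UNIV u \<circ> inv_into UNIV v"
    have cI: "?c \<in> ?I" using uv uvi by (intro subgroup_Homeo_comp[OF subI])
    have "half_map (meet S T) ?c =
      half_map S u \<circ> half_map T v \<circ> half_map S (inv_into UNIV u) \<circ> half_map T (inv_into UNIV v)"
    proof
      fix x
      obtain i t where x: "x = (2 * of_int i + 1) / 4 + t" and t: "- (1/4) \<le> t" "t \<le> 1/(4::real)" by (rule half_cases)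
      note t1 = twist_range[OF on[OF uvi(2)] t, of "T i"]
      note t2 = twist_range[OF on[OF uvi(1)] t1, of "S i"]
      note t3 = twist_range[OF on[OF uv(2)] t2, of "T i"]
      have "(half_map S u \<circ> half_map T v \<circ> half_map S (inv_into UNIV u) \<circ> half_map T (inv_into UNIV v)) x =
        (2 * of_int i + 1) / 4 + twist (S i) u (twist (T i) v (twist (S i) (inv_into UNIV u) (twist (T i) (inv_into UNIV v) t)))"
        unfolding x comp_apply half_map_eq[OF on[OF uvi(2)] t] half_map_eq[OF on[OF uvi(1)] t1]
          half_map_eq[OF on[OF uv(2)] t2] half_map_eq[OF on[OF uv(1)] t3] by simp
      moreover have "half_map (meet S T) ?c x = (2 * of_int i + 1) / 4 + twist (meet S T i) ?c t"
        unfolding x by (rule half_map_eq[OF on[OF cI] t])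
      moreover have "twist (meet S T i) ?c t =
        twist (S i) u (twist (T i) v (twist (S i) (inv_into UNIV u) (twist (T i) (inv_into UNIV v) t)))"
      proof (cases "S i = T i")
        case True
        then show ?thesis by (simp add: meet_def twist_comp)
      next
        case False
        then show ?thesis using disjoint_commutator[OF u v False, of t] by (simp add: meet_def twist_def[of 0])
      qed
      ultimately show "half_map (meet S T) ?c x = (half_map S u \<circ> half_map T v \<circ> half_map S (inv_into UNIV u) \<circ> half_map T (inv_into UNIV v)) x"
        by simp
    qed
    also have "\<dots> \<in> K"
      using availableD(3)[OF S] availableD(3)[OF T] uv uvi by (intro subgroup_Homeo_comp[OF K_subgroup])
    finally show "?c \<in> L" using cI by (simp add: L_def)
  qed
  moreover have "half_map (meet S T) f \<in> K" if f: "f \<in> ?I" and sub: "dyad_PL_c 0 (1/4) \<subseteq> L" for f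
  proof -
    obtain r q where fPL: "f \<in> dyad_PL" and rq: "r \<in> dyad" "q \<in> dyad" "- (1/4) < r" "r < q" "q < 1/4"
      "\<And>x. x \<le> r \<or> q \<le> x \<Longrightarrow> f x = x" using f by (rule dyad_PL_cE) blast
    have "1/8 \<in> dyad" using dyad_half[of "1/4"] by simp
    \<comment> \<open>The support \<open>[r, q]\<close> is to be moved to positive coordinates;
      \<open>1/16\<close> and \<open>1/8\<close> are just two dyadic points of
      \<open>(0, 1/4)\<close>.\<close>
    then obtain g where g: "g \<in> dyad_PL" "g r = 1/16" "g q = 1/8"
      using dyad_PL_interpolate[of r q "1/16" "1/8"] rq by auto
    obtain h where h: "h \<in> ?I" "\<forall>x\<in>{r..q}. h x = g x"
      using dyad_PL_c_extend[OF g(1), of "- (1/4)" r q "1/4"] rq g by auto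
    have hrq: "h r = 1/16" "h q = 1/8" using h g rq by auto
    note hi = subgroup_Homeo_inv[OF subI h(1)]
    note hm = subgroup_Homeo_carrier[OF subI h(1)]
    note him = inv_strict_mono_surj[OF hm]
    let ?f = "h \<circ> f \<circ> inv_into UNIV h"
    have fI: "?f \<in> ?I" using f h hi by (intro subgroup_Homeo_comp[OF subI])
    have "?f \<in> dyad_PL_c 0 (1/4)"
    proof (rule dyad_PL_cI[of _ _ "1/16" "1/8"])
      show "?f \<in> dyad_PL" using fI by (simp add: dyad_PL_c_def)
      fix x :: real assume "x < 1/16 \<or> 1/8 < x"
      then have "inv_into UNIV h x \<le> r \<or> q \<le> inv_into UNIV h x"
        using strict_mono_less_eq[OF hm(1), of "inv_into UNIV h x" r] strict_mono_less_eq[OF hm(1), of q "inv_into UNIV h x"]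
        by (auto simp: him(3) hrq)
      then show "?f x = x" using rq(6) him(3) by simp
    qed auto
    then have fL: "half_map (meet S T) ?f \<in> K" using sub by (auto simp: L_def)
    define F where "F = ?f"
    note fI = fI[folded F_def] and fL = fL[folded F_def]
    \<comment> \<open>Where \<open>meet S T\<close> is nonzero it equals \<open>S\<close>, so the
      conjugation happens in the same orientation; elsewhere the conjugators cancel.\<close>
    have "half_map (meet S T) f = half_map S (inv_into UNIV h) \<circ> half_map (meet S T) F \<circ> half_map S h"
    proof
      fix x
      obtain i t where x: "x = (2 * of_int i + 1) / 4 + t" and t: "- (1/4) \<le> t" "t \<le> 1/(4::real)" by (rule half_cases)
      note t1 = twist_range[OF on[OF h(1)] t, of "S i"]
      note t2 = twist_range[OF on[OF fI] t1, of "meet S T i"]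
      have "(half_map S (inv_into UNIV h) \<circ> half_map (meet S T) F \<circ> half_map S h) x =
        (2 * of_int i + 1) / 4 + twist (S i) (inv_into UNIV h) (twist (meet S T i) F (twist (S i) h t))"
        unfolding x comp_apply half_map_eq[OF on[OF h(1)] t] half_map_eq[OF on[OF fI] t1]
          half_map_eq[OF on[OF hi] t2] by simp
      also have "\<dots> = (2 * of_int i + 1) / 4 + twist (meet S T i) f t"
        by (cases "S i = T i") (auto simp: meet_def twist_def F_def him)
      also have "\<dots> = half_map (meet S T) f x" unfolding x by (rule half_map_eq[OF on[OF f] t, symmetric])
      finally show "half_map (meet S T) f x = (half_map S (inv_into UNIV h) \<circ> half_map (meet S T) F \<circ> half_map S h) x" by simp
    qed
    also have "\<dots> \<in> K"
      using availableD(3)[OF S] h hi fL by (intro subgroup_Homeo_comp[OF K_subgroup])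
    finally show ?thesis .
  qed
  moreover have "pattern (meet S T)"
    using availableD(1,2)[OF S] availableD(1,2)[OF T] by (auto simp: pattern_def meet_def)
  ultimately show ?thesis by (simp add: available_def)
qed

text \<open>The half-interval \<open>[i/2, (i+1)/2]\<close> is one half of the unit interval around \<open>mid c i / 2\<close>,
  where \<open>mid c i\<close> is the one of \<open>i\<close>, \<open>i + 1\<close> congruent to \<open>c\<close>.\<close>

definition mid :: "int \<Rightarrow> int \<Rightarrow> int" where
  "mid c i = (if even (i - c) then i else i + 1)"

text \<open>The value 1 marks the right half of the unit interval, -1 the left half.\<close>

definition side :: "int \<Rightarrow> int \<Rightarrow> int" where
  "side c i = (if even (i - c) then 1 else - 1)"

text \<open>A map on the half of sign \<open>d\<close> is carried by a label \<open>V\<close> to the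
  half of sign \<open>V * d\<close>. For a sign \<open>V\<close> this is half \<open>i\<close>
  exactly if \<open>V * side = d\<close>; a label 0 never satisfies the equation for
  \<open>d = 1\<close> or \<open>d = - 1\<close>.\<close>

definition half_pattern :: "int \<Rightarrow> int \<Rightarrow> (int \<Rightarrow> int) \<Rightarrow> int \<Rightarrow> int" where
  "half_pattern c d V i = (if V (mid c i) * side c i = d then V (mid c i) else 0)"

definition half_shift :: "int \<Rightarrow> (real \<Rightarrow> real) \<Rightarrow> real \<Rightarrow> real" where
  "half_shift d f t = of_int d / 4 + f (t - of_int d / 4)"

lemma mid_even: "even (mid c i - c)"
  by (auto simp: mid_def)

lemma half_shift_PL_c:
  assumes f: "f \<in> dyad_PL_c (- (1/4)) (1/4)" and d: "d \<in> {1, - 1}"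
  shows "half_shift d f \<in> dyad_PL_c (- (1/2)) (1/2)"
proof -
  obtain r q where rq: "f \<in> dyad_PL" "r \<in> dyad" "q \<in> dyad" "- (1/4) < r" "r < q" "q < 1/4"
    "\<And>x. x \<le> r \<or> q \<le> x \<Longrightarrow> f x = x" using f by (rule dyad_PL_cE) blast
  have e: "half_shift d f = (\<lambda>x. x + of_int d / 4) \<circ> (f \<circ> (\<lambda>x. x + - (of_int d / 4)))"
    by (simp add: half_shift_def fun_eq_iff)
  have "of_int d / 4 \<in> dyad" using dyad_half[OF dyad_half_int[of d]] by simp
  then have "half_shift d f \<in> dyad_PL" unfolding e using rq(1)
    by (intro dyad_PL_comp dyad_PL_translation dyad_uminus)
  moreover have "half_shift d f x = x" if "x < r + of_int d / 4 \<or> q + of_int d / 4 < x" for x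
    using rq(7)[of "x - of_int d / 4"] that by (auto simp: half_shift_def)
  ultimately show ?thesis using rq d
    by (intro dyad_PL_cI[of _ _ "r + of_int d / 4" "q + of_int d / 4"]) auto
qed

text \<open>The same homeomorphism in two coordinate systems: \<open>half_shift d f\<close> lives in
  one half of the standard unit block, and the label decides which half of the actual unit interval
  that becomes.\<close>

lemma half_map_half_pattern:
  assumes f: "f \<in> dyad_PL_c (- (1/4)) (1/4)" and d: "d \<in> {1, - 1}"
  shows "half_map (half_pattern c d V) f = unit_map c V (half_shift d f)"
proof
  fix x
  obtain i t where x: "x = (2 * of_int i + 1) / 4 + t" and t: "- (1/4) \<le> t" "t \<le> 1/(4::real)" by (rule half_cases)
  let ?m = "mid c i"
  have fx: "f y = y" if "y \<le> - (1/4) \<or> 1/4 \<le> y" for y using f that by (auto simp: dyad_PL_c_def)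
  have x': "x = of_int ?m / 2 + (of_int (side c i) / 4 + t)"
    unfolding x by (auto simp: mid_def side_def field_simps)
  have "unit_map c V (half_shift d f) x = of_int ?m / 2 + twist (V ?m) (half_shift d f) (of_int (side c i) / 4 + t)"
    unfolding x' using t by (intro unit_map_eq dyad_PL_c_on[OF half_shift_PL_c[OF f d]] mid_even) (auto simp: side_def)
  also have "\<dots> = (2 * of_int i + 1) / 4 + twist (half_pattern c d V i) f t"
    unfolding x'[unfolded x, symmetric] using d t
    by (auto simp: twist_def half_shift_def half_pattern_def side_def mid_def fx field_simps)
  also have "\<dots> = half_map (half_pattern c d V) f x"
    unfolding x by (rule half_map_eq[OF dyad_PL_c_on[OF f] t, symmetric])
  finally show "half_map (half_pattern c d V) f x = unit_map c V (half_shift d f) x" by simp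
qed

definition indicator_pattern :: "int \<Rightarrow> int \<Rightarrow> int" where
  "indicator_pattern j i = (if 2 * int n dvd i - j then 1 else 0)"

lemma mid_period: "mid c (i + 2 * int n) = mid c i + 2 * int n" "side c (i + 2 * int n) = side c i"
  by (simp_all add: mid_def side_def)

text \<open>Conditions on a single label: the initial supply of patterns. The parity of
  \<open>c\<close> chooses the kind of letter.\<close>

lemma half_pattern_available:
  assumes d: "d \<in> {1, - 1}" shows "half_pattern c d s \<in> available"
proof -
  have "half_map (half_pattern c d s) f \<in> K" if f: "f \<in> dyad_PL_c (- (1/4)) (1/4)" for f
    unfolding half_map_half_pattern[OF f d] by (rule unit_map_K[OF half_shift_PL_c[OF f d]])
  moreover have "pattern (half_pattern c d s)"
    using s_sign by (auto simp: pattern_def half_pattern_def mid_period s_period)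
  ultimately show ?thesis by (simp add: available_def)
qed

text \<open>Of the two halves around \<open>m\<close>, the index
  \<open>if s m * d = 1 then m else m - 1\<close> is the one reached from the half of sign
  \<open>d\<close>. The label survives only where \<open>S\<close> agrees with it there, so a
  condition on half-intervals becomes one on unit intervals.\<close>

definition shift_label :: "(int \<Rightarrow> int) \<Rightarrow> int \<Rightarrow> int \<Rightarrow> int" where
  "shift_label S d m = (if S (if s m * d = 1 then m else m - 1) = s m then s m else 0)"

lemma half_pattern_shift_label:
  assumes d: "d \<in> {1, - 1}"
  shows "half_pattern c d (shift_label S d) = meet S (half_pattern c d s)"
proof
  fix i
  have "(if s (mid c i) * d = 1 then mid c i else mid c i - 1) = i" if "s (mid c i) * side c i = d"
    using that d s_sign[of "mid c i"] by (auto simp: mid_def side_def split: if_splits)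
  then show "half_pattern c d (shift_label S d) i = meet S (half_pattern c d s) i"
    using d s_sign[of "mid c i"] by (auto simp: half_pattern_def meet_def shift_label_def side_def)
qed

text \<open>Conjugating by a translation by half a unit inside the unit intervals moves the pattern across
  the midpoints.\<close>

lemma half_pattern_opposite:
  assumes S: "S \<in> available" and d: "d \<in> {1, - 1}"
  shows "half_pattern c (- d) (shift_label S d) \<in> available"
proof -
  let ?V = "shift_label S d"
  let ?J = "dyad_PL_c (- (1/2)) (1/2)"
  have subJ: "subgroup ?J Homeo_plus_R" by (rule subgroup_dyad_PL_c) simp
  have on: "f \<in> dyad_PL_on (- (1/2)) (1/2)" if "f \<in> ?J" for f using that by (rule dyad_PL_c_on)
  have avail: "half_pattern c d ?V \<in> available"
    unfolding half_pattern_shift_label[OF d] by (intro meet_available S half_pattern_available d)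
  have d': "- d \<in> {1, - 1}" using d by auto
  have "half_map (half_pattern c (- d) ?V) f \<in> K" if f: "f \<in> dyad_PL_c (- (1/4)) (1/4)" for f
  proof -
    obtain r q where rq: "f \<in> dyad_PL" "r \<in> dyad" "q \<in> dyad" "- (1/4) < r" "r < q" "q < 1/4"
      "\<And>x. x \<le> r \<or> q \<le> x \<Longrightarrow> f x = x" using f by (rule dyad_PL_cE) blast
    have f_on: "f \<in> dyad_PL_on r q" unfolding dyad_PL_on_def
    proof (intro CollectI conjI allI impI rq(1))
      fix x assume "x \<notin> {r..q}"
      then show "f x = x" by (intro rq(7)) auto
    qed
    let ?d = "of_int d :: real"
    have "(\<lambda>x. x + - (?d / 2)) \<in> dyad_PL" by (intro dyad_PL_translation dyad_uminus) simp
    \<comment> \<open>\<open>h\<close> shifts the support from the half of sign \<open>d\<close> by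
      half a unit into the other half, and thus conjugates \<open>half_shift d f\<close> to
      \<open>half_shift (- d) f\<close>.\<close>
    then obtain h where h: "h \<in> ?J" "\<forall>x\<in>{r + ?d / 4..q + ?d / 4}. h x = x + - (?d / 2)"
      using dyad_PL_c_extend[of "\<lambda>x. x + - (?d / 2)" "- (1/2)" "r + ?d / 4" "q + ?d / 4" "1/2"] rq d by auto
    note hi = subgroup_Homeo_inv[OF subJ h(1)]
    note hm = subgroup_Homeo_carrier[OF subJ h(1)]
    note him = inv_strict_mono_surj[OF hm]
    define F where "F = half_shift d f"
    have F: "F \<in> ?J" unfolding F_def by (rule half_shift_PL_c[OF f d])
    have Fd: "half_shift (- d) f = h \<circ> F \<circ> inv_into UNIV h"
    proof
      fix y
      obtain x where y: "y = h x" using him(3) by metis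
      have e: "(h \<circ> F \<circ> inv_into UNIV h) y = h (F x)" by (simp add: y him)
      show "half_shift (- d) f y = (h \<circ> F \<circ> inv_into UNIV h) y"
      proof (cases "x \<in> {r + ?d / 4..q + ?d / 4}")
        case True
        have fr: "r \<le> f (x - ?d / 4)" "f (x - ?d / 4) \<le> q"
          using dyad_PL_on_range[OF f_on, of "x - ?d / 4"] True by auto
        then have "h (F x) = F x + - (?d / 2)" using h(2) by (simp add: F_def half_shift_def)
        moreover have "h x = x - ?d / 2" using True h(2) by auto
        ultimately show ?thesis unfolding e by (simp add: y F_def half_shift_def)
      next
        case False
        then have out: "x < r + ?d / 4 \<or> q + ?d / 4 < x" by auto
        have "h (r + ?d / 4) = r - ?d / 4" "h (q + ?d / 4) = q - ?d / 4" using h(2) rq by auto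
        then have "h x < r - ?d / 4 \<or> q - ?d / 4 < h x"
          using out strict_mono_less[OF hm(1), of x "r + ?d / 4"] strict_mono_less[OF hm(1), of "q + ?d / 4" x] by auto
        then have "f (h x + ?d / 4) = h x + ?d / 4" by (intro rq(7)) auto
        moreover have "f (x - ?d / 4) = x - ?d / 4" using out by (intro rq(7)) auto
        ultimately show ?thesis unfolding e by (simp add: y F_def half_shift_def)
      qed
    qed
    have Fd': "half_shift (- d) f \<in> ?J" by (rule half_shift_PL_c[OF f d'])
    have "unit_map c ?V (half_shift (- d) f) = unit_map c s h \<circ> unit_map c ?V F \<circ> unit_map c s (inv_into UNIV h)"
    proof
      fix x
      define p where "p = (of_int c - 1) / (2::real)"
      obtain i t where it: "x = center (1/2) p i + t" "- (1/2) \<le> t" "t < 1/(2::real)" using block_cases[of "1/2" x p] by auto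
      define m where "m = 2 * i + c"
      have "center (1/2) p i = of_int m / 2" unfolding center_def m_def p_def by (simp add: field_simps)
      then have x: "x = of_int m / 2 + t" using it by simp
      have m: "even (m - c)" by (simp add: m_def)
      have t: "- (1/2) \<le> t" "t \<le> 1/2" using it by auto
      note t1 = twist_range[OF on[OF hi] t, of "s m"]
      note t2 = twist_range[OF on[OF F] t1, of "?V m"]
      have "(unit_map c s h \<circ> unit_map c ?V F \<circ> unit_map c s (inv_into UNIV h)) x =
        of_int m / 2 + twist (s m) h (twist (?V m) F (twist (s m) (inv_into UNIV h) t))"
        unfolding x comp_apply unit_map_eq[OF on[OF hi] t m] unit_map_eq[OF on[OF F] t1 m]
          unit_map_eq[OF on[OF h(1)] t2 m] by simp
      \<comment> \<open>Either the value of \<open>shift_label\<close> is \<open>s m\<close>, and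
        the conjugation is seen in one orientation throughout, or it is 0 and the conjugators
        cancel.\<close>
      also have "\<dots> = of_int m / 2 + twist (?V m) (half_shift (- d) f) t"
        using s_sign[of m] by (auto simp: Fd shift_label_def twist_def him)
      also have "\<dots> = unit_map c ?V (half_shift (- d) f) x"
        unfolding x by (rule unit_map_eq[OF on[OF Fd'] t m, symmetric])
      finally show "unit_map c ?V (half_shift (- d) f) x = (unit_map c s h \<circ> unit_map c ?V F \<circ> unit_map c s (inv_into UNIV h)) x" by simp
    qed
    moreover have "unit_map c ?V F \<in> K"
      unfolding F_def half_map_half_pattern[OF f d, symmetric] by (rule availableD(3)[OF avail f])
    ultimately show ?thesis
      unfolding half_map_half_pattern[OF f d'] using unit_map_K[OF h(1)] unit_map_K[OF hi]
      by (simp add: subgroup_Homeo_comp[OF K_subgroup])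
  qed
  moreover have "pattern (half_pattern c (- d) ?V)"
  proof -
    have p: "shift_label S d (m + 2 * int n) = shift_label S d m" for m
      using availableD(2)[OF S, of m] availableD(2)[OF S, of "m - 1"] s_period[of m]
      by (simp add: shift_label_def algebra_simps)
    have v: "shift_label S d m \<in> {- 1, 0, 1}" for m using s_sign[of m] by (auto simp: shift_label_def)
    then show ?thesis by (auto simp: pattern_def half_pattern_def mid_period p)
  qed
  ultimately show ?thesis by (simp add: available_def)
qed

section \<open>Half-intervals that available patterns cannot tell apart\<close>

definition linked :: "int \<Rightarrow> int \<Rightarrow> int \<Rightarrow> bool" where
  "linked j i e \<longleftrightarrow> (\<forall>S\<in>available. S j = 1 \<longrightarrow> S i = e)"

text \<open>If \<open>i\<close> repeats \<open>j\<close> with orientation \<open>e\<close>, then the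
  neighbour \<open>i + e\<close> repeats \<open>j + 1\<close>. A pattern \<open>S\<close> nonzero at
  \<open>j + 1\<close> is moved across the point \<open>(j + 1) / 2\<close> to a pattern
  \<open>R\<close> nonzero at \<open>j\<close>. The link prescribes \<open>R\<close> at
  \<open>i\<close>, and a nonzero value there can only come from \<open>S\<close> at
  \<open>i + e\<close>.\<close>

lemma linked_step:
  assumes l: "linked j i e" and e: "e \<in> {1, - 1}" shows "linked (j + 1) (i + e) e"
  unfolding linked_def
proof (intro ballI impI)
  fix S assume S: "S \<in> available" "S (j + 1) = 1"
  let ?c = "j + 1"
  define q where "q = s ?c"
  have q: "q \<in> {1, - 1}" using s_sign unfolding q_def by blast
  \<comment> \<open>The factor \<open>q\<close> makes \<open>T\<close> agree with the label at
    \<open>j + 1\<close>, so that \<open>shift_label\<close> keeps this label.\<close>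
  define T where "T = (\<lambda>i. q * S i)"
  have T: "T \<in> available" unfolding T_def by (rule sign_available[OF S(1) q])
  define R where "R = half_pattern ?c (- q) (shift_label T q)"
  have R: "R \<in> available" unfolding R_def by (rule half_pattern_opposite[OF T q])
  have "R j = q"
    using q S(2) by (auto simp: R_def half_pattern_def shift_label_def mid_def side_def T_def q_def)
  then have "q * R j = 1" using q by auto
  then have "q * R i = e" using l sign_available[OF R q] by (auto simp: linked_def)
  then have Ri: "R i = q * e" using q by auto
  let ?m = "mid ?c i"
  have "shift_label T q ?m = q * e" "q * e * side ?c i = - q"
    using Ri q e by (auto simp: R_def half_pattern_def split: if_splits)
  then have sl: "s ?m = q * e" "T (if s ?m * q = 1 then ?m else ?m - 1) = q * e" and sd: "side ?c i = - e"
    using q e by (auto simp: shift_label_def split: if_splits)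
  \<comment> \<open>Since \<open>i\<close> is the half of side \<open>- e\<close>, the other half of
    its unit interval lies in direction \<open>e\<close>.\<close>
  have "(if s ?m * q = 1 then ?m else ?m - 1) = i + e"
    using sl(1) sd q e by (auto simp: mid_def side_def split: if_splits)
  then show "S (i + e) = e" using sl(2) q by (auto simp: T_def)
qed

text \<open>The link is tested on the pattern that reads the label at the right end
  \<open>(j + 1) / 2\<close> of \<open>j\<close>. This end corresponds to the right end of
  \<open>i\<close> if \<open>e = 1\<close>, and to the left end \<open>i / 2\<close>, with inverted
  label, if \<open>e = - 1\<close>. The parity of \<open>i - j\<close> says that both letters are of
  the same kind.\<close>

lemma linked_label:
  assumes l: "linked j i e" and e: "e \<in> {1, - 1}"
  shows "e = 1 \<and> even (i - j) \<and> s (i + 1) = s (j + 1) \<or> e = - 1 \<and> odd (i - j) \<and> s i = - s (j + 1)"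
proof -
  let ?c = "j + 1"
  define q where "q = s ?c"
  have q: "q \<in> {1, - 1}" using s_sign unfolding q_def by blast
  define R where "R = half_pattern ?c (- q) s"
  have q': "- q \<in> {1, - 1}" using q by auto
  have R: "R \<in> available" unfolding R_def by (rule half_pattern_available[OF q'])
  have "R j = q" using q by (auto simp: R_def half_pattern_def mid_def side_def q_def)
  then have "q * R j = 1" using q by auto
  then have "q * R i = e" using l sign_available[OF R q] by (auto simp: linked_def)
  then have Ri: "R i = q * e" using q by auto
  have "s (mid ?c i) = q * e" "q * e * side ?c i = - q"
    using Ri q e by (auto simp: R_def half_pattern_def split: if_splits)
  then show ?thesis using q e by (auto simp: mid_def side_def q_def split: if_splits)
qed

lemma linked_iterate:
  assumes "linked j i e" "e \<in> {1, - 1}" shows "linked (j + int t) (i + e * int t) e"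
proof (induction t)
  case (Suc t)
  then show ?case using linked_step[OF Suc.IH assms(2)] by (simp add: algebra_simps)
qed (use assms in simp)

text \<open>\<open>linked_iterate\<close> propagates links only to larger \<open>j\<close>; modulo
  the period every integer is reached that way.\<close>

lemma nat_shift: "\<exists>t::nat. \<exists>k. t0 = int t + 2 * int n * k"
proof -
  have "t0 = int (nat (t0 mod (2 * int n))) + 2 * int n * (t0 div (2 * int n))"
    using n_pos by simp
  then show ?thesis by blast
qed

text \<open>The labels to the right of \<open>i\<close> and of \<open>j\<close> agree for ever, so
  the even shift by \<open>i - j\<close> preserves \<open>s\<close> and minimality applies.\<close>

lemma linked_pos: assumes l: "linked j i 1" shows "2 * int n dvd i - j"
proof -
  have *: "s (i + 1 + int t) = s (j + 1 + int t)" "even (i - j)" for t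
    using linked_label[OF linked_iterate[OF l, of t]] by (auto simp: algebra_simps)
  define q where "q = (i - j) div 2"
  have q: "i - j = 2 * q" using *(2) by (simp add: q_def)
  have "s (x + 2 * q) = s x" for x
  proof -
    obtain t k where tk: "x - (j + 1) = int t + 2 * int n * k" using nat_shift by blast
    have "s (x + 2 * q) = s (i + 1 + int t + 2 * int n * k)" using tk q by (intro arg_cong[of _ _ s]) linarith
    also have "\<dots> = s (j + 1 + int t + 2 * int n * k)" using *(1)[of t] by (simp add: s_period')
    also have "\<dots> = s x" using tk by (intro arg_cong[of _ _ s]) linarith
    finally show ?thesis .
  qed
  then have "int n dvd q" by (rule s_minimal)
  then show ?thesis using q by simp
qed

text \<open>An orientation-reversing coincidence would be a reflection of the labelling; the label at its
  centre is mapped to itself and not to its inverse.\<close>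

lemma linked_neg: "\<not> linked j i (- 1)"
proof
  assume l: "linked j i (- 1)"
  have *: "s (i - int t) = - s (j + 1 + int t)" "odd (i - j)" for t
    using linked_label[OF linked_iterate[OF l, of t]] by (auto simp: algebra_simps)
  \<comment> \<open>\<open>j + 1 + t0\<close> is fixed by the reflection
    \<open>x \<mapsto> i + j + 1 - x\<close> of indices, so its label would be its own
    inverse.\<close>
  define t0 where "t0 = (i - (j + 1)) div 2"
  have t0: "i - (j + 1) = 2 * t0" using *(2) by (simp add: t0_def)
  obtain t k where tk: "t0 = int t + 2 * int n * k" using nat_shift by blast
  have "s (j + 1 + t0) = s (j + 1 + int t + 2 * int n * k)" using tk by (simp add: algebra_simps)
  then have "s (j + 1 + t0) = s (j + 1 + int t)" by (simp only: s_period')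
  moreover have "i - int t = j + 1 + t0 + 2 * int n * k" using tk t0 by linarith
  then have "s (i - int t) = s (j + 1 + t0)" by (simp only: s_period')
  ultimately show False using *(1)[of t] s_sign[of "j + 1 + t0"] by auto
qed

text \<open>One pattern avoids the value 1 at \<open>i\<close> and another avoids -1; their meet can
  only be 0 there.\<close>

lemma separate:
  assumes "\<not> 2 * int n dvd i - j" shows "\<exists>S\<in>available. S j = 1 \<and> S i = 0"
proof -
  obtain S where S: "S \<in> available" "S j = 1" "S i \<noteq> 1" using linked_pos[of j i] assms unfolding linked_def by blast
  obtain T where T: "T \<in> available" "T j = 1" "T i \<noteq> - 1" using linked_neg[of j i] unfolding linked_def by blast
  have "meet S T i = 0" using S T availableD(1)[OF S(1), of i] by (auto simp: meet_def)
  moreover have "meet S T j = 1" using S T by (simp add: meet_def)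
  ultimately show ?thesis using meet_available[OF S(1) T(1)] by blast
qed

lemma indicator_available: "indicator_pattern j \<in> available"
proof -
  have ex: "\<exists>S\<in>available. S j = 1 \<and> (\<forall>i\<in>I. S i = 0)" if "finite I" "\<forall>i\<in>I. \<not> 2 * int n dvd i - j" for I
    using that
  proof (induction I rule: finite_induct)
    case empty
    define q where "q = s (j + 1)"
    have q: "q \<in> {1, - 1}" using s_sign unfolding q_def by blast
    have "half_pattern (j + 1) (- q) s j = q" using q by (auto simp: half_pattern_def mid_def side_def q_def)
    then have "q * half_pattern (j + 1) (- q) s j = 1" using q by auto
    moreover have "- q \<in> {1, - 1}" using q by auto
    then have "(\<lambda>i. q * half_pattern (j + 1) (- q) s i) \<in> available" by (intro sign_available half_pattern_available q)
    ultimately show ?case by (intro bexI[of _ "\<lambda>i. q * half_pattern (j + 1) (- q) s i"]) auto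
  next
    case (insert i I)
    then obtain S where S: "S \<in> available" "S j = 1" "\<forall>i\<in>I. S i = 0" by blast
    obtain T where T: "T \<in> available" "T j = 1" "T i = 0" using separate[of i j] insert.prems by blast
    have "meet S T j = 1" "\<forall>k\<in>insert i I. meet S T k = 0" using S T by (auto simp: meet_def)
    then show ?case using meet_available[OF S(1) T(1)] by blast
  qed
  \<comment> \<open>The indices of one period outside the class of \<open>j\<close>. Finitely many
    meets clear them, and periodicity of patterns does the rest.\<close>
  define I where "I = {i \<in> {j..<j + 2 * int n}. \<not> 2 * int n dvd i - j}"
  have "finite I" unfolding I_def by (rule finite_subset[of _ "{j..<j + 2 * int n}"]) auto
  moreover have "\<forall>i\<in>I. \<not> 2 * int n dvd i - j" by (simp add: I_def)
  ultimately obtain S where S: "S \<in> available" "S j = 1" and "\<forall>i\<in>I. S i = 0" using ex[of I] by blast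
  then have S0: "S i = 0" if "i \<in> {j..<j + 2 * int n}" "\<not> 2 * int n dvd i - j" for i
    using that by (simp add: I_def)
  have per: "S (i + 2 * int n * k) = S i" for i k
    by (rule int_periodic) (rule availableD(2)[OF S(1)])
  have "S i = indicator_pattern j i" for i
  proof -
    define i' where "i' = j + (i - j) mod (2 * int n)"
    have i': "i = i' + 2 * int n * ((i - j) div (2 * int n))" by (simp add: i'_def)
    have r: "i' \<in> {j..<j + 2 * int n}" using n_pos by (simp add: i'_def)
    have "S i = S i'" using per[of i' "(i - j) div (2 * int n)"] unfolding i'[symmetric] .
    moreover have "S i' = indicator_pattern j i"
    proof (cases "2 * int n dvd i - j")
      case True
      then have "i' = j" by (simp add: i'_def dvd_imp_mod_0)
      then show ?thesis using S(2) True by (simp add: indicator_pattern_def)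
    next
      case False
      then have "\<not> 2 * int n dvd i' - j" by (simp add: i'_def dvd_eq_mod_eq_0)
      then show ?thesis using S0[OF r] False by (simp add: indicator_pattern_def)
    qed
    ultimately show ?thesis by simp
  qed
  then have "S = indicator_pattern j" by blast
  then show ?thesis using S(1) by simp
qed

end

section \<open>Generating all periodic piecewise dyadic affine homeomorphisms\<close>

text \<open>Support, read modulo \<open>n\<close>, in a compact part of \<open>(a, b)\<close>: on
  the circle of length \<open>n\<close>, \<open>[s, r + n]\<close> is what remains outside
  \<open>[r, s]\<close>.\<close>

definition local_PL :: "nat \<Rightarrow> real \<Rightarrow> real \<Rightarrow> (real \<Rightarrow> real) set" where
  "local_PL n a b = {g \<in> periodic_PL n.
     \<exists>r s. a < r \<and> r \<le> s \<and> s < b \<and> (\<forall>x. s \<le> x \<and> x \<le> r + real n \<longrightarrow> g x = x)}"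

lemma local_PL_I:
  "g \<in> periodic_PL n \<Longrightarrow> a < r \<Longrightarrow> r \<le> s \<Longrightarrow> s < b \<Longrightarrow>
   (\<And>x. s \<le> x \<Longrightarrow> x \<le> r + real n \<Longrightarrow> g x = x) \<Longrightarrow> g \<in> local_PL n a b"
  unfolding local_PL_def by auto

lemma local_PL_E:
  assumes "g \<in> local_PL n a b" "b \<le> a + real n"
  obtains r s where "g \<in> periodic_PL n" "r \<in> dyad" "s \<in> dyad" "a < r" "r < s" "s < b"
    "\<And>x. s \<le> x \<Longrightarrow> x \<le> r + real n \<Longrightarrow> g x = x"
proof -
  obtain r s where g: "g \<in> periodic_PL n" and rs: "a < r" "r \<le> s" "s < b"
    "\<forall>x. s \<le> x \<and> x \<le> r + real n \<longrightarrow> g x = x" using assms(1) unfolding local_PL_def by blast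
  obtain r' s' where "r' \<in> dyad" "s' \<in> dyad" "a < r'" "r' < r" "s < s'" "s' < b"
    using dyad_dense[of a r] dyad_dense[of s b] rs by blast
  then show ?thesis using that[of r' s'] g rs by auto
qed

lemma periodic_PL_eqI:
  assumes "g \<in> periodic_PL n" "h \<in> periodic_PL n" "n > 0"
    and eq: "\<And>x. a \<le> x \<Longrightarrow> x < a + real n \<Longrightarrow> g x = h x"
  shows "g = h"
proof
  fix x
  define k where "k = \<lfloor>(x - a) / real n\<rfloor>"
  define y where "y = x - real n * of_int k"
  have "of_int k \<le> (x - a) / real n" "(x - a) / real n < of_int k + 1" unfolding k_def by linarith+
  then have "a \<le> y" "y < a + real n" unfolding y_def using assms(3) by (simp_all add: field_simps)
  then have "g y = h y" by (rule eq)
  moreover have "x = y + real n * of_int k" by (simp add: y_def)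
  ultimately show "g x = h x" using periodic_PL_shift[OF assms(1), of y k] periodic_PL_shift[OF assms(2), of y k] by simp
qed

text \<open>\<open>blocks\<close> with one block per period and constant label 1 repeats a map with
  period \<open>n\<close>.\<close>

lemma local_PL_extend:
  assumes f: "f \<in> dyad_PL_c a b" and a: "a \<in> dyad" and b: "b \<le> a + real n" and n: "n > 0"
  shows "\<exists>g\<in>local_PL n a b. \<forall>x. a \<le> x \<and> x \<le> a + real n \<longrightarrow> g x = f x"
proof -
  obtain r s where f: "f \<in> dyad_PL" and rs: "r \<in> dyad" "s \<in> dyad" "a < r" "r < s" "s < b"
    "\<And>x. x \<le> r \<or> s \<le> x \<Longrightarrow> f x = x" using f by (rule dyad_PL_cE) blast
  define w where "w = real n / 2"
  have w: "w > 0" "w \<in> dyad" unfolding w_def using n dyad_half_int[of "int n"] by simp_all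
  define c where "c = a + w"
  have c: "c \<in> dyad" unfolding c_def using a w by (intro dyad_add)
  define h where "h = (\<lambda>x. x + - c) \<circ> (f \<circ> (\<lambda>x. x + c))"
  have "h \<in> dyad_PL" unfolding h_def using f c by (intro dyad_PL_comp dyad_PL_translation dyad_uminus)
  moreover have "h t = t" if "t \<notin> {- w..w}" for t
    using rs(6)[of "t + c"] that rs b by (auto simp: h_def c_def w_def)
  ultimately have h: "h \<in> dyad_PL_on (- w) w" by (simp add: dyad_PL_on_def)
  let ?g = "blocks w a (\<lambda>_. 1) h"
  have ce: "center w a 0 = c" by (simp add: center_def c_def)
  have eq: "?g x = f x" if "a \<le> x" "x \<le> a + real n" for x
    using blocks_eq[OF w(1) h, of "x - c" a "\<lambda>_. 1" 0] that by (simp add: ce twist_def h_def) (simp add: c_def w_def)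
  have "?g (x + real n) = ?g x + real n" for x
    using blocks_periodic[OF w(1) h, of "\<lambda>_. 1" 1 a x] by (simp add: w_def)
  then have g: "?g \<in> periodic_PL n" using blocks_dyad_PL[OF w a h] by (simp add: periodic_PL_def)
  have "?g \<in> local_PL n a b"
  proof (rule local_PL_I[OF g rs(3) less_imp_le[OF rs(4)] rs(5)])
    fix x assume x: "s \<le> x" "x \<le> r + real n"
    show "?g x = x"
    proof (cases "x \<le> a + real n")
      case True
      then show ?thesis using eq[of x] rs(6)[of x] x rs by simp
    next
      case False
      then have "?g (x - real n) = x - real n" using eq[of "x - real n"] rs(6)[of "x - real n"] x rs b by simp
      then show ?thesis using g by (simp add: periodic_PL_def) (metis diff_add_cancel)
    qed
  qed
  then show ?thesis using eq by blast
qed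

section \<open>From half-intervals to all periodic maps\<close>

context labelled_line
begin

text \<open>Conjugation by \<open>k\<close> carries the support \<open>[r, s']\<close> of
  \<open>g\<close> into \<open>(a, b)\<close>, where \<open>K\<close> contains every local
  map.\<close>

lemma K_conj:
  assumes ab: "local_PL n a b \<subseteq> K" and k: "k \<in> K" and g: "g \<in> periodic_PL n"
    and fx: "\<And>x. s' \<le> x \<Longrightarrow> x \<le> r + real n \<Longrightarrow> g x = x" and rs: "r \<le> s'" "a < k r" "k s' < b"
  shows "g \<in> K"
proof -
  have kp: "k \<in> periodic_PL n" using k K_periodic by blast
  have km: "strict_mono k" "surj k" using kp by (auto simp: periodic_PL_def dyad_PL_strict_mono dyad_PL_surj)
  note ki = inv_strict_mono_surj[OF km]
  have kiK: "inv_into UNIV k \<in> K" by (rule subgroup_Homeo_inv[OF K_subgroup k])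
  have "k \<circ> g \<circ> inv_into UNIV k \<in> local_PL n a b"
  proof (rule local_PL_I[of _ _ _ "k r" "k s'"])
    show "k \<circ> g \<circ> inv_into UNIV k \<in> periodic_PL n"
      using kp g kiK K_periodic by (intro subgroup_Homeo_comp[OF subgroup_periodic_PL]) auto
    show "k r \<le> k s'" using rs(1) by (simp add: strict_mono_less_eq[OF km(1)])
    fix x assume x: "k s' \<le> x" "x \<le> k r + real n"
    have "k r + real n = k (r + real n)" using kp by (simp add: periodic_PL_def)
    then have "s' \<le> inv_into UNIV k x" "inv_into UNIV k x \<le> r + real n"
      using x strict_mono_less_eq[OF km(1), of s' "inv_into UNIV k x"]
        strict_mono_less_eq[OF km(1), of "inv_into UNIV k x" "r + real n"] by (simp_all add: ki)
    then show "(k \<circ> g \<circ> inv_into UNIV k) x = x" using fx by (simp add: ki)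
  qed (use rs in auto)
  then have "k \<circ> g \<circ> inv_into UNIV k \<in> K" using ab by blast
  then have "inv_into UNIV k \<circ> (k \<circ> g \<circ> inv_into UNIV k) \<circ> k \<in> K"
    by (rule subgroup_Homeo_comp[OF K_subgroup subgroup_Homeo_comp[OF K_subgroup kiK] k])
  moreover have "inv_into UNIV k \<circ> (k \<circ> g \<circ> inv_into UNIV k) \<circ> k = g" by (simp add: fun_eq_iff ki)
  ultimately show ?thesis by simp
qed

text \<open>For the pattern that is 1 on the class of \<open>j\<close> and 0 elsewhere,
  \<open>half_map\<close> rebuilds a periodic map from its piece on
  \<open>[j/2, (j+1)/2]\<close>.\<close>

lemma half_interval_K: "local_PL n (of_int j / 2) ((of_int j + 1) / 2) \<subseteq> K"
proof
  fix g assume gl: "g \<in> local_PL n (of_int j / 2) ((of_int j + 1) / 2)"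
  have n1: "real n \<ge> 1" using n_pos by simp
  have b: "(of_int j + 1) / 2 \<le> of_int j / 2 + real n" using n1 by (simp add: field_simps)
  obtain r q where g: "g \<in> periodic_PL n" and rq: "r \<in> dyad" "q \<in> dyad" "of_int j / 2 < r" "r < q" "q < (of_int j + 1) / 2"
    and fx: "\<And>x. q \<le> x \<Longrightarrow> x \<le> r + real n \<Longrightarrow> g x = x"
    using gl b by (rule local_PL_E) blast
  have gPL: "g \<in> dyad_PL" using g by (rule periodic_PL_dyad_PL)
  have "g (r + real n) = r + real n" using rq n1 by (intro fx) (auto simp: field_simps)
  then have gr: "g r = r" using g by (simp add: periodic_PL_def)
  have gq: "g q = q" using rq n1 by (intro fx) (auto simp: field_simps)
  \<comment> \<open>As \<open>g\<close> fixes \<open>r\<close> and \<open>q\<close>, a single copy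
    of its periodic support can be cut out.\<close>
  define f1 where "f1 = (\<lambda>x. if x \<le> q then g x else x)"
  define f0 where "f0 = (\<lambda>x. if x \<le> r then x else f1 x)"
  have "f1 \<in> dyad_PL" unfolding f1_def using gPL rq gq by (intro dyad_PL_glue dyad_PL_id) auto
  then have f0: "f0 \<in> dyad_PL" unfolding f0_def using rq gr by (intro dyad_PL_glue dyad_PL_id) (auto simp: f1_def)
  define c where "c = (2 * of_int j + 1) / (4::real)"
  have c: "c \<in> dyad" unfolding c_def using dyad_half[OF dyad_half_int[of "2 * j + 1"]] by simp
  define f where "f = (\<lambda>x. x + - c) \<circ> (f0 \<circ> (\<lambda>x. x + c))"
  have f: "f \<in> dyad_PL_c (- (1/4)) (1/4)"
  proof (rule dyad_PL_cI[of _ _ "r - c" "q - c"])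
    show "f \<in> dyad_PL" unfolding f_def using f0 c by (intro dyad_PL_comp dyad_PL_translation dyad_uminus)
    fix x assume "x < r - c \<or> q - c < x"
    then show "f x = x" using rq by (auto simp: f_def f0_def f1_def)
  qed (use rq in \<open>auto simp: c_def field_simps\<close>)
  have hK: "half_map (indicator_pattern j) f \<in> K" by (rule availableD(3)[OF indicator_available f])
  have "half_map (indicator_pattern j) f = g"
  proof (rule periodic_PL_eqI[OF _ g n_pos])
    show "half_map (indicator_pattern j) f \<in> periodic_PL n" using hK K_periodic by blast
    fix x assume x: "of_int j / 2 \<le> x" "x < of_int j / 2 + real n"
    obtain i t where it: "x = center (1/4) 0 i + t" "- (1/4) \<le> t" "t < 1/(4::real)" using block_cases[of "1/4" x 0] by auto
    then have xi: "x = (2 * of_int i + 1) / 4 + t" by (simp add: center_def)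
    have hx: "half_map (indicator_pattern j) f x = (2 * of_int i + 1) / 4 + twist (indicator_pattern j i) f t"
      unfolding xi using it by (intro half_map_eq dyad_PL_c_on[OF f]) auto
    have "of_int j < (of_int (i + 1) :: real)" using x(1) it xi by (simp add: field_simps)
    then have ij: "j \<le> i" by linarith
    have "(of_int i :: real) < of_int (j + 2 * int n)" using x(2) it xi by (simp add: field_simps)
    then have ij': "i < j + 2 * int n" by linarith
    show "half_map (indicator_pattern j) f x = g x"
    proof (cases "i = j")
      case True
      then have e: "half_map (indicator_pattern j) f x = c + f t" unfolding hx by (simp add: indicator_pattern_def twist_def c_def)
      have xt: "x = t + c" using xi True by (simp add: c_def)
      have "g x = x" if "x \<le> r"
      proof -
        have "g (x + real n) = x + real n" using that x rq b by (intro fx) auto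
        then show ?thesis using g by (simp add: periodic_PL_def)
      qed
      moreover have "g x = x" if "q \<le> x" using that x rq by (intro fx) auto
      ultimately show ?thesis unfolding e by (auto simp: f_def f0_def f1_def xt)
    next
      case False
      then have "\<not> 2 * int n dvd i - j" using ij ij' by (auto dest: zdvd_imp_le)
      then have "half_map (indicator_pattern j) f x = x" using hx xi by (simp add: indicator_pattern_def twist_def)
      moreover have "of_int (j + 1) \<le> (of_int i :: real)" using ij False by linarith
      then have "(of_int j + 1) / 2 \<le> x" unfolding xi using it(2) by (simp add: field_simps)
      then have "g x = x" using x rq by (intro fx) auto
      ultimately show ?thesis by simp
    qed
  qed
  then show "g \<in> K" using hK by simp
qed

text \<open>Twisting \<open>h\<close> beforehand by the label at \<open>m\<close> cancels the twist
  there. The effect on other unit intervals is left open: such elements only serve to move points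
  and supports.\<close>

lemma unit_move:
  assumes h: "h \<in> dyad_PL_c (- (1/2)) (1/2)"
  shows "\<exists>k\<in>K. \<forall>t. - (1/2) \<le> t \<and> t \<le> 1/2 \<longrightarrow> k (of_int m / 2 + t) = of_int m / 2 + h t"
proof (intro bexI allI impI)
  have "twist (s m) h \<in> dyad_PL_c (- (1/2)) (1/2)" using twist_PL_c[OF _ s_sign[of m], of h "1/2"] h by simp
  then show "unit_map m s (twist (s m) h) \<in> K" by (rule unit_map_K)
  fix t :: real assume t: "- (1/2) \<le> t \<and> t \<le> 1/2"
  have "unit_map m s (twist (s m) h) (of_int m / 2 + t) = of_int m / 2 + twist (s m) (twist (s m) h) t"
    using t twist_PL_on[OF dyad_PL_c_on[OF h]] by (intro unit_map_eq) auto
  also have "twist (s m) (twist (s m) h) t = h t" using s_sign[of m] by (auto simp: twist_def)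
  finally show "unit_map m s (twist (s m) h) (of_int m / 2 + t) = of_int m / 2 + h t" .
qed

lemma unit_interval_K: "local_PL n ((of_int m - 1) / 2) ((of_int m + 1) / 2) \<subseteq> K"
proof
  fix g assume gl: "g \<in> local_PL n ((of_int m - 1) / 2) ((of_int m + 1) / 2)"
  have n1: "real n \<ge> 1" using n_pos by simp
  have b: "(of_int m + 1) / 2 \<le> (of_int m - 1) / 2 + real n" using n1 by (simp add: field_simps)
  obtain r q where g: "g \<in> periodic_PL n" and rq: "r \<in> dyad" "q \<in> dyad" "(of_int m - 1) / 2 < r" "r < q" "q < (of_int m + 1) / 2"
    and fx: "\<And>x. q \<le> x \<Longrightarrow> x \<le> r + real n \<Longrightarrow> g x = x"
    using gl b by (rule local_PL_E) blast
  define r0 where "r0 = r - of_int m / 2"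
  define q0 where "q0 = q - of_int m / 2"
  have "r0 \<in> dyad" "q0 \<in> dyad" unfolding r0_def q0_def by (intro dyad_diff rq dyad_half_int)+
  moreover have "- (1/2) < r0" "r0 < q0" "q0 < 1/2" using rq by (auto simp: r0_def q0_def field_simps)
  ultimately have rq0: "r0 \<in> dyad" "q0 \<in> dyad" "- (1/2) < r0" "r0 < q0" "q0 < 1/2" by simp_all
  \<comment> \<open>\<open>1/16\<close> and \<open>1/4\<close> lie in \<open>(0, 1/2)\<close>, so
    the support is moved into the right half of the unit interval.\<close>
  obtain f where f: "f \<in> dyad_PL" "f r0 = 1/16" "f q0 = 1/4"
    using dyad_PL_interpolate[of r0 q0 "1/16" "1/4"] rq0 by auto
  obtain h where h: "h \<in> dyad_PL_c (- (1/2)) (1/2)" "\<forall>x\<in>{r0..q0}. h x = f x"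
    using dyad_PL_c_extend[OF f(1), of "- (1/2)" r0 q0 "1/2"] rq0 f by auto
  obtain k where k: "k \<in> K" "\<forall>t. - (1/2) \<le> t \<and> t \<le> 1/2 \<longrightarrow> k (of_int m / 2 + t) = of_int m / 2 + h t"
    using unit_move[OF h(1)] by blast
  have "k (of_int m / 2 + r0) = of_int m / 2 + 1/16" "k (of_int m / 2 + q0) = of_int m / 2 + 1/4"
    using k(2) h(2) f rq0 by auto
  then have "k r = of_int m / 2 + 1/16" "k q = of_int m / 2 + 1/4" by (simp_all add: r0_def q0_def)
  then show "g \<in> K"
    using K_conj[OF half_interval_K[of m] k(1) g fx] rq by (simp add: field_simps)
qed

text \<open>Fragmentation step: a map local to \<open>(b, d)\<close> pulls the right end
  \<open>q\<close> of a support back to a point \<open>y < c\<close> and keeps the left end above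
  \<open>a\<close>, so the support fits into \<open>(a, c)\<close>.\<close>

lemma overlap_K:
  assumes ac: "local_PL n a c \<subseteq> K" and bd: "local_PL n b d \<subseteq> K"
    and abcd: "a < b" "b < c" "c < d" "d \<le> a + real n" and b: "b \<in> dyad"
  shows "local_PL n a d \<subseteq> K"
proof
  fix g assume "g \<in> local_PL n a d"
  then obtain r q where g: "g \<in> periodic_PL n" and rq: "r \<in> dyad" "q \<in> dyad" "a < r" "r < q" "q < d"
    and fx: "\<And>x. q \<le> x \<Longrightarrow> x \<le> r + real n \<Longrightarrow> g x = x"
    using abcd(4) by (rule local_PL_E) blast
  obtain y where y: "y \<in> dyad" "b < y" "y < c" using dyad_dense[OF abcd(2)] by blast
  show "g \<in> K"
  proof (cases "q < c")
    case True
    then have "g \<in> local_PL n a c" using g rq fx by (intro local_PL_I[of _ _ _ r q]) auto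
    then show ?thesis using ac by blast
  next
    case False
    have "(\<lambda>x. x + (y - q)) \<in> dyad_PL" using y rq by (intro dyad_PL_translation dyad_diff)
    then obtain f where f: "f \<in> dyad_PL_c b d" "\<forall>x\<in>{q..q}. f x = x + (y - q)"
      using dyad_PL_c_extend[of "\<lambda>x. x + (y - q)" b q q d] y rq abcd False by auto
    obtain k where k: "k \<in> local_PL n b d" "\<And>x. b \<le> x \<Longrightarrow> x \<le> b + real n \<Longrightarrow> k x = f x"
      using local_PL_extend[OF f(1) b, of n] abcd n_pos by auto
    have kq: "k q = y" using k(2)[of q] f(2) False rq abcd by simp
    have km: "strict_mono k" using k(1) by (auto simp: local_PL_def periodic_PL_def dyad_PL_strict_mono)
    have fb: "f x = x" if "x \<le> b \<or> d \<le> x" for x using f(1) that by (auto simp: dyad_PL_c_def)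
    have kr: "a < k r"
    proof (cases "b \<le> r")
      case True
      then have "k b \<le> k r" by (simp add: strict_mono_less_eq[OF km])
      moreover have "k b = b" using k(2)[of b] fb[of b] by simp
      ultimately show ?thesis using abcd by simp
    next
      case False
      \<comment> \<open>\<open>r\<close> is left of the range where \<open>k\<close> is described by
        \<open>f\<close>, but its translate \<open>r + n\<close> is in that range and beyond
        \<open>d\<close>, where \<open>f\<close> is trivial.\<close>
      have "k (r + real n) = r + real n" using k(2)[of "r + real n"] fb[of "r + real n"] False rq abcd by simp
      moreover have "k \<in> periodic_PL n" using k(1) by (simp add: local_PL_def)
      ultimately show ?thesis using rq by (simp add: periodic_PL_def)
    qed
    show ?thesis
      using K_conj[OF ac _ g fx] k(1) bd kr kq y rq by auto
  qed
qed

text \<open>Starting from \<open>(0, 1)\<close>, each step adjoins the unit interval centred at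
  \<open>(m + 2) / 2\<close>, which overlaps the part already reached in a half-interval.\<close>

lemma fundamental_interval_K: "local_PL n 0 (real n) \<subseteq> K"
proof -
  have n1: "real n \<ge> 1" using n_pos by simp
  have "local_PL n 0 ((real m + 2) / 2) \<subseteq> K" if "m + 2 \<le> 2 * n" for m
    using that
  proof (induction m)
    case 0
    show ?case using unit_interval_K[of 1] by simp
  next
    case (Suc m)
    have U: "local_PL n ((real m + 1) / 2) ((real m + 3) / 2) \<subseteq> K"
      using unit_interval_K[of "int m + 2"] by (simp add: add.commute)
    have "(real m + 1) / 2 \<in> dyad" using dyad_half_int[of "int m + 1"] by simp
    moreover have "real m + 3 \<le> 2 * real n" using Suc.prems by linarith
    ultimately have "local_PL n 0 ((real m + 3) / 2) \<subseteq> K"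
      using Suc by (intro overlap_K[OF Suc.IH U]) (auto simp: field_simps)
    then show ?case by (simp add: add.commute)
  qed
  from this[of "2 * n - 2"] show ?thesis using n_pos by simp
qed

lemma unit_transitive:
  assumes "x \<in> dyad" "y \<in> dyad" "(of_int m - 1) / 2 < x" "x < (of_int m + 1) / 2"
    "(of_int m - 1) / 2 < y" "y < (of_int m + 1) / 2"
  shows "\<exists>k\<in>K. k x = y"
proof -
  have "(\<lambda>t. t + (y - x)) \<in> dyad_PL" using assms by (intro dyad_PL_translation dyad_diff)
  then obtain h where h: "h \<in> dyad_PL_c (- (1/2)) (1/2)" "\<forall>t\<in>{x - of_int m / 2..x - of_int m / 2}. h t = t + (y - x)"
    using dyad_PL_c_extend[of "\<lambda>t. t + (y - x)" "- (1/2)" "x - of_int m / 2" "x - of_int m / 2" "1/2"] assms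
    by (auto simp: field_simps)
  obtain k where k: "k \<in> K" "\<forall>t. - (1/2) \<le> t \<and> t \<le> 1/2 \<longrightarrow> k (of_int m / 2 + t) = of_int m / 2 + h t"
    using unit_move[OF h(1)] by blast
  have "- (1/2) \<le> x - of_int m / 2 \<and> x - of_int m / 2 \<le> 1/2" using assms by (simp add: field_simps)
  then have "k (of_int m / 2 + (x - of_int m / 2)) = of_int m / 2 + h (x - of_int m / 2)"
    using k(2) by blast
  then have "k x = y" using h(2) by simp
  then show ?thesis using k(1) by blast
qed

lemma transitive_trans: "\<exists>k\<in>K. k x = y \<Longrightarrow> \<exists>k\<in>K. k y = z \<Longrightarrow> \<exists>k\<in>K. k x = z"
  using subgroup_Homeo_comp[OF K_subgroup] by (metis comp_apply)

lemma transitive_sym: "\<exists>k\<in>K. k x = y \<Longrightarrow> \<exists>k\<in>K. k y = x"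
  using subgroup_Homeo_inv[OF K_subgroup] subgroup_Homeo_carrier[OF K_subgroup] inv_strict_mono_surj(4) by metis

text \<open>Points travel along overlapping unit intervals; \<open>m/2 + 1/4\<close> is common to
  those centred at \<open>m/2\<close> and \<open>(m + 1)/2\<close>.\<close>

lemma transitive_dyad: assumes x: "x \<in> dyad" shows "\<exists>k\<in>K. k x = 0"
proof -
  have quarter: "of_int m / 2 + 1/4 \<in> dyad" for m by (intro dyad_add) auto
  have step: "\<exists>k\<in>K. k (of_int m / 2) = of_int (m + 1) / 2" for m
  proof (rule transitive_trans)
    show "\<exists>k\<in>K. k (of_int m / 2) = of_int m / 2 + 1/4"
      by (rule unit_transitive[of _ _ m]) (use quarter in \<open>auto simp: field_simps\<close>)
    show "\<exists>k\<in>K. k (of_int m / 2 + 1/4) = of_int (m + 1) / 2"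
      by (rule unit_transitive[OF quarter dyad_half_int, of "m + 1"]) (simp_all add: field_simps)
  qed
  have half: "\<exists>k\<in>K. k (of_int m / 2) = 0" for m
  proof (induction m rule: int_induct[where k = 0])
    case base
    show ?case using subgroup_Homeo_id[OF K_subgroup] by (intro bexI[of _ id]) auto
  next
    case (step1 i)
    show ?case by (rule transitive_trans[OF transitive_sym[OF step[of i]] step1(2)])
  next
    case (step2 i)
    show ?case using transitive_trans[OF step[of "i - 1"]] step2(2) by simp
  qed
  define m where "m = \<lfloor>2 * x\<rfloor>"
  have m: "of_int m \<le> 2 * x" "2 * x < of_int m + 1" unfolding m_def by linarith+
  have "\<exists>k\<in>K. k x = of_int m / 2"
    by (rule unit_transitive[of _ _ m]) (use m x in \<open>auto simp: field_simps\<close>)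
  from transitive_trans[OF this half] show ?thesis .
qed

text \<open>Since \<open>g 0\<close> is dyadic, an element of \<open>K\<close> returns it to 0. A
  local element \<open>h\<close> that agrees with the resulting map near 0 is then divided out. What
  remains is the identity near 0, hence local to \<open>(0, n)\<close>.\<close>

theorem K_eq: "K = periodic_PL n"
proof
  show "K \<subseteq> periodic_PL n" by (rule K_periodic)
  show "periodic_PL n \<subseteq> K"
  proof
    fix g assume g: "g \<in> periodic_PL n"
    have n1: "real n \<ge> 1" using n_pos by simp
    have "g 0 \<in> dyad" using dyad_PL_dyad[OF periodic_PL_dyad_PL[OF g]] by simp
    then obtain k where k: "k \<in> K" "k (g 0) = 0" using transitive_dyad by blast
    define g1 where "g1 = k \<circ> g"
    have g1: "g1 \<in> periodic_PL n"
      unfolding g1_def using k(1) g K_periodic by (intro subgroup_Homeo_comp[OF subgroup_periodic_PL]) auto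
    have g10: "g1 0 = 0" by (simp add: g1_def k(2))
    have g1PL: "g1 \<in> dyad_PL" by (rule periodic_PL_dyad_PL[OF g1])
    note m = dyad_PL_strict_mono[OF g1PL] dyad_PL_surj[OF g1PL]
    have lim: "filterlim g1 (nhds 0) (at 0)" using strict_mono_surj_tendsto[OF m, of 0] by (simp add: g10)
    have "\<forall>\<^sub>F y in at 0. - (1/2) < g1 y \<and> g1 y < 1/2"
      using order_tendstoD(1)[OF lim, of "- (1/2)"] order_tendstoD(2)[OF lim, of "1/2"]
      by (simp add: eventually_conj_iff)
    then obtain e where e: "e > 0" "\<And>y. y \<noteq> 0 \<Longrightarrow> dist y 0 < e \<Longrightarrow> - (1/2) < g1 y \<and> g1 y < 1/2"
      unfolding eventually_at by auto
    define d where "d = min (e / 2) (1/4)"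
    have d: "0 < d" "d < 1/2" "d < e" using e by (auto simp: d_def)
    have gd: "- (1/2) < g1 (- d)" "g1 d < 1/2" using e(2)[of "- d"] e(2)[of d] d by auto
    obtain f where f: "f \<in> dyad_PL_c (- (1/2)) (1/2)" "\<forall>x\<in>{- d..d}. f x = g1 x"
      using dyad_PL_c_extend[OF g1PL, of "- (1/2)" "- d" d "1/2"] d gd by auto
    obtain h where h: "h \<in> local_PL n (- (1/2)) (1/2)" "\<And>x. - (1/2) \<le> x \<Longrightarrow> x \<le> - (1/2) + real n \<Longrightarrow> h x = f x"
      using local_PL_extend[OF f(1), of n] dyad_uminus[of "1/2"] n1 n_pos by auto
    have hK: "h \<in> K" using unit_interval_K[of 0] h(1) by auto
    have hm: "strict_mono h" "surj h" using subgroup_Homeo_carrier[OF K_subgroup hK] by blast+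
    note hiK = subgroup_Homeo_inv[OF K_subgroup hK]
    define g2 where "g2 = inv_into UNIV h \<circ> g1"
    have g2: "g2 \<in> periodic_PL n"
      unfolding g2_def using hiK g1 K_periodic by (intro subgroup_Homeo_comp[OF subgroup_periodic_PL]) auto
    have small: "g2 x = x" if "- d \<le> x" "x \<le> d" for x
    proof -
      have "h x = g1 x" using h(2)[of x] f(2) that d n1 by simp
      then show ?thesis unfolding g2_def by (simp flip: \<open>h x = g1 x\<close> add: inv_strict_mono_surj(4)[OF hm])
    qed
    have "g2 \<in> local_PL n 0 (real n)"
    proof (rule local_PL_I[OF g2, of _ d "real n - d"])
      fix x assume "real n - d \<le> x" "x \<le> d + real n"
      then have "g2 (x - real n) = x - real n" by (intro small) auto
      then show "g2 x = x" using g2 by (simp add: periodic_PL_def) (metis diff_add_cancel)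
    qed (use d n1 in auto)
    then have g2K: "g2 \<in> K" using fundamental_interval_K by blast
    have "inv_into UNIV k \<circ> (h \<circ> g2) \<in> K"
      using subgroup_Homeo_inv[OF K_subgroup k(1)] hK g2K by (intro subgroup_Homeo_comp[OF K_subgroup])
    moreover have "inv_into UNIV k \<circ> (h \<circ> g2) = g"
      using subgroup_Homeo_carrier[OF K_subgroup k(1)] hm
      by (simp add: g2_def g1_def fun_eq_iff inv_strict_mono_surj)
    ultimately show "g \<in> K" by simp
  qed
qed

end

section \<open>The covering of the circle by the line\<close>

lemma cover_shift:
  assumes "n > 0" shows "cover n (x + real n * of_int k) = cover n x"
proof -
  have "(x + real n * of_int k) / real n = x / real n + of_int k" using assms by (simp add: field_simps)
  then show ?thesis by (simp add: cover_def algebra_simps)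
qed

lemma residue_bounds:
  assumes "n > 0" shows "0 \<le> x - real n * of_int \<lfloor>x / real n\<rfloor>" "x - real n * of_int \<lfloor>x / real n\<rfloor> < real n"
proof -
  have "of_int \<lfloor>x / real n\<rfloor> \<le> x / real n" "x / real n < of_int \<lfloor>x / real n\<rfloor> + 1" by linarith+
  then have "of_int \<lfloor>x / real n\<rfloor> * real n \<le> x" "x < (of_int \<lfloor>x / real n\<rfloor> + 1) * real n"
    using assms by (simp_all only: pos_le_divide_eq pos_divide_less_eq of_nat_0_less_iff)
  then show "0 \<le> x - real n * of_int \<lfloor>x / real n\<rfloor>" "x - real n * of_int \<lfloor>x / real n\<rfloor> < real n"
    by (simp_all add: algebra_simps)
qed

lemma cover_eq_iff:
  assumes n: "n > 0" shows "cover n x = cover n y \<longleftrightarrow> (\<exists>k::int. y = x + real n * of_int k)"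
proof
  assume eq: "cover n x = cover n y"
  define u where "u = x - real n * of_int \<lfloor>x / real n\<rfloor>"
  define v where "v = y - real n * of_int \<lfloor>y / real n\<rfloor>"
  have uv: "0 \<le> u" "u < real n" "0 \<le> v" "v < real n" unfolding u_def v_def by (rule residue_bounds[OF n])+
  have "glue n u = glue n v" using eq by (simp add: cover_def u_def v_def)
  then have "u = v" using uv by (auto simp: glue_def doubleton_eq_iff split: if_splits)
  then have "y = x + real n * of_int (\<lfloor>y / real n\<rfloor> - \<lfloor>x / real n\<rfloor>)" by (simp add: u_def v_def algebra_simps)
  then show "\<exists>k::int. y = x + real n * of_int k" by blast
qed (auto simp: cover_shift[OF n])

lemma cover_eq_glue:
  assumes "n > 0" "x \<in> {0..real n}" shows "cover n x = glue n x"
proof (cases "x = real n")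
  case True
  then show ?thesis using assms by (simp add: cover_def glue_def)
next
  case False
  then have "\<lfloor>x / real n\<rfloor> = 0" using assms by (simp add: floor_eq_iff)
  then show ?thesis by (simp add: cover_def)
qed

lemma topspace_circle: "topspace (circle n) = glue n ` {0..real n}"
  by (simp add: circle_def)

lemma range_cover: assumes n: "n > 0" shows "range (cover n) = topspace (circle n)"
proof
  show "range (cover n) \<subseteq> topspace (circle n)"
  proof
    fix p assume "p \<in> range (cover n)"
    then obtain x where "p = glue n (x - real n * of_int \<lfloor>x / real n\<rfloor>)" by (auto simp: cover_def)
    then show "p \<in> topspace (circle n)" unfolding topspace_circle
      using residue_bounds[OF n, of x] by (intro image_eqI[of _ _ "x - real n * of_int \<lfloor>x / real n\<rfloor>"]) auto
  qed
  show "topspace (circle n) \<subseteq> range (cover n)"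
    unfolding topspace_circle by (auto simp: cover_eq_glue[OF n, symmetric] simp del: atLeastAtMost_iff)
qed

lemma cover_in_circle [simp]: "n > 0 \<Longrightarrow> cover n x \<in> topspace (circle n)"
  using range_cover by blast

lemma circle_cases: assumes "n > 0" "p \<in> topspace (circle n)" obtains x where "x \<in> {0..real n}" "p = cover n x"
  using assms cover_eq_glue[OF assms(1)] unfolding topspace_circle by auto

text \<open>For openness on the line: the complement of the preimage is the sum of a compact part of
  \<open>[0, n]\<close> and the closed set of multiples of \<open>n\<close>, hence closed.\<close>

lemma quotient_map_cover:
  assumes n: "n > 0" shows "quotient_map euclideanreal (circle n) (cover n)"
  unfolding quotient_map_def
proof (intro conjI allI impI)
  show "cover n ` topspace euclideanreal = topspace (circle n)" using range_cover[OF n] by simp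
  fix U assume U: "U \<subseteq> topspace (circle n)"
  let ?W = "{x. cover n x \<in> U}"
  let ?A = "{x \<in> {0..real n}. glue n x \<in> U}"
  have circ: "openin (circle n) U \<longleftrightarrow> openin (top_of_set {0..real n}) ?A"
    using U by (simp add: circle_def openin_quotient_topology)
  have A: "?A = {0..real n} \<inter> ?W" using cover_eq_glue[OF n] by auto
  have "open ?W \<longleftrightarrow> openin (top_of_set {0..real n}) ?A"
  proof
    assume "open ?W"
    then show "openin (top_of_set {0..real n}) ?A" unfolding A by (rule openin_open_Int)
  next
    assume "openin (top_of_set {0..real n}) ?A"
    then have "closedin (top_of_set {0..real n}) ({0..real n} - ?A)" by (simp add: openin_closedin_eq)
    then have cl: "compact ({0..real n} - ?A)" by (rule closedin_compact[OF compact_Icc])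
    let ?Z = "(\<lambda>x. real n *\<^sub>R x) ` (\<int> :: real set)"
    have "closed ?Z" by (intro closed_scaling closed_Ints)
    with cl have "closed (\<Union>x\<in>{0..real n} - ?A. \<Union>y\<in>?Z. {x + y})" by (rule compact_closed_sums)
    moreover have "(\<Union>x\<in>{0..real n} - ?A. \<Union>y\<in>?Z. {x + y}) = - ?W"
    proof (intro equalityI subsetI)
      fix z assume "z \<in> (\<Union>x\<in>{0..real n} - ?A. \<Union>y\<in>?Z. {x + y})"
      then obtain x y where "x \<in> {0..real n} - ?A" "y \<in> ?Z" "z = x + y" by blast
      then obtain k where "x \<in> {0..real n} - ?A" "k \<in> \<int>" "z = x + real n * k" by auto
      then show "z \<in> - ?W" unfolding A using cover_shift[OF n, of x] by (auto elim!: Ints_cases)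
    next
      fix z assume z: "z \<in> - ?W"
      let ?x = "z - real n * of_int \<lfloor>z / real n\<rfloor>"
      have zx: "z = ?x + real n * of_int \<lfloor>z / real n\<rfloor>" by simp
      have "?x \<in> {0..real n}" using residue_bounds[OF n, of z] by simp
      moreover have "cover n ?x \<notin> U" using z cover_shift[OF n, of ?x "\<lfloor>z / real n\<rfloor>"] by simp
      ultimately have x: "?x \<in> {0..real n} - ?A" unfolding A by blast
      have "real n * of_int \<lfloor>z / real n\<rfloor> \<in> ?Z" by (intro image_eqI[of _ _ "of_int \<lfloor>z / real n\<rfloor>"]) auto
      then show "z \<in> (\<Union>x\<in>{0..real n} - ?A. \<Union>y\<in>?Z. {x + y})" using x zx by blast
    qed
    ultimately have "closed (- ?W)" by (simp only:)
    then show "open ?W" by (simp add: closed_def)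
  qed
  then show "openin euclideanreal {x \<in> topspace euclideanreal. cover n x \<in> U} = openin (circle n) U"
    using circ by simp
qed

lemma circle_dyadic_cover: assumes n: "n > 0" shows "circle_dyadic (cover n x) \<longleftrightarrow> x \<in> dyad"
proof -
  let ?u = "x - real n * of_int \<lfloor>x / real n\<rfloor>"
  have nd: "real n * of_int k \<in> dyad" for k using dyad_of_int[of "int n * k"] by simp
  have u: "?u \<in> dyad \<longleftrightarrow> x \<in> dyad" using dyad_diff[OF _ nd, of x] dyad_add[OF _ nd, of ?u "\<lfloor>x / real n\<rfloor>"] by auto
  show ?thesis
  proof
    assume "circle_dyadic (cover n x)"
    moreover have "?u \<in> cover n x" by (simp add: cover_def glue_def)
    ultimately show "x \<in> dyad" using u dyadics_dyad by (auto simp: circle_dyadic_def)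
  next
    assume "x \<in> dyad"
    then have "?u \<in> dyadics" using u residue_bounds(1)[OF n] by (intro dyad_nonneg) auto
    moreover have "(0::real) \<in> dyadics" "real n \<in> dyadics" using real_in_dyadics[of 0] by simp_all
    ultimately show "circle_dyadic (cover n x)" by (simp add: circle_dyadic_def cover_def glue_def)
  qed
qed

section \<open>Lifts of circle maps\<close>

text \<open>\<open>SOME\<close> picks a point of the fibre; for periodic \<open>g\<close> the result
  is independent of the choice.\<close>

definition descend :: "nat \<Rightarrow> (real \<Rightarrow> real) \<Rightarrow> real set \<Rightarrow> real set" where
  "descend n g = (\<lambda>p\<in>topspace (circle n). cover n (g (SOME x. cover n x = p)))"

lemma descend_cover:
  assumes n: "n > 0" and g: "g \<in> periodic_PL n" shows "descend n g (cover n x) = cover n (g x)"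
proof -
  define y where "y = (SOME y. cover n y = cover n x)"
  have "cover n y = cover n x" unfolding y_def by (rule someI[of _ x]) simp
  then obtain k where "x = y + real n * of_int k" using cover_eq_iff[OF n] by blast
  then have "cover n (g x) = cover n (g y)" using periodic_PL_shift[OF g] cover_shift[OF n] by simp
  then show ?thesis using n by (simp add: descend_def y_def)
qed

lemma descend_unique:
  assumes n: "n > 0" and g: "g \<in> periodic_PL n" and f: "f \<in> extensional (topspace (circle n))"
    and eq: "\<And>x. f (cover n x) = cover n (g x)"
  shows "descend n g = f"
proof
  fix p show "descend n g p = f p"
  proof (cases "p \<in> topspace (circle n)")
    case True
    then show ?thesis using circle_cases[OF n] descend_cover[OF n g] eq by metis
  next
    case False
    then show ?thesis using f by (simp add: descend_def extensional_def)
  qed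
qed

lemma descend_continuous:
  assumes n: "n > 0" and g: "g \<in> periodic_PL n" shows "continuous_map (circle n) (circle n) (descend n g)"
proof (rule continuous_compose_quotient_map[OF quotient_map_cover[OF n]])
  have "g \<in> dyad_PL" using g by (rule periodic_PL_dyad_PL)
  then have "continuous_map euclideanreal euclideanreal g"
    using strict_mono_surj_continuous dyad_PL_strict_mono dyad_PL_surj by auto
  then have "continuous_map euclideanreal (circle n) (cover n \<circ> g)"
    using quotient_imp_continuous_map[OF quotient_map_cover[OF n]] by (rule continuous_map_compose)
  moreover have "descend n g \<circ> cover n = cover n \<circ> g" by (simp add: fun_eq_iff descend_cover[OF n g])
  ultimately show "continuous_map euclideanreal (circle n) (descend n g \<circ> cover n)" by simp
qed

lemma descend_homeo:
  assumes n: "n > 0" and g: "g \<in> periodic_PL n" shows "descend n g \<in> carrier (homeo_group (circle n))"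
proof -
  have gi: "inv_into UNIV g \<in> periodic_PL n" by (rule subgroup_Homeo_inv[OF subgroup_periodic_PL g])
  have m: "strict_mono g" "surj g" using g by (auto simp: periodic_PL_def dyad_PL_strict_mono dyad_PL_surj)
  have "descend n (inv_into UNIV g) (descend n g p) = p \<and> descend n g (descend n (inv_into UNIV g) p) = p"
    if p: "p \<in> topspace (circle n)" for p
  proof -
    obtain x where "p = cover n x" using circle_cases[OF n p] by blast
    then show ?thesis by (simp add: descend_cover[OF n g] descend_cover[OF n gi] inv_strict_mono_surj[OF m])
  qed
  then have "homeomorphic_maps (circle n) (circle n) (descend n g) (descend n (inv_into UNIV g))"
    using descend_continuous[OF n g] descend_continuous[OF n gi] by (auto simp: homeomorphic_maps_def)
  then show ?thesis by (auto simp: homeo_group_carrier homeomorphic_map_maps descend_def)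
qed

lemma descend_comp:
  assumes n: "n > 0" and g: "g \<in> periodic_PL n" and h: "h \<in> periodic_PL n"
  shows "descend n (g \<circ> h) = compose (topspace (circle n)) (descend n g) (descend n h)"
proof (rule descend_unique[OF n])
  show "g \<circ> h \<in> periodic_PL n" using g h by (rule subgroup_Homeo_comp[OF subgroup_periodic_PL])
  show "compose (topspace (circle n)) (descend n g) (descend n h) (cover n x) = cover n ((g \<circ> h) x)" for x
    using n by (simp add: compose_def descend_cover[OF n g] descend_cover[OF n h])
qed (simp add: compose_def)

text \<open>The difference takes values in the multiples of \<open>n\<close>, and continuity keeps
  it from jumping to another one.\<close>

lemma lifts_differ_by_constant:
  assumes n: "n > 0" and ev: "\<forall>\<^sub>F y in nhds x. cover n (h y) = cover n (g y)" and "isCont h x" "isCont g x"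
  shows "\<exists>c. \<forall>\<^sub>F y in nhds x. g y = h y + c"
proof -
  define D where "D y = g y - h y" for y
  have "isCont D x" unfolding D_def using assms by (intro continuous_intros)
  then have "filterlim D (nhds (D x)) (nhds x)" by (simp add: isCont_def tendsto_at_iff_tendsto_nhds)
  then have lim: "\<forall>\<^sub>F y in nhds x. dist (D y) (D x) < real n" using n by (intro tendstoD) auto
  have cx: "cover n (h x) = cover n (g x)" using ev by (rule eventually_nhds_x_imp_x)
  have "\<forall>\<^sub>F y in nhds x. g y = h y + D x"
    using ev lim
  proof eventually_elim
    case (elim y)
    obtain k where k: "g y = h y + real n * of_int k" using elim(1) cover_eq_iff[OF n] by blast
    obtain l where l: "g x = h x + real n * of_int l" using cx cover_eq_iff[OF n] by blast
    have "\<bar>real n * of_int (k - l)\<bar> < real n" using elim(2) k l by (simp add: D_def dist_real_def algebra_simps)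
    then have "real n * \<bar>of_int (k - l)\<bar> < real n * 1" by (simp add: abs_mult)
    then have "\<bar>of_int (k - l) :: real\<bar> < 1" using n by (simp only: mult_less_cancel_left_pos of_nat_0_less_iff)
    then have "k = l" by linarith
    then show ?case using k l by (simp add: D_def)
  qed
  then show ?thesis by blast
qed

text \<open>A derivative on the circle is witnessed by some local lift, which differs from
  \<open>g\<close> by a constant near the chosen point.\<close>

lemma circle_derivative_lift:
  assumes n: "n > 0" and g: "continuous_on UNIV g" and fg: "\<And>x. f (cover n x) = cover n (g x)"
    and d: "has_circle_derivative n f d p"
  shows "\<exists>x. cover n x = p \<and> (g has_real_derivative d) (at x)"
proof -
  obtain x h where x: "cover n x = p" and ev: "\<forall>\<^sub>F y in nhds x. cover n (h y) = f (cover n y)"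
    and h: "(h has_real_derivative d) (at x)" using d unfolding has_circle_derivative_def by blast
  have "isCont h x" using h by (rule DERIV_isCont)
  moreover have "isCont g x" using g by (simp add: continuous_on_eq_continuous_at)
  ultimately obtain c where c: "\<forall>\<^sub>F y in nhds x. g y = h y + c"
    using lifts_differ_by_constant[OF n ev[unfolded fg]] by blast
  have "((\<lambda>y. h y + c) has_real_derivative d) (at x)" using h by (auto intro!: derivative_eq_intros)
  then have "(g has_real_derivative d) (at x)" using DERIV_cong_ev[OF refl c refl] by blast
  then show ?thesis using x by blast
qed

lemma has_circle_derivativeI:
  assumes "\<And>x. f (cover n x) = cover n (g x)" "(g has_real_derivative d) (at x)"
  shows "has_circle_derivative n f d (cover n x)"
  unfolding has_circle_derivative_def using assms by (intro exI[of _ x] exI[of _ g]) auto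

section \<open>Periodic maps of the line as lifts of the elements of \<open>T(n)\<close>\<close>

lemma descend_thompson_T:
  assumes n: "n > 0" and g: "g \<in> periodic_PL n" shows "descend n g \<in> thompson_T n"
proof -
  note fg = descend_cover[OF n g]
  have PL: "g \<in> dyad_PL" using g by (rule periodic_PL_dyad_PL)
  note m = dyad_PL_strict_mono[OF PL] dyad_PL_surj[OF PL]
  have cont: "continuous_on UNIV g" by (rule strict_mono_surj_continuous[OF m])
  have brk: "x \<in> breaks g" if "\<nexists>d. has_circle_derivative n (descend n g) d (cover n x)" for x
    using that dyad_PL_differentiable[OF PL, of x] has_circle_derivativeI[of "descend n g", OF fg] by blast
  have "cover n (g x) = descend n g (glue n x)" if "x \<in> {0..real n}" for x
    using fg[of x] cover_eq_glue[OF n that] by simp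
  then have "circle_lift n (descend n g) g"
    unfolding circle_lift_def using continuous_on_subset[OF cont] by blast
  moreover have "strict_mono_on {0..real n} g" using m(1) by (auto simp: strict_mono_on_def strict_mono_def)
  moreover have "piecewise_linear 0 (real n) g" by (rule piecewise_linear_dyad_PL[OF PL]) simp
  moreover have "finite {p \<in> topspace (circle n). \<nexists>d. has_circle_derivative n (descend n g) d p}"
  proof (rule finite_subset)
    show "finite (cover n ` ({0..real n} \<inter> breaks g))" using finite_breaks[OF PL] by blast
    show "{p \<in> topspace (circle n). \<nexists>d. has_circle_derivative n (descend n g) d p} \<subseteq> cover n ` ({0..real n} \<inter> breaks g)"
    proof
      fix p assume p: "p \<in> {p \<in> topspace (circle n). \<nexists>d. has_circle_derivative n (descend n g) d p}"
      then obtain x where "x \<in> {0..real n}" "p = cover n x" using circle_cases[OF n] by blast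
      then show "p \<in> cover n ` ({0..real n} \<inter> breaks g)" using brk[of x] p by blast
    qed
  qed
  moreover have "\<exists>k::int. d = 2 powi k" if d: "has_circle_derivative n (descend n g) d p" for p d
  proof -
    obtain x where "(g has_real_derivative d) (at x)" using circle_derivative_lift[OF n cont fg d] by blast
    then show ?thesis by (rule dyad_PL_DERIV_right[OF PL has_field_derivative_at_within])
  qed
  moreover have "circle_dyadic p \<and> circle_dyadic (descend n g p)"
    if p: "p \<in> topspace (circle n)" and d: "\<nexists>d. has_circle_derivative n (descend n g) d p" for p
  proof -
    obtain x where x: "p = cover n x" using circle_cases[OF n p] by blast
    then have "x \<in> dyad" using brk[of x] d breaks_subset_dyad[OF PL] by blast
    then show ?thesis unfolding x fg circle_dyadic_cover[OF n] using dyad_PL_dyad[OF PL] by simp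
  qed
  moreover have "circle_dyadic (descend n g (glue n 0))"
    using cover_eq_glue[OF n, of 0, symmetric] dyad_PL_dyad[OF PL, of 0] by (simp add: fg circle_dyadic_cover[OF n])
  ultimately show ?thesis unfolding thompson_T_def using descend_homeo[OF n g] by blast
qed

text \<open>A lift on \<open>[0, n]\<close> has degree one and hence extends periodically. Slopes
  and differentiability pass between circle and line through \<open>cover\<close>, and
  \<open>dyad_PL_of_slopes\<close> supplies the dyadic constants.\<close>

lemma thompson_T_lift:
  assumes n: "n > 0" and f: "f \<in> thompson_T n"
  shows "\<exists>g\<in>periodic_PL n. descend n g = f"
proof -
  have fC: "f \<in> extensional (topspace (circle n))" "homeomorphic_map (circle n) (circle n) f"
    using f by (auto simp: thompson_T_def homeo_group_carrier)
  obtain g where lift: "circle_lift n f g" and mono: "strict_mono_on {0..real n} g" and pl: "piecewise_linear 0 (real n) g"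
    using f unfolding thompson_T_def by blast
  have cont: "continuous_on {0..real n} g" and cg: "\<And>x. x \<in> {0..real n} \<Longrightarrow> cover n (g x) = f (cover n x)"
    using lift cover_eq_glue[OF n] by (auto simp: circle_lift_def)
  have n0: "(0::real) < real n" using n by simp
  \<comment> \<open>Monotonicity makes the degree \<open>k\<close> positive; \<open>k > 1\<close>
    would give an inner point with the same image on the circle as 0, against injectivity.\<close>
  have gn: "g (real n) = g 0 + real n"
  proof -
    have "cover n (real n) = cover n 0" using cover_shift[OF n, of 0 1] by simp
    then have "cover n (g 0) = cover n (g (real n))" using cg[of 0] cg[of "real n"] n by simp
    then obtain k where k: "g (real n) = g 0 + real n * of_int k" using cover_eq_iff[OF n] by blast
    have "g 0 < g (real n)" using mono n0 by (auto simp: strict_mono_on_def)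
    then have "0 < real n * of_int k" using k by simp
    then have k1: "k \<ge> 1" using n0 by (simp add: zero_less_mult_iff)
    have "\<not> k > 1"
    proof
      assume "k > 1"
      then have "real n * 1 < real n * of_int k" using n0 by (intro mult_strict_left_mono) auto
      then have lt: "g 0 + real n < g (real n)" using k by simp
      obtain x where x: "0 \<le> x" "x \<le> real n" "g x = g 0 + real n"
        using IVT'[of g 0 "g 0 + real n" "real n"] lt n0 cont by auto
      have "x \<noteq> 0" "x \<noteq> real n" using x(3) lt n0 by auto
      have "cover n (g x) = cover n (g 0)" using x(3) cover_shift[OF n, of "g 0" 1] by simp
      then have "f (cover n x) = f (cover n 0)" using cg[of x] cg[of 0] x(1,2) n0 by simp
      moreover have "inj_on f (topspace (circle n))" using fC(2) homeomorphic_imp_injective_map by blast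
      ultimately have "cover n 0 = cover n x" using n by (auto dest: inj_onD)
      then obtain l where l: "x = real n * of_int l" using cover_eq_iff[OF n] by force
      have "0 < x" "x < real n" using x(1,2) \<open>x \<noteq> 0\<close> \<open>x \<noteq> real n\<close> by auto
      then have "0 < real n * of_int l" "real n * of_int l < real n * 1" unfolding l by simp_all
      then have "0 < (of_int l :: real)" "(of_int l :: real) < 1"
        using n0 by (simp_all only: zero_less_mult_iff mult_less_cancel_left_pos) auto
      then show False by simp
    qed
    then show ?thesis using k k1 by simp
  qed
  define G where "G x = g (x - real n * of_int \<lfloor>x / real n\<rfloor>) + real n * of_int \<lfloor>x / real n\<rfloor>" for x
  have Gshift: "G (x + real n * of_int k) = G x + real n * of_int k" for x k
  proof -
    have "(x + real n * of_int k) / real n = x / real n + of_int k" using n0 by (simp add: field_simps)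
    then show ?thesis by (simp add: G_def algebra_simps)
  qed
  have Gg: "G x = g x" if "x \<in> {0..real n}" for x
  proof (cases "x = real n")
    case True
    then show ?thesis using n0 gn by (simp add: G_def)
  next
    case False
    then have "\<lfloor>x / real n\<rfloor> = 0" using that by (simp add: floor_eq_iff)
    then show ?thesis by (simp add: G_def)
  qed
  have Gf: "f (cover n x) = cover n (G x)" for x
  proof -
    let ?u = "x - real n * of_int \<lfloor>x / real n\<rfloor>"
    have "cover n (G x) = cover n (g ?u)" unfolding G_def by (rule cover_shift[OF n])
    also have "\<dots> = f (cover n ?u)" using residue_bounds[OF n, of x] by (intro cg) auto
    also have "cover n ?u = cover n x" using cover_shift[OF n, of ?u "\<lfloor>x / real n\<rfloor>"] by simp
    finally show ?thesis by simp
  qed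
  have Gmono: "strict_mono G"
  proof (rule strict_monoI)
    fix x y :: real assume xy: "x < y"
    let ?k = "\<lfloor>x / real n\<rfloor>" and ?l = "\<lfloor>y / real n\<rfloor>"
    note bx = residue_bounds[OF n, of x] and by' = residue_bounds[OF n, of y]
    have gm: "g u < g v" if "0 \<le> u" "u < v" "v \<le> real n" for u v using that mono by (auto simp: strict_mono_on_def)
    have "?k \<le> ?l" using xy n0 by (intro floor_mono divide_right_mono) auto
    then consider "?k = ?l" | "?k < ?l" by linarith
    then show "G x < G y"
    proof cases
      case 1
      have "g (x - real n * of_int ?k) < g (y - real n * of_int ?k)"
        using bx by' 1 xy by (intro gm) auto
      then show ?thesis using 1 by (simp add: G_def)
    next
      case 2
      have "g (x - real n * of_int ?k) < g (real n)" using bx by (intro gm) auto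
      moreover have "g 0 \<le> g (y - real n * of_int ?l)"
        using gm[of 0 "y - real n * of_int ?l"] by' by (cases "y - real n * of_int ?l = 0") auto
      moreover have "real n * (of_int ?k + 1) \<le> real n * of_int ?l" using 2 n0 by (intro mult_left_mono) linarith+
      ultimately show ?thesis unfolding G_def gn by (simp add: algebra_simps)
    qed
  qed
  have Gsurj: "surj G"
    unfolding surj_def
  proof
    fix y
    let ?k = "\<lfloor>(y - g 0) / real n\<rfloor>"
    note b = residue_bounds[OF n, of "y - g 0"]
    have "g 0 \<le> y - real n * of_int ?k" "y - real n * of_int ?k \<le> g (real n)" using b gn by auto
    then obtain x where x: "0 \<le> x" "x \<le> real n" "g x = y - real n * of_int ?k"
      using IVT'[of g 0 _ "real n"] n0 cont by auto
    then have "G (x + real n * of_int ?k) = y" using Gshift[of x ?k] Gg[of x] by simp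
    then show "\<exists>x. y = G x" by metis
  qed
  have Gcont: "continuous_on UNIV G" by (rule strict_mono_surj_continuous[OF Gmono Gsurj])
  have pow: "\<exists>k::int. d = 2 powi k" if "has_circle_derivative n f d p" "p \<in> topspace (circle n)" for d p
    using f that unfolding thompson_T_def by blast
  have slope: "\<exists>k::int. m = 2 powi k" if uv: "0 \<le> u" "u < v" "v \<le> real n" "\<forall>t\<in>{u..v}. g t = m * t + c" for u v m c
  proof -
    obtain y where y: "u < y" "y < v" using dense[OF uv(2)] by blast
    have "((\<lambda>t. m * t + c) has_real_derivative m) (at y)" by (auto intro!: derivative_eq_intros)
    then have "(G has_real_derivative m) (at y)"
      by (rule has_field_derivative_transform_within_open[of _ _ _ "{u<..<v}"])
        (use y uv Gg in auto)
    from has_circle_derivativeI[of f, OF Gf this] show ?thesis using pow n by simp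
  qed
  have "G \<in> dyad_PL"
  proof (rule dyad_PL_of_slopes[OF Gmono Gsurj])
    fix x
    show "\<exists>k c. \<forall>\<^sub>F y in at_right x. G y = 2 powi k * y + c"
    proof -
      let ?i = "\<lfloor>x / real n\<rfloor>"
      let ?N = "real n * of_int ?i"
      define u where "u = x - ?N"
      have u: "0 \<le> u" "u < real n" unfolding u_def by (rule residue_bounds[OF n])+
      obtain m c v where v: "u < v" "v \<le> real n" "\<forall>t\<in>{u..v}. g t = m * t + c"
        using piecewise_linear_right[OF pl u] by blast
      obtain k where k: "m = 2 powi k" using slope[OF u(1) v] by blast
      have "G y = 2 powi k * y + (c + ?N - 2 powi k * ?N)" if "x < y" "y < v + ?N" for y
      proof -
        have "G y = G (y - ?N) + ?N" using Gshift[of "y - ?N" ?i] by simp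
        also have "G (y - ?N) = g (y - ?N)" using that u v by (intro Gg) (auto simp: u_def)
        also have "g (y - ?N) = m * (y - ?N) + c" using that v by (auto simp: u_def)
        finally show ?thesis by (simp add: k algebra_simps)
      qed
      moreover have "x < v + ?N" using v by (simp add: u_def)
      ultimately show ?thesis unfolding eventually_at_right_field by blast
    qed
    show "\<exists>k c. \<forall>\<^sub>F y in at_left x. G y = 2 powi k * y + c"
    proof -
      \<comment> \<open>The ceiling of \<open>x / n\<close> minus 1: now \<open>u\<close> lies in
        \<open>(0, n]\<close> instead of \<open>[0, n)\<close> and has room on its left.\<close>
      let ?i = "- \<lfloor>- x / real n\<rfloor> - 1"
      let ?N = "real n * of_int ?i"
      define u where "u = x - ?N"
      have u: "0 < u" "u \<le> real n" using residue_bounds[OF n, of "- x"] by (simp_all add: u_def algebra_simps)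
      obtain m c v where v: "v < u" "0 \<le> v" "\<forall>t\<in>{v..u}. g t = m * t + c"
        using piecewise_linear_left[OF pl u] by blast
      obtain k where k: "m = 2 powi k" using slope[OF v(2,1) u(2) v(3)] by blast
      have "G y = 2 powi k * y + (c + ?N - 2 powi k * ?N)" if "v + ?N < y" "y < x" for y
      proof -
        have "G y = G (y - ?N) + ?N" using Gshift[of "y - ?N" ?i] by simp
        also have "G (y - ?N) = g (y - ?N)" using that u v by (intro Gg) (auto simp: u_def)
        also have "g (y - ?N) = m * (y - ?N) + c" using that v by (auto simp: u_def)
        finally show ?thesis by (simp add: k algebra_simps)
      qed
      moreover have "v + ?N < x" using v by (simp add: u_def)
      ultimately show ?thesis unfolding eventually_at_left_field by blast
    qed
    show "\<exists>d. (G has_real_derivative d) (at x)" if x: "x \<notin> dyad"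
    proof -
      have "\<not> circle_dyadic (cover n x)" using x circle_dyadic_cover[OF n] by simp
      moreover have "\<forall>p \<in> topspace (circle n). (\<nexists>d. has_circle_derivative n f d p) \<longrightarrow>
          circle_dyadic p \<and> circle_dyadic (f p)"
        using f unfolding thompson_T_def by blast
      ultimately obtain d where "has_circle_derivative n f d (cover n x)"
        using cover_in_circle[OF n] by blast
      from circle_derivative_lift[OF n Gcont Gf this]
      obtain z where z: "cover n z = cover n x" "(G has_real_derivative d) (at z)" by blast
      \<comment> \<open>The derivative is found at some point \<open>z\<close> of the fibre of
        \<open>x\<close>; periodicity carries it to \<open>x\<close>.\<close>
      then obtain k where k: "x = z + real n * of_int k" using cover_eq_iff[OF n] by blast
      let ?N = "real n * of_int k"
      have "((\<lambda>y. y - ?N) has_real_derivative 1) (at x)" by (auto intro!: derivative_eq_intros)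
      moreover have "(G has_real_derivative d) (at (x - ?N))" using z(2) k by simp
      ultimately have "((\<lambda>y. G (y - ?N)) has_real_derivative d * 1) (at x)" by (rule DERIV_chain2[rotated])
      then have "((\<lambda>y. G (y - ?N) + ?N) has_real_derivative d) (at x)" by (auto intro!: derivative_eq_intros)
      moreover have "(\<lambda>y. G (y - ?N) + ?N) = G"
      proof
        fix y show "G (y - ?N) + ?N = G y" using Gshift[of "y - ?N" k] by simp
      qed
      ultimately show ?thesis by auto
    qed
    show "(0::real) \<in> dyad" by simp
    \<comment> \<open>The dyadic image of 0 is the starting point for the propagation of dyadic
      constants.\<close>
    have "circle_dyadic (f (glue n 0))" using f by (simp add: thompson_T_def)
    then have "circle_dyadic (cover n (G 0))" using Gf[of 0] cover_eq_glue[OF n, of 0] by simp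
    then show "G 0 \<in> dyad" by (simp add: circle_dyadic_cover[OF n])
  qed
  then have "G \<in> periodic_PL n" using Gshift[of _ 1] by (simp add: periodic_PL_def)
  moreover from this have "descend n G = f" by (rule descend_unique[OF n _ fC(1) Gf])
  ultimately show ?thesis by blast
qed

text \<open>Stated for any group with carrier \<open>periodic_PL n\<close> and this product, so that
  it applies to a generated subgroup. A lift of the identity moves each point by a multiple of
  \<open>n\<close>, and monotonicity makes the displacement constant.\<close>

theorem periodic_PL_short_exact:
  assumes n: "n > 0" and B: "group B" "carrier B = periodic_PL n" "\<And>g h. g \<otimes>\<^bsub>B\<^esub> h = h \<circ> g"
  shows "short_exact integer_group B (T_group n) (\<lambda>k x. x + real n * of_int k) (descend n)"
proof -
  let ?j = "\<lambda>(k::int) x. x + real n * of_int k"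
  interpret B: group B by (rule B(1))
  interpret C: group "homeo_group (circle n)" by (rule group_homeo_group)
  have hom: "descend n \<in> hom B (homeo_group (circle n))"
    by (auto simp: hom_def B descend_homeo[OF n] homeo_group_mult descend_comp[OF n])
  interpret h: group_hom B "homeo_group (circle n)" "descend n"
    using hom by unfold_locales
  have img: "descend n ` carrier B = thompson_T n"
    unfolding B using descend_thompson_T[OF n] thompson_T_lift[OF n] by blast
  have "subgroup (thompson_T n) (homeo_group (circle n))" using h.img_is_subgroup img by simp
  then have T: "group (T_group n)" unfolding T_group_def by (rule C.subgroup_imp_group)
  have epi: "descend n \<in> epi B (T_group n)"
    using hom img by (auto simp: epi_def hom_def T_group_def)
  have j: "?j k \<in> periodic_PL n" for k
  proof -
    have "real n * of_int k \<in> dyad" using dyad_of_int[of "int n * k"] by simp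
    then show ?thesis by (simp add: periodic_PL_def dyad_PL_translation)
  qed
  have mon: "?j \<in> mon integer_group B"
    using j n by (auto simp: mon_def hom_def B inj_on_def fun_eq_iff algebra_simps)
  have "?j ` carrier integer_group = kernel B (T_group n) (descend n)"
  proof (intro equalityI subsetI)
    fix g assume "g \<in> ?j ` carrier integer_group"
    then obtain k where g: "g = ?j k" by auto
    have "descend n g = (\<lambda>p\<in>topspace (circle n). p)"
      unfolding g using n by (intro descend_unique[OF n j]) (simp_all add: cover_shift)
    then show "g \<in> kernel B (T_group n) (descend n)"
      using j g by (simp add: kernel_def B T_group_def homeo_group_one)
  next
    fix g assume "g \<in> kernel B (T_group n) (descend n)"
    then have g: "g \<in> periodic_PL n" and id: "descend n g = (\<lambda>p\<in>topspace (circle n). p)"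
      by (auto simp: kernel_def B T_group_def homeo_group_one)
    have ex: "\<exists>k::int. g x = x + real n * of_int k" for x
    proof -
      have "cover n (g x) = cover n x" using descend_cover[OF n g, of x] id n by simp
      then show ?thesis using cover_eq_iff[OF n] by metis
    qed
    obtain k0 where k0: "g 0 = real n * of_int k0" using ex[of 0] by auto
    have gm: "strict_mono g" using g by (simp add: periodic_PL_def dyad_PL_strict_mono)
    have gn: "g (0 + real n) = g 0 + real n" using g unfolding periodic_PL_def by blast
    have "g = ?j k0"
    proof (rule periodic_PL_eqI[OF g j n, of 0])
      fix x assume x: "0 \<le> x" "x < 0 + real n"
      obtain k where k: "g x = x + real n * of_int k" using ex by blast
      have "g 0 \<le> g x" "g x < g (0 + real n)" using x gm by (simp_all add: strict_mono_less_eq strict_mono_less)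
      \<comment> \<open>By \<open>g 0 \<le> g x < g 0 + n\<close> and \<open>0 \<le> x < n\<close>
        the two multiples of \<open>n\<close> differ by less than \<open>n\<close>.\<close>
      then have "real n * of_int k0 < real n * of_int (k + 1)" "real n * of_int k < real n * of_int (k0 + 1)"
        using x k k0 gn by (simp_all add: algebra_simps)
      then have "k0 < k + 1" "k < k0 + 1" using n by (simp_all only: mult_less_cancel_left_pos of_nat_0_less_iff of_int_less_iff)
      then show "g x = x + real n * of_int k0" using k by simp
    qed
    then show "g \<in> ?j ` carrier integer_group" by auto
  qed
  then show ?thesis
    unfolding short_exact_def using B(1) T mon epi group_integer_group by blast
qed

section \<open>The generators of \<open>G\<^sub>\<sigma>\<close>\<close>

text \<open>Moves \<open>[0,1]\<close> to \<open>[-1/2, 1/2]\<close>, where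
  \<open>t \<mapsto> 1 - t\<close> becomes \<open>t \<mapsto> - t\<close>, so that
  \<open>flip_conj\<close> turns into \<open>twist (- 1)\<close>.\<close>

definition recenter :: "(real \<Rightarrow> real) \<Rightarrow> real \<Rightarrow> real" where
  "recenter F t = F (t + 1/2) - 1/2"

definition letter_sign :: "(real \<Rightarrow> letter) \<Rightarrow> int \<Rightarrow> int" where
  "letter_sign \<sigma> m = (if \<sigma> (of_int m / 2) \<in> {La, Lb} then 1 else - 1)"

lemma recenter_PL_on: assumes "F \<in> dyad_PL_on 0 1" shows "recenter F \<in> dyad_PL_on (- (1/2)) (1/2)"
proof -
  have e: "recenter F = (\<lambda>x. x + - (1/2)) \<circ> (F \<circ> (\<lambda>x. x + 1/2))" by (simp add: recenter_def fun_eq_iff)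
  have "recenter F \<in> dyad_PL" unfolding e using assms
    by (intro dyad_PL_comp dyad_PL_translation dyad_uminus) (auto simp: dyad_PL_on_def)
  moreover have "recenter F t = t" if "t \<notin> {- (1/2)..1/2}" for t
  proof -
    have "t + 1/2 \<notin> {0..1}" using that by auto
    then show ?thesis using assms unfolding recenter_def dyad_PL_on_def by simp
  qed
  ultimately show ?thesis by (simp add: dyad_PL_on_def)
qed

lemma recenter_comp: "recenter (F \<circ> G) = recenter F \<circ> recenter G"
  by (simp add: recenter_def fun_eq_iff)

lemma unit_map_comp:
  assumes "f \<in> dyad_PL_on (- (1/2)) (1/2)" "g \<in> dyad_PL_on (- (1/2)) (1/2)"
  shows "unit_map c V (f \<circ> g) = unit_map c V f \<circ> unit_map c V g"
  unfolding unit_map_def using assms by (intro blocks_comp) auto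

lemma unit_map_id: "unit_map c V id = id"
  by (simp add: unit_map_def blocks_id)

lemma unit_map_parity:
  assumes h: "h \<in> dyad_PL_on (- (1/2)) (1/2)" and c: "even (c - c')"
  shows "unit_map c V h = unit_map c' V h"
proof
  fix x
  define p where "p = (of_int c - 1) / (2::real)"
  obtain i t where it: "x = center (1/2) p i + t" "- (1/2) \<le> t" "t < 1/(2::real)" using block_cases[of "1/2" x p] by auto
  define m where "m = 2 * i + c"
  have "center (1/2) p i = of_int m / 2" unfolding center_def m_def p_def by (simp add: field_simps)
  then have x: "x = of_int m / 2 + t" using it by simp
  have "m - c' = 2 * i + (c - c')" by (simp add: m_def)
  then have "even (m - c)" "even (m - c')" using c by (simp_all add: m_def)
  then show "unit_map c V h x = unit_map c' V h x" unfolding x using it by (simp add: unit_map_eq[OF h])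
qed

lemma unit_map_periodic:
  assumes h: "h \<in> dyad_PL_on (- (1/2)) (1/2)" and V: "\<And>i. V (i + 2 * int n) = V i"
  shows "unit_map c V h \<in> periodic_PL n"
proof -
  have "(of_int c - 1) / 2 \<in> dyad" using dyad_half_int[of "c - 1"] by simp
  then have "unit_map c V h \<in> dyad_PL" unfolding unit_map_def using h by (intro blocks_dyad_PL) auto
  moreover have "V (2 * (i + int n) + c) = V (2 * i + c)" for i
    using V[of "2 * i + c"] by (simp add: algebra_simps)
  then have "unit_map c V h (x + real n) = unit_map c V h x + real n" for x
    unfolding unit_map_def using blocks_periodic[of "1/2" h "\<lambda>i. V (2 * i + c)" "int n" _ x] h by simp
  ultimately show ?thesis by (simp add: periodic_PL_def)
qed

section \<open>The generators as block maps\<close>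

lemma flip_conj_eq:
  assumes "f ` {0..1} \<subseteq> {0..1}" "t \<in> {0..1}" shows "flip_conj f t = 1 - f (1 - t)"
proof -
  have "1 - t \<in> {0..1}" using assms(2) by simp
  then have "f (1 - t) \<in> {0..1}" using assms(1) by blast
  then show ?thesis using assms(2) by (simp add: flip_conj_def homeo_group_mult compose_def flip_def)
qed

lemma labelling_odd: assumes "labelling \<sigma>" shows "\<sigma> (of_int i + 1/2) \<in> {Lb, Lb_inv}"
proof -
  have e: "of_int (2 * i + 1) / 2 = (of_int i + 1/2 :: real)" by (simp add: field_simps)
  have "of_int i + 1/2 \<in> half_integers" unfolding half_integers_def e[symmetric] by blast
  moreover have "of_int i + 1/2 \<notin> (\<int> :: real set)"
  proof
    assume "of_int i + 1/2 \<in> (\<int> :: real set)"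
    then obtain k where "of_int i + 1/2 = (of_int k :: real)" by (auto elim: Ints_cases)
    then have "of_int (2 * i + 1) = (of_int (2 * k) :: real)" by simp
    then have "2 * i + 1 = 2 * k" by (simp only: of_int_eq_iff)
    then show False by presburger
  qed
  ultimately show ?thesis using assms by (simp add: labelling_def)
qed

lemma letter_sign_odd:
  assumes "labelling \<sigma>" shows "letter_sign \<sigma> (2 * i + 1) = (if \<sigma> (of_int i + 1/2) = Lb then 1 else - 1)"
proof -
  have e: "of_int (2 * i + 1) / 2 = (of_int i + 1/2 :: real)" by (simp add: field_simps)
  show ?thesis unfolding letter_sign_def e using labelling_odd[OF assms, of i] by auto
qed

lemma letter_sign_even:
  assumes "labelling \<sigma>" shows "letter_sign \<sigma> (2 * i) = (if \<sigma> (of_int i) = La then 1 else - 1)"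
proof -
  have "\<sigma> (of_int i) \<in> {La, La_inv}" using assms by (simp add: labelling_def)
  then show ?thesis unfolding letter_sign_def by auto
qed

lemma zeta_unit_map:
  assumes \<sigma>: "labelling \<sigma>" and \<nu>: "\<nu> ` {0..1} \<subseteq> {0..1}"
  shows "zeta \<sigma> \<nu> = unit_map 1 (letter_sign \<sigma>) (recenter (extend_I \<nu>))" (is "_ = unit_map 1 ?s ?F")
proof
  fix x :: real
  define i where "i = \<lfloor>x\<rfloor>"
  define t where "t = x - of_int i"
  have t: "0 \<le> t" "t \<le> 1" unfolding t_def i_def by linarith+
  have c: "center (1/2) 0 i = of_int i + 1/2" by (simp add: center_def)
  have xt: "x - (of_int i + 1/2) = t - 1/2" by (simp add: t_def)
  have "unit_map 1 ?s ?F x = center (1/2) 0 i + twist (?s (2 * i + 1)) ?F (x - center (1/2) 0 i)"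
    by (simp add: unit_map_def blocks_def Let_def i_def)
  also have "\<dots> = (if \<sigma> (of_int i + 1/2) = Lb then of_int i + \<nu> t else of_int i + flip_conj \<nu> t)"
    unfolding letter_sign_odd[OF \<sigma>] c xt using t flip_conj_eq[OF \<nu>, of t]
    by (simp add: twist_def recenter_def extend_I_def)
  also have "\<dots> = zeta \<sigma> \<nu> x" by (simp add: zeta_def Let_def i_def t_def)
  finally show "zeta \<sigma> \<nu> x = unit_map 1 ?s ?F x" by simp
qed

lemma chi_unit_map:
  assumes \<sigma>: "labelling \<sigma>" and \<nu>: "\<nu> ` {0..1} \<subseteq> {0..1}"
  shows "chi \<sigma> \<nu> = unit_map 0 (letter_sign \<sigma>) (recenter (extend_I \<nu>))" (is "_ = unit_map 0 ?s ?F")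
proof
  fix x :: real
  define i where "i = \<lfloor>x + 1/2\<rfloor>"
  define t where "t = x - (of_int i - 1/2)"
  have t: "0 \<le> t" "t \<le> 1" unfolding t_def i_def by linarith+
  have c: "center (1/2) (- (1/2)) i = of_int i" by (simp add: center_def field_simps)
  have xt: "x - of_int i = t - 1/2" by (simp add: t_def)
  have "unit_map 0 ?s ?F x = center (1/2) (- (1/2)) i + twist (?s (2 * i)) ?F (x - center (1/2) (- (1/2)) i)"
    by (simp add: unit_map_def blocks_def Let_def i_def)
  also have "\<dots> = (if \<sigma> (of_int i) = La then of_int i - 1/2 + \<nu> t else of_int i - 1/2 + flip_conj \<nu> t)"
    unfolding letter_sign_even[OF \<sigma>] c xt using t flip_conj_eq[OF \<nu>, of t]
    by (simp add: twist_def recenter_def extend_I_def)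
  also have "\<dots> = chi \<sigma> \<nu> x" by (simp add: chi_def Let_def i_def t_def)
  finally show "chi \<sigma> \<nu> x = unit_map 0 ?s ?F x" by simp
qed

text \<open>Conjugation by powers of \<open>\<nu>\<^sub>1\<close>, which expands near \<open>0\<close> and \<open>1\<close>, moves any compact subset of
  the open unit interval into \<open>[1/16, 15/16]\<close>.\<close>

lemma dyad_PL_c_unit_generated:
  assumes L: "subgroup L Homeo_plus_R" "L \<subseteq> dyad_PL" and sub: "dyad_PL_on (1/16) (15/16) \<subseteq> L"
    and N: "N \<in> L" "\<And>x. 0 < x \<Longrightarrow> x < 1/16 \<Longrightarrow> N x = 2 * x" "\<And>x. 15/16 < x \<Longrightarrow> x < 1 \<Longrightarrow> N x = 1 - 2 * (1 - x)"
  shows "dyad_PL_c 0 1 \<subseteq> L"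
proof
  have Nm: "strict_mono N" using subgroup_Homeo_carrier[OF L(1) N(1)] by blast
  \<comment> \<open>\<open>N\<close> doubles the distance to an end while that distance is below
    \<open>1/16\<close>; \<open>j\<close> applications bring points at distance at least
    \<open>(1/2) ^ j / 16\<close> from the ends into the middle part.\<close>
  have ex: "\<exists>M\<in>L. 1/16 \<le> M r \<and> M s \<le> 15/16" if "(1/2) ^ j / 16 \<le> r" "s \<le> 1 - (1/2) ^ j / 16" for j r s
    using that
  proof (induction j arbitrary: r s)
    case 0
    then show ?case using subgroup_Homeo_id[OF L(1)] by (intro bexI[of _ id]) auto
  next
    case (Suc j)
    have pos: "(0::real) < (1/2) ^ j" "(1/2) ^ j \<le> (1::real)" by (simp_all add: power_le_one)
    have "(0::real) < (1/2) ^ Suc j / 16" by simp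
    then have r0: "0 < r" and s1: "s < 1" using Suc.prems by linarith+
    have "(1/2) ^ j / 16 \<le> N r"
    proof (cases "r < 1/16")
      case True
      then show ?thesis using N(2)[of r] Suc.prems(1) pos r0 by simp
    next
      case False
      \<comment> \<open>The formula for \<open>N\<close> ends at \<open>1/16\<close>; comparison
        with \<open>1/32\<close>, whose image is \<open>1/16\<close>, suffices.\<close>
      then have "N (1/32) < N r" by (simp add: strict_mono_less[OF Nm])
      then show ?thesis using N(2)[of "1/32"] pos by simp
    qed
    moreover have "N s \<le> 1 - (1/2) ^ j / 16"
    proof (cases "15/16 < s")
      case True
      then show ?thesis using N(3)[of s] Suc.prems(2) pos s1 by simp
    next
      case False
      then have "N s < N (31/32)" by (simp add: strict_mono_less[OF Nm])
      then show ?thesis using N(3)[of "31/32"] pos by simp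
    qed
    ultimately obtain M where "M \<in> L" "1/16 \<le> M (N r)" "M (N s) \<le> 15/16" using Suc.IH by blast
    then show ?case using subgroup_Homeo_comp[OF L(1) _ N(1)] by (intro bexI[of _ "M \<circ> N"]) auto
  qed
  fix f assume "f \<in> dyad_PL_c 0 1"
  then obtain r s where f: "f \<in> dyad_PL" and rs: "r \<in> dyad" "s \<in> dyad" "0 < r" "r < s" "s < 1"
    "\<And>x. x \<le> r \<or> s \<le> x \<Longrightarrow> f x = x" by (rule dyad_PL_cE) blast
  obtain j where "(1/2) ^ j < min r (1 - s)" using real_arch_pow_inv[of "min r (1 - s)" "1/2"] rs by auto
  then have "(1/2) ^ j < r" "(1/2) ^ j < 1 - s" "(0::real) < (1/2) ^ j" by simp_all
  then have "(1/2) ^ j / 16 \<le> r" "s \<le> 1 - (1/2) ^ j / 16" by linarith+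
  then obtain M where M: "M \<in> L" "1/16 \<le> M r" "M s \<le> 15/16" using ex by blast
  note Mm = subgroup_Homeo_carrier[OF L(1) M(1)]
  note Mi = inv_strict_mono_surj[OF Mm]
  have iL: "inv_into UNIV M \<in> L" by (rule subgroup_Homeo_inv[OF L(1) M(1)])
  have "M \<circ> f \<circ> inv_into UNIV M \<in> dyad_PL_on (1/16) (15/16)"
  proof -
    have "M \<circ> f \<circ> inv_into UNIV M \<in> dyad_PL" using f M iL L(2) by (intro dyad_PL_comp) auto
    moreover have "(M \<circ> f \<circ> inv_into UNIV M) x = x" if "x \<notin> {1/16..15/16}" for x
    proof -
      have "inv_into UNIV M x \<le> r \<or> s \<le> inv_into UNIV M x"
        using that M strict_mono_less_eq[OF Mm(1), of "inv_into UNIV M x" r]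
          strict_mono_less_eq[OF Mm(1), of s "inv_into UNIV M x"] by (auto simp: Mi)
      then show ?thesis using rs(6) by (simp add: Mi)
    qed
    ultimately show ?thesis by (simp add: dyad_PL_on_def)
  qed
  then have mid: "M \<circ> f \<circ> inv_into UNIV M \<in> L" using sub by blast
  have "inv_into UNIV M \<circ> (M \<circ> f \<circ> inv_into UNIV M) \<circ> M \<in> L"
    by (rule subgroup_Homeo_comp[OF L(1) subgroup_Homeo_comp[OF L(1) iL mid] M(1)])
  moreover have "inv_into UNIV M \<circ> (M \<circ> f \<circ> inv_into UNIV M) \<circ> M = f" by (simp add: fun_eq_iff Mi)
  ultimately show "f \<in> L" by simp
qed

text \<open>The preimage of \<open>K\<close> under the homomorphism
  \<open>F \<mapsto> unit_map c V (recenter F)\<close>; with it, membership in \<open>K\<close> is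
  checked on generators only.\<close>

lemma subgroup_unit_map:
  assumes K: "subgroup K Homeo_plus_R"
  shows "subgroup {F \<in> dyad_PL_on 0 1. unit_map c V (recenter F) \<in> K} Homeo_plus_R" (is "subgroup ?L _")
proof (rule subgroup_HomeoI)
  note sub = subgroup_dyad_PL_on[of 0 1]
  have r: "recenter id = id" by (simp add: recenter_def fun_eq_iff)
  show "id \<in> ?L" using subgroup_Homeo_id[OF sub] subgroup_Homeo_id[OF K] by (simp add: r unit_map_id)
  fix F assume F: "F \<in> ?L"
  then have Fm: "strict_mono F" "surj F" using subgroup_Homeo_carrier[OF sub] by blast+
  then show "strict_mono F \<and> surj F" by simp
  have Fi: "inv_into UNIV F \<in> dyad_PL_on 0 1" using F subgroup_Homeo_inv[OF sub] by blast
  let ?u = "unit_map c V (recenter F)" and ?v = "unit_map c V (recenter (inv_into UNIV F))"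
  have "F \<circ> inv_into UNIV F = id" by (simp add: fun_eq_iff inv_strict_mono_surj(3)[OF Fm])
  then have "?u \<circ> ?v = id"
    using F Fi unit_map_comp[of "recenter F" "recenter (inv_into UNIV F)" c V, symmetric]
      recenter_PL_on recenter_comp[of F "inv_into UNIV F", symmetric] by (simp add: r unit_map_id del: comp_apply)
  then have "?u (?v x) = x" for x by (simp add: fun_eq_iff)
  moreover have um: "strict_mono ?u" "surj ?u" using F subgroup_Homeo_carrier[OF K] by blast+
  ultimately have "?v = inv_into UNIV ?u" using inv_strict_mono_surj(4)[OF um] by (metis ext)
  then have "?v \<in> K" using F subgroup_Homeo_inv[OF K] by simp
  then show "inv_into UNIV F \<in> ?L" using Fi by blast
  fix G assume G: "G \<in> ?L"
  have "unit_map c V (recenter (F \<circ> G)) = ?u \<circ> unit_map c V (recenter G)"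
    unfolding recenter_comp using F G by (intro unit_map_comp recenter_PL_on) auto
  then show "F \<circ> G \<in> ?L"
    using F G subgroup_Homeo_comp[OF sub] subgroup_Homeo_comp[OF K] by auto
qed

text \<open>\<open>c0\<close> acts on \<open>(0, 1/4)\<close> and its mirror image on
  \<open>(3/4, 1)\<close>, so near each end only one factor of \<open>\<nu>\<^sub>1\<close> is felt,
  and it doubles the distance to that end.\<close>

lemma nu1_properties:
  assumes c0: "c0 \<in> thompson_F" and supp: "supp_I c0 = {0<..<1/4}"
    and dbl: "\<And>t. t \<in> {0<..<1/16} \<Longrightarrow> c0 t = 2 * t"
  shows "nu1 c0 ` {0..1} \<subseteq> {0..1}" "extend_I (nu1 c0) \<in> dyad_PL_on 0 1"
    "0 < x \<Longrightarrow> x < 1/16 \<Longrightarrow> extend_I (nu1 c0) x = 2 * x"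
    "15/16 < x \<Longrightarrow> x < 1 \<Longrightarrow> extend_I (nu1 c0) x = 1 - 2 * (1 - x)"
proof -
  have C: "c0 \<in> carrier Homeo_I" using c0 by (simp add: thompson_F_def)
  have im: "c0 ` {0..1} \<subseteq> {0..1}" using Homeo_I_image[OF C] by simp
  have c0_in: "c0 t \<in> {0..1}" if "t \<in> {0..1}" for t using im that by blast
  note fc = flip_conj_eq[OF im]
  have nu: "nu1 c0 t = 1 - c0 (1 - c0 t)" if "t \<in> {0..1}" for t
    using that fc[OF c0_in[OF that]] by (simp add: nu1_def homeo_group_mult compose_def)
  have fixed: "c0 t = t" if "t \<in> {0..1}" "1/4 \<le> t" for t
  proof (rule ccontr)
    assume "c0 t \<noteq> t"
    then have "t \<in> supp_I c0" using that by (simp add: supp_I_def)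
    then show False using that supp by simp
  qed
  show "nu1 c0 ` {0..1} \<subseteq> {0..1}"
  proof
    fix y assume "y \<in> nu1 c0 ` {0..1}"
    then obtain t where t: "t \<in> {0..1}" "y = nu1 c0 t" by blast
    have "1 - c0 t \<in> {0..1}" using c0_in[OF t(1)] by simp
    then have "c0 (1 - c0 t) \<in> {0..1}" by (rule c0_in)
    then show "y \<in> {0..1}" using nu[OF t(1)] t(2) by simp
  qed
  define E where "E = extend_I c0"
  have E: "E \<in> dyad_PL" unfolding E_def by (rule extend_I_dyad_PL[OF c0])
  \<comment> \<open>The conjugate of \<open>E\<close> by \<open>x \<mapsto> 1 - x\<close>.\<close>
  define E' where "E' = (\<lambda>x. x + 1) \<circ> ((\<lambda>x. - E (- x)) \<circ> (\<lambda>x. x + - 1))"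
  have E': "E' \<in> dyad_PL" unfolding E'_def
    by (intro dyad_PL_comp dyad_PL_translation dyad_PL_reflect[OF E] dyad_uminus) auto
  have "extend_I (nu1 c0) x = E' (E x)" for x
  proof (cases "x \<in> {0..1}")
    case True
    then show ?thesis using nu[OF True] c0_in[OF True] by (simp add: E'_def E_def extend_I_def)
  next
    case False
    then show ?thesis by (auto simp: E'_def E_def extend_I_def)
  qed
  then have "extend_I (nu1 c0) = E' \<circ> E" by (simp add: fun_eq_iff)
  then have "extend_I (nu1 c0) \<in> dyad_PL" using dyad_PL_comp[OF E' E] by simp
  then show "extend_I (nu1 c0) \<in> dyad_PL_on 0 1" by (simp add: dyad_PL_on_def extend_I_def)
  show "extend_I (nu1 c0) x = 2 * x" if "0 < x" "x < 1/16"
    using that nu[of x] dbl[of x] fixed[of "1 - 2 * x"] by (simp add: extend_I_def)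
  show "extend_I (nu1 c0) x = 1 - 2 * (1 - x)" if "15/16 < x" "x < 1"
    using that nu[of x] dbl[of "1 - x"] fixed[of x] by (simp add: extend_I_def)
qed

text \<open>At indices of fixed parity a letter is determined by its sign, so even shifts preserving
  all signs are periods of \<sigma>. A nonzero remainder of such a period modulo the least one would
  be a smaller period.\<close>

lemma labelling_minimal_period:
  assumes "periodic_labelling \<sigma>"
  obtains n :: nat where "n > 0" "\<And>i. letter_sign \<sigma> (i + 2 * int n) = letter_sign \<sigma> i"
    "\<And>q. (\<And>i. letter_sign \<sigma> (i + 2 * q) = letter_sign \<sigma> i) \<Longrightarrow> int n dvd q"
proof -
  have lab: "labelling \<sigma>" using assms by (simp add: periodic_labelling_def)
  define P where "P p \<longleftrightarrow> p > 0 \<and> (\<forall>j\<in>half_integers. \<sigma> (j + real p) = \<sigma> j)" for p :: nat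
  define n where "n = (LEAST p. P p)"
  have "\<exists>p. P p" using assms by (auto simp: periodic_labelling_def P_def)
  then have n: "P n" unfolding n_def by (rule LeastI_ex)
  have sn: "letter_sign \<sigma> (i + 2 * int n) = letter_sign \<sigma> i" for i
  proof -
    have "of_int i / 2 \<in> half_integers" by (auto simp: half_integers_def)
    then have "\<sigma> (of_int i / 2 + real n) = \<sigma> (of_int i / 2)" using n by (simp add: P_def)
    moreover have "of_int (i + 2 * int n) / 2 = of_int i / 2 + real n" by (simp add: field_simps)
    ultimately show ?thesis by (simp only: letter_sign_def)
  qed
  have snk: "letter_sign \<sigma> (i + 2 * int n * k) = letter_sign \<sigma> i" for i k
    by (rule int_periodic) (rule sn)
  have \<sigma>_eq: "\<sigma> (of_int i + of_int r / 2) = \<sigma> (of_int r / 2)"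
    if "letter_sign \<sigma> (r + 2 * i) = letter_sign \<sigma> r" for i r
  proof (cases "even r")
    case True
    then obtain k where k: "r = 2 * k" by (elim evenE)
    have "letter_sign \<sigma> (2 * (k + i)) = letter_sign \<sigma> (2 * k)" using that k by (simp add: algebra_simps)
    moreover have "\<sigma> (of_int (k + i)) \<in> {La, La_inv}" "\<sigma> (of_int k) \<in> {La, La_inv}"
      using lab Ints_of_int unfolding labelling_def by blast+
    ultimately have "\<sigma> (of_int (k + i)) = \<sigma> (of_int k)"
      unfolding letter_sign_even[OF lab] by (auto split: if_splits)
    then show ?thesis using k by (simp add: add.commute)
  next
    case False
    then obtain k where k: "r = 2 * k + 1" by (elim oddE)
    have "letter_sign \<sigma> (2 * (k + i) + 1) = letter_sign \<sigma> (2 * k + 1)" using that k by (simp add: algebra_simps)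
    then have eq: "\<sigma> (of_int (k + i) + 1/2) = Lb \<longleftrightarrow> \<sigma> (of_int k + 1/2) = Lb"
      unfolding letter_sign_odd[OF lab] by (auto split: if_splits)
    have "\<sigma> (of_int (k + i) + 1/2) = \<sigma> (of_int k + 1/2)" 
      using eq labelling_odd[OF lab, of "k + i"] labelling_odd[OF lab, of k] by auto
    moreover have "of_int i + of_int r / 2 = (of_int (k + i) + 1/2 :: real)" "of_int r / 2 = (of_int k + 1/2 :: real)"
      using k by (simp_all add: field_simps)
    ultimately show ?thesis by (simp only:)
  qed
  have min: "int n dvd q" if q: "\<And>i. letter_sign \<sigma> (i + 2 * q) = letter_sign \<sigma> i" for q
  proof (rule ccontr)
    assume ndvd: "\<not> int n dvd q"
    define r where "r = nat (q mod int n)"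
    have n0: "int n > 0" using n by (simp add: P_def)
    have r: "int r = q mod int n" using n0 by (simp add: r_def)
    have rn: "0 < r" "r < n"
      using ndvd r n0 pos_mod_bound[OF n0, of q] by (auto simp: dvd_eq_mod_eq_0 intro: gr0I)
    have "q = int r + int n * (q div int n)" unfolding r by simp
    then have rq: "i + 2 * q = (i + 2 * int r) + 2 * int n * (q div int n)" for i by (simp add: algebra_simps)
    have "letter_sign \<sigma> (i + 2 * int r) = letter_sign \<sigma> i" for i
      using q[of i] snk[of "i + 2 * int r" "q div int n"] unfolding rq by simp
    then have "\<sigma> (of_int (int r) + of_int i / 2) = \<sigma> (of_int i / 2)" for i by (rule \<sigma>_eq)
    note \<sigma>_r = this
    have "\<sigma> (j + real r) = \<sigma> j" if j: "j \<in> half_integers" for j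
    proof -
      obtain i where ji: "j = of_int i / 2" using j unfolding half_integers_def by blast
      show ?thesis unfolding ji using \<sigma>_r[of i] by (simp add: add.commute)
    qed
    then have "P r" using rn by (simp add: P_def)
    then have "n \<le> r" unfolding n_def by (rule Least_le)
    then show False using rn by simp
  qed
  show ?thesis using that[of n] n sn min by (simp add: P_def)
qed

theorem lemma4p5:
  fixes c\<^sub>0 \<nu>\<^sub>2 \<nu>\<^sub>3 :: "real \<Rightarrow> real" and \<sigma> :: "real \<Rightarrow> letter"
  assumes "c\<^sub>0 \<in> thompson_F"
    and "supp_I c\<^sub>0 = {0<..<1/4}"
    and "\<And>x. x \<in> {0<..<1/4} \<Longrightarrow> c\<^sub>0 x > x"
    and "\<And>t. t \<in> {0<..<1/16} \<Longrightarrow> c\<^sub>0 t = 2 * t"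
    and "\<nu>\<^sub>2 \<in> carrier Homeo_I" and "supp_I \<nu>\<^sub>2 \<subseteq> {1/16<..<15/16}"
    and "\<nu>\<^sub>3 \<in> carrier Homeo_I" and "supp_I \<nu>\<^sub>3 \<subseteq> {1/16<..<15/16}"
    and "generate Homeo_I {\<nu>\<^sub>2, \<nu>\<^sub>3} = thompson_F_on (1/16) (15/16)"
    and "periodic_labelling \<sigma>"
  shows "\<exists>n::nat. n > 0 \<and>
    (\<exists>j \<phi>. short_exact integer_group (G_group (nu1 c\<^sub>0) \<nu>\<^sub>2 \<nu>\<^sub>3 \<sigma>) (T_group n) j \<phi>)"
proof -
  let ?\<nu>\<^sub>1 = "nu1 c\<^sub>0"
  let ?A = "dyad_PL_on (1/16) (15/16)"
  have lab: "labelling \<sigma>" using assms(10) by (simp add: periodic_labelling_def)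
  note nu1 = nu1_properties[OF assms(1,2,4)]
  have gen: "generate Homeo_plus_R {extend_I \<nu>\<^sub>2, extend_I \<nu>\<^sub>3} = ?A"
    by (rule generate_extend_I[OF assms(9)]) simp
  have A01: "?A \<subseteq> dyad_PL_on 0 1" by (auto simp: dyad_PL_on_def)
  have "extend_I \<nu>\<^sub>2 \<in> ?A" "extend_I \<nu>\<^sub>3 \<in> ?A" unfolding gen[symmetric] by (auto intro: generate.incl)
  then have ext: "extend_I \<nu> \<in> dyad_PL_on 0 1" if "\<nu> \<in> {?\<nu>\<^sub>1, \<nu>\<^sub>2, \<nu>\<^sub>3}" for \<nu>
    using that A01 nu1(2) by auto
  have range: "\<nu> ` {0..1} \<subseteq> {0..1}" if "\<nu> \<in> {?\<nu>\<^sub>1, \<nu>\<^sub>2, \<nu>\<^sub>3}" for \<nu>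
    using that nu1(1) Homeo_I_image[OF assms(5)] Homeo_I_image[OF assms(7)] by auto
  obtain n where n: "n > 0" "\<And>i. letter_sign \<sigma> (i + 2 * int n) = letter_sign \<sigma> i"
    "\<And>q. (\<And>i. letter_sign \<sigma> (i + 2 * q) = letter_sign \<sigma> i) \<Longrightarrow> int n dvd q"
    using labelling_minimal_period[OF assms(10)] by blast
  let ?s = "letter_sign \<sigma>"
  let ?G = "G_group ?\<nu>\<^sub>1 \<nu>\<^sub>2 \<nu>\<^sub>3 \<sigma>"
  let ?S = "{zeta \<sigma> ?\<nu>\<^sub>1, zeta \<sigma> \<nu>\<^sub>2, zeta \<sigma> \<nu>\<^sub>3, chi \<sigma> ?\<nu>\<^sub>1, chi \<sigma> \<nu>\<^sub>2, chi \<sigma> \<nu>\<^sub>3}"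
  define K where "K = generate Homeo_plus_R ?S"
  have um: "unit_map c ?s (recenter (extend_I \<nu>)) \<in> ?S" if "\<nu> \<in> {?\<nu>\<^sub>1, \<nu>\<^sub>2, \<nu>\<^sub>3}" "c \<in> {0, 1}" for \<nu> c
    using that zeta_unit_map[OF lab range[OF that(1)]] chi_unit_map[OF lab range[OF that(1)]] by auto
  have S_PL: "?S \<subseteq> periodic_PL n"
  proof -
    have "zeta \<sigma> \<nu> \<in> periodic_PL n \<and> chi \<sigma> \<nu> \<in> periodic_PL n" if "\<nu> \<in> {?\<nu>\<^sub>1, \<nu>\<^sub>2, \<nu>\<^sub>3}" for \<nu>
      unfolding zeta_unit_map[OF lab range[OF that]] chi_unit_map[OF lab range[OF that]]
      using unit_map_periodic[where V = ?s, OF recenter_PL_on[OF ext[OF that]] n(2)] by blast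
    then show ?thesis by blast
  qed
  then have S_carrier: "?S \<subseteq> carrier Homeo_plus_R"
    using subgroup.subset[OF subgroup_periodic_PL] by (rule subset_trans)
  have K: "subgroup K Homeo_plus_R" unfolding K_def by (rule Homeo.generate_is_subgroup[OF S_carrier])
  have carrier_G: "carrier ?G = K"
    unfolding G_group_def K_def carrier_subgroup_generated using S_carrier by (simp only: Int_absorb1)
  have unit_K: "unit_map c ?s h \<in> K" if h: "h \<in> dyad_PL_c (- (1/2)) (1/2)" for c h
  proof -
    \<comment> \<open>Only the parity of \<open>c\<close> matters; the representatives 0 and 1
      belong to \<open>chi\<close> and \<open>zeta\<close>.\<close>
    define c' where "c' = c mod 2"
    have c': "c' \<in> {0, 1}" "even (c - c')" by (auto simp: c'_def)
    let ?L = "{F \<in> dyad_PL_on 0 1. unit_map c' ?s (recenter F) \<in> K}"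
    have L: "subgroup ?L Homeo_plus_R" by (rule subgroup_unit_map[OF K])
    have gen_L: "extend_I \<nu> \<in> ?L" if "\<nu> \<in> {?\<nu>\<^sub>1, \<nu>\<^sub>2, \<nu>\<^sub>3}" for \<nu>
      using ext[OF that] um[OF that c'(1)] by (auto simp: K_def intro: generate.incl)
    \<comment> \<open>\<open>\<nu>\<^sub>2\<close> and \<open>\<nu>\<^sub>3\<close> account for the
      maps on \<open>[1/16, 15/16]\<close>; conjugation by powers of \<open>\<nu>\<^sub>1\<close>
      then reaches all compactly supported ones.\<close>
    have LA: "?A \<subseteq> ?L" unfolding gen[symmetric]
      by (rule Homeo.generate_subgroup_incl[OF _ L]) (use gen_L in blast)
    have LPL: "?L \<subseteq> dyad_PL" by (auto simp: dyad_PL_on_def)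
    have sub: "dyad_PL_c 0 1 \<subseteq> ?L"
      using gen_L[of ?\<nu>\<^sub>1] nu1(3,4) by (intro dyad_PL_c_unit_generated[OF L LPL LA, of "extend_I ?\<nu>\<^sub>1"]) auto
    obtain r q where rq: "h \<in> dyad_PL" "r \<in> dyad" "q \<in> dyad" "- (1/2) < r" "r < q" "q < 1/2"
      "\<And>x. x \<le> r \<or> q \<le> x \<Longrightarrow> h x = x" using h by (rule dyad_PL_cE) blast
    define F where "F = (\<lambda>x. x + 1/2) \<circ> (h \<circ> (\<lambda>x. x + - (1/2)))"
    have "F \<in> dyad_PL_c 0 1"
    proof (rule dyad_PL_cI[of _ _ "r + 1/2" "q + 1/2"])
      show "F \<in> dyad_PL" unfolding F_def using rq(1) by (intro dyad_PL_comp dyad_PL_translation dyad_uminus) auto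
      fix x assume "x < r + 1/2 \<or> q + 1/2 < x"
      then show "F x = x" using rq(7)[of "x - 1/2"] by (auto simp: F_def)
    qed (use rq in auto)
    then have "unit_map c' ?s (recenter F) \<in> K" using sub by blast
    moreover have "recenter F = h" by (simp add: recenter_def F_def fun_eq_iff)
    ultimately show ?thesis using unit_map_parity[OF dyad_PL_c_on[OF h] c'(2)] by simp
  qed
  have sgn: "?s i \<in> {1, - 1}" for i by (simp add: letter_sign_def)
  interpret labelled_line n ?s K
  proof (rule labelled_line.intro, goal_cases)
    case 6
    show ?case unfolding K_def by (rule Homeo.generate_subgroup_incl[OF S_PL subgroup_periodic_PL])
  next
    \<comment> \<open>The locale assumption \<open>perfect\<close>, obtained from generation by
      \<open>\<nu>\<^sub>2\<close> and \<open>\<nu>\<^sub>3\<close>.\<close>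
    case 8
    then show ?case by (rule dyad_PL_c_perfect[OF gen])
  qed (fact n sgn K | rule n(3) unit_K; assumption)+
  have "group ?G" unfolding G_group_def by (rule Homeo.group_subgroup_generated)
  moreover have "g \<otimes>\<^bsub>?G\<^esub> h = h \<circ> g" for g h by (simp add: G_group_def)
  ultimately have "short_exact integer_group ?G (T_group n) (\<lambda>k x. x + real n * of_int k) (descend n)"
    using carrier_G K_eq by (intro periodic_PL_short_exact[OF n(1)]) simp_all
  then show ?thesis using n(1) by blast
qed

end
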